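(* Let $A,B$ be arbitrary quantities independent of $\tau$. Then the five theta-constants $\theta_1'=\theta_1'(A\tau+B|\tau)$, $\theta_k=\theta_k(A\tau+B|\tau)$ ($k=1,2,3,4$) are differentially closed over $\mathbb C(\vartheta^2,\eta;\pi,A)$: $$\frac{d\theta_k}{d\tau}=\frac{-i}{4\pi}(\theta_1'+4\pi iA\,\theta_1)\,\theta_1'\,\frac{\theta_k}{\theta_1^2}+\frac i2\,\vartheta_k^2\,(\theta_1'+2\pi iA\,\theta_1)\,\frac{\theta_\nu\theta_\mu}{\theta_1^2}+\frac{\pi i}{4}\Big\{\vartheta_3^2\vartheta_4^2\,\theta_2^2-\vartheta_k^2\vartheta_\mu^2\,\theta_\nu^2-\vartheta_k^2\vartheta_\nu^2\,\theta_\mu^2\Big\}\frac{\theta_k}{\theta_1^2}+\frac i\pi\Big\{\eta+\frac{\pi^2}{12}(\vartheta_3^4+\vartheta_4^4)\Big\}\theta_k,$$ $$\frac{d\theta_1'}{d\tau}=\frac{i}{4\pi}(3\theta_1'+4\pi iA\,\theta_1)\Big\{\pi^2\vartheta_3^2\vartheta_4^2\,\frac{\theta_2^2}{\theta_1^2}+4\eta+\frac{\pi^2}{3}(\vartheta_3^4+\vartheta_4^4)\Big\}-\frac{i}{4\pi}(\theta_1'+4\pi iA\,\theta_1)\frac{(\theta_1')^2}{\theta_1^2}-\frac i2\,\pi^2\,\vartheta_2^2\vartheta_3^2\vartheta_4^2\,\frac{\theta_2\theta_3\theta_4}{\theta_1^2},$$ where $k=1,2,3,4$ and $$\nu=\frac{8k-28}{3k-10},\qquad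 \mu=\frac{10k-28}{3k-8}.$$
   Context: Theta functions: for integers $a,b$, $\theta\big[{a\atop b}\big](z|\tau)=\sum_{k\in\mathbb Z}\exp\big(\pi i(k+\tfrac a2)^2\tau+2\pi i(k+\tfrac a2)(z+\tfrac b2)\big)$ with $\tau$ in the upper half-plane, and $\theta_1=-\theta\big[{1\atop1}\big]$, $\theta_2=\theta\big[{1\atop0}\big]$, $\theta_3=\theta\big[{0\atop0}\big]$, $\theta_4=\theta\big[{0\atop1}\big]$; $\vartheta_k=\vartheta_k(\tau)=\theta_k(0|\tau)$ (so $\vartheta_1\equiv0$); $\theta_1'(z|\tau)=\partial_z\theta_1(z|\tau)$. $\eta=\eta(\tau)=\zeta(1|\tau)$ is Weierstrass' zeta function with half-periods $1,\tau$ evaluated at $1$. $d/d\tau$ denotes the total derivative along $z=A\tau+B$. For $k=2,3,4$ the triple $(k,\nu,\mu)$ runs over the cyclic permutations of $(2,3,4)$; for $k=1$ all terms containing the factor $\vartheta_k=\vartheta_1\equiv0$ are dropped. The case $\theta_1(A\tau+B|\tau)\equiv0$ (e.g. $A\tau+B=0$) is understood as a limiting case of the formulas. $\mathbb C(\vartheta^2,\eta;\pi,A)$ is the field generated by $\vartheta_2^2,\vartheta_3^2,\vartheta_4^2,\eta,\pi,A$. *)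

theory Defs
  imports "HOL-Complex_Analysis.Complex_Analysis"
begin

definition upper_half_plane :: "complex set" where
  "upper_half_plane = {\<tau>. Im \<tau> > 0}"

definition theta_char :: "int \<Rightarrow> int \<Rightarrow> complex \<Rightarrow> complex \<Rightarrow> complex" where
  "theta_char a b z \<tau> =
     (\<Sum>\<^sub>\<infinity>k\<in>(UNIV :: int set).
        exp (pi * \<i> * (of_int k + of_int a / 2)^2 * \<tau>
             + 2 * pi * \<i> * (of_int k + of_int a / 2) * (z + of_int b / 2)))"

text \<open>Only the indices 1, 2, 3, 4 are meaningful; the value 0 elsewhere is junk.\<close>

definition theta :: "nat \<Rightarrow> complex \<Rightarrow> complex \<Rightarrow> complex" where
  "theta k z \<tau> =
     (if k = 1 then - theta_char 1 1 z \<tau>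
      else if k = 2 then theta_char 1 0 z \<tau>
      else if k = 3 then theta_char 0 0 z \<tau>
      else if k = 4 then theta_char 0 1 z \<tau>
      else 0)"

definition theta1' :: "complex \<Rightarrow> complex \<Rightarrow> complex" where
  "theta1' z \<tau> = deriv (\<lambda>w. theta 1 w \<tau>) z"

definition vartheta :: "nat \<Rightarrow> complex \<Rightarrow> complex" where
  "vartheta k \<tau> = theta k 0 \<tau>"

text \<open>The arguments of the zeta function are half-periods, so the period lattice is
  generated by \<open>2 * \<omega>\<close> and \<open>2 * \<omega>'\<close>.\<close>

definition period_lattice :: "complex \<Rightarrow> complex \<Rightarrow> complex set" where
  "period_lattice \<omega> \<omega>' = {2 * of_int m * \<omega> + 2 * of_int n * \<omega>' | m n :: int. True}"

definition weierstrass_zeta :: "complex \<Rightarrow> complex \<Rightarrow> complex \<Rightarrow> complex" where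
  "weierstrass_zeta \<omega> \<omega>' z =
     1 / z + (\<Sum>\<^sub>\<infinity>w\<in>period_lattice \<omega> \<omega>' - {0}. 1 / (z - w) + 1 / w + z / w^2)"

definition eta :: "complex \<Rightarrow> complex" where
  "eta \<tau> = weierstrass_zeta 1 \<tau> 1"

text \<open>For \<open>k = 2, 3, 4\<close> the divisions are exact and \<open>(k, nu k, mu k)\<close> is a cyclic
  permutation of \<open>(2, 3, 4)\<close>. For \<open>k = 1\<close> the quotients are not integers, so the
  values are junk; every term in which they are used below carries the factor
  \<open>vartheta 1\<close>, which is identically zero.\<close>

definition nu :: "nat \<Rightarrow> nat" where
  "nu k = nat ((8 * int k - 28) div (3 * int k - 10))"

definition mu :: "nat \<Rightarrow> nat" where
  "mu k = nat ((10 * int k - 28) div (3 * int k - 8))"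

lemma nu_mu_values:
  "(nu 2, mu 2) = (3, 4)" "(nu 3, mu 3) = (4, 2)" "(nu 4, mu 4) = (2, 3)"
  by (simp_all add: nu_def mu_def)

text \<open>Right-hand sides of the differential equations, with \<open>z\<close> in place of \<open>A * \<tau> + B\<close>.\<close>

definition theta_rhs :: "nat \<Rightarrow> complex \<Rightarrow> complex \<Rightarrow> complex \<Rightarrow> complex" where
  "theta_rhs k A z \<tau> =
     - \<i> / (4 * pi) * (theta1' z \<tau> + 4 * pi * \<i> * A * theta 1 z \<tau>) * theta1' z \<tau>
         * (theta k z \<tau> / (theta 1 z \<tau>)^2)
     + \<i> / 2 * (vartheta k \<tau>)^2 * (theta1' z \<tau> + 2 * pi * \<i> * A * theta 1 z \<tau>)
         * (theta (nu k) z \<tau> * theta (mu k) z \<tau> / (theta 1 z \<tau>)^2)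
     + pi * \<i> / 4
         * ((vartheta 3 \<tau>)^2 * (vartheta 4 \<tau>)^2 * (theta 2 z \<tau>)^2
            - (vartheta k \<tau>)^2 * (vartheta (mu k) \<tau>)^2 * (theta (nu k) z \<tau>)^2
            - (vartheta k \<tau>)^2 * (vartheta (nu k) \<tau>)^2 * (theta (mu k) z \<tau>)^2)
         * (theta k z \<tau> / (theta 1 z \<tau>)^2)
     + \<i> / pi * (eta \<tau> + pi^2 / 12 * ((vartheta 3 \<tau>)^4 + (vartheta 4 \<tau>)^4))
         * theta k z \<tau>"

definition theta1'_rhs :: "complex \<Rightarrow> complex \<Rightarrow> complex \<Rightarrow> complex" where
  "theta1'_rhs A z \<tau> =
     \<i> / (4 * pi) * (3 * theta1' z \<tau> + 4 * pi * \<i> * A * theta 1 z \<tau>)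
         * (pi^2 * (vartheta 3 \<tau>)^2 * (vartheta 4 \<tau>)^2 * ((theta 2 z \<tau>)^2 / (theta 1 z \<tau>)^2)
            + 4 * eta \<tau> + pi^2 / 3 * ((vartheta 3 \<tau>)^4 + (vartheta 4 \<tau>)^4))
     - \<i> / (4 * pi) * (theta1' z \<tau> + 4 * pi * \<i> * A * theta 1 z \<tau>)
         * ((theta1' z \<tau>)^2 / (theta 1 z \<tau>)^2)
     - \<i> / 2 * pi^2 * (vartheta 2 \<tau>)^2 * (vartheta 3 \<tau>)^2 * (vartheta 4 \<tau>)^2
         * (theta 2 z \<tau> * theta 3 z \<tau> * theta 4 z \<tau> / (theta 1 z \<tau>)^2)"

text \<open>The field generated over the complex numbers by a set \<open>G\<close> of meromorphic functions on
  an open connected set \<open>D\<close>. Meromorphic functions are identified when they agree on \<open>D\<close>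
  off a set without accumulation points in \<open>D\<close>; hence the rule \<open>cong\<close>, and hence the
  pointwise inverse represents the reciprocal of any function that is not identically zero.\<close>

inductive_set generated_field :: "complex set \<Rightarrow> (complex \<Rightarrow> complex) set \<Rightarrow> (complex \<Rightarrow> complex) set"
  for D :: "complex set" and G :: "(complex \<Rightarrow> complex) set" where
  gen: "f \<in> G \<Longrightarrow> f \<in> generated_field D G"
| const: "(\<lambda>_. c) \<in> generated_field D G"
| add: "f \<in> generated_field D G \<Longrightarrow> g \<in> generated_field D G \<Longrightarrow>
          (\<lambda>x. f x + g x) \<in> generated_field D G"
| uminus: "f \<in> generated_field D G \<Longrightarrow> (\<lambda>x. - f x) \<in> generated_field D G"
| mult: "f \<in> generated_field D G \<Longrightarrow> g \<in> generated_field D G \<Longrightarrow>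
          (\<lambda>x. f x * g x) \<in> generated_field D G"
| inverse: "f \<in> generated_field D G \<Longrightarrow> (\<lambda>x. inverse (f x)) \<in> generated_field D G"
| cong: "f \<in> generated_field D G \<Longrightarrow> eventually (\<lambda>x. g x = f x) (cosparse D) \<Longrightarrow>
          g \<in> generated_field D G"

definition coeff_field :: "complex \<Rightarrow> (complex \<Rightarrow> complex) set" where
  "coeff_field A = generated_field upper_half_plane
     {\<lambda>\<tau>. (vartheta 2 \<tau>)^2, \<lambda>\<tau>. (vartheta 3 \<tau>)^2, \<lambda>\<tau>. (vartheta 4 \<tau>)^2, eta,
      \<lambda>_. of_real pi, \<lambda>_. A}"

definition five_thetas :: "complex \<Rightarrow> complex \<Rightarrow> (complex \<Rightarrow> complex) set" where
  "five_thetas A B = insert (\<lambda>\<tau>. theta1' (A * \<tau> + B) \<tau>)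
     ((\<lambda>k \<tau>. theta k (A * \<tau> + B) \<tau>) ` {1, 2, 3, 4})"

text \<open>The derivative of each member of \<open>T\<close> is a rational function of the members of \<open>T\<close>
  with coefficients in the field \<open>K\<close> of functions on \<open>D\<close>.\<close>

definition differentially_closed_over ::
    "complex set \<Rightarrow> (complex \<Rightarrow> complex) set \<Rightarrow> (complex \<Rightarrow> complex) set \<Rightarrow> bool" where
  "differentially_closed_over D K T \<longleftrightarrow>
     (\<forall>f\<in>T. f holomorphic_on D \<and> deriv f \<in> generated_field D (K \<union> T))"

definition regular_params :: "complex \<Rightarrow> (complex \<times> complex) set" where
  "regular_params \<tau> = {(A', B'). theta 1 (A' * \<tau> + B') \<tau> \<noteq> 0}"

end

theory Submission
  imports Defs
begin

text \<open>
  Each term of a theta series satisfies the heat equation, so along \<open>z = A * \<tau> + B\<close> the total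
  derivative of any \<open>z\<close>-derivative \<open>F\<close> of a theta function is \<open>A * F' + F'' / (4 * pi * \<i>)\<close>. Hence
  the theorem is a statement about \<open>z\<close>-derivatives at a fixed \<open>\<tau>\<close>, and it follows from two
  identities that hold for all \<open>z\<close>: the Wronskians
  \<open>\<theta>\<^sub>k' \<theta>\<^sub>1 - \<theta>\<^sub>1' \<theta>\<^sub>k = - pi \<vartheta>\<^sub>k^2 \<theta>\<^sub>\<nu> \<theta>\<^sub>\<mu>\<close> (lemma \<open>theta_wronskian\<close>) and the formula for
  \<open>\<theta>\<^sub>1'' \<theta>\<^sub>1 - \<theta>\<^sub>1'^2\<close>, the second logarithmic derivative, as a combination of \<open>\<theta>\<^sub>1^2\<close> and \<open>\<theta>\<^sub>2^2\<close>
  (lemma \<open>theta_log_deriv2_eta\<close>). One further differentiation of each expresses \<open>\<theta>\<^sub>k''\<close> and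
  \<open>\<theta>\<^sub>1'''\<close>, and substitution gives the stated right-hand sides wherever \<open>\<theta>\<^sub>1\<close> does not vanish.
  At a zero of \<open>\<theta>\<^sub>1\<close> the total derivative is still \<open>A * F' + F'' / (4 * pi * \<i>)\<close>, which is continuous
  in \<open>(A, B)\<close> and equals the right-hand side at regular parameters; this is the limiting case.

  The two identities come, up to constants, from rearranging a double series
  (\<open>theta_series_product\<close>): a product of two theta functions at \<open>\<tau>\<close> is a combination of two
  products at \<open>2 * \<tau>\<close>, with arguments \<open>x + y\<close> and \<open>x - y\<close>. Differentiating in \<open>x - y\<close> leaves only
  functions of \<open>x + y\<close>. The constants are fixed at \<open>z = 0\<close>, where the same rearrangement relates
  theta constants at \<open>\<tau>\<close> and \<open>2 * \<tau>\<close>. Iterating \<open>\<tau> \<mapsto> 2 * \<tau>\<close> leads to the leading terms of the series;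
  this shows that the theta constants do not vanish and that the quotient of \<open>\<theta>\<^sub>1'(0)\<close> by
  \<open>\<vartheta>\<^sub>2 \<vartheta>\<^sub>3 \<vartheta>\<^sub>4\<close>, which is invariant under doubling, equals \<open>pi\<close> (\<open>jacobi_derivative\<close>).

  One constant is left, the coefficient of \<open>\<theta>\<^sub>1^2\<close>. Expanding at \<open>z = 0\<close> turns it into
  \<open>\<theta>\<^sub>1'''(0) / \<theta>\<^sub>1'(0)\<close>, so it remains to prove \<open>\<eta> = - \<theta>\<^sub>1'''(0) / (12 \<theta>\<^sub>1'(0))\<close>
  (\<open>eta_eq_theta1_ratio\<close>). Both sides equal \<open>pi^2 / 12\<close> plus half the sum of
  \<open>pi^2 / sin(pi k \<tau>)^2\<close> over \<open>k \<ge> 1\<close>. For the lattice sum one averages over \<open>w\<close> and \<open>- w\<close>, after which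
  a part of every row telescopes to zero and the rest is the series for the squared cosecant.
  For the theta quotient, Rothe's \<open>q\<close>-binomial identity replaces the series of \<open>\<theta>\<^sub>1\<close> by a finite
  sum equal to a constant times the product of \<open>sin(pi (z + k \<tau>))\<close> over \<open>\<bar>k\<bar> \<le> N\<close>, and dominated
  convergence gives the limit for large \<open>N\<close>.

  For differential closure, suppose first that \<open>\<theta>\<^sub>1(A * \<tau> + B|\<tau>)\<close> is not identically zero. Then its
  zeros are isolated, and off them the derivatives are the right-hand sides. If it is identically
  zero, the vanishing of its derivative says \<open>\<theta>\<^sub>1'' = - 4 * pi * \<i> * A * \<theta>\<^sub>1'\<close>, and expanding the two
  identities at a zero of \<open>\<theta>\<^sub>1\<close> with this property shows that each of the other four functions is an
  eigenfunction: its derivative is itself times an element of the coefficient field. If \<open>\<theta>\<^sub>1'\<close> is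
  identically zero as well, all five functions are.
\<close>

section \<open>Infinite sums over the integers\<close>

text \<open>
  Dominated convergence for sums over an arbitrary index set: the domination makes the finite
  partial sums converge uniformly in \<open>n\<close>, so the two limits may be interchanged.
\<close>

lemma tannery_infsum:
  fixes f :: "nat \<Rightarrow> 'a \<Rightarrow> complex"
  assumes lim: "\<And>x. x \<in> X \<Longrightarrow> (\<lambda>n. f n x) \<longlonglongrightarrow> g x"
    and bound: "\<And>n x. x \<in> X \<Longrightarrow> norm (f n x) \<le> M x"
    and M: "M summable_on X"
  shows "(\<lambda>n. \<Sum>\<^sub>\<infinity>x\<in>X. f n x) \<longlonglongrightarrow> (\<Sum>\<^sub>\<infinity>x\<in>X. g x)"
proof (rule swap_uniform_limit'[where S = UNIV and F = "finite_subsets_at_top X"])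
  show "uniform_limit UNIV (\<lambda>Y n. \<Sum>x\<in>Y. f n x) (\<lambda>n. \<Sum>\<^sub>\<infinity>x\<in>X. f n x) (finite_subsets_at_top X)"
    by (rule Weierstrass_m_test_general[OF _ M]) (use bound in auto)
  show "\<forall>\<^sub>F Y in finite_subsets_at_top X. (\<lambda>n. \<Sum>x\<in>Y. f n x) \<longlonglongrightarrow> (\<Sum>x\<in>Y. g x)"
    by (intro eventually_finite_subsets_at_top_weakI tendsto_sum) (use lim in auto)
  have "norm (g x) \<le> M x" if "x \<in> X" for x
    by (rule tendsto_le[OF _ tendsto_const tendsto_norm[OF lim[OF that]]])
       (use bound that in auto)
  then have "(\<lambda>x. norm (g x)) summable_on X"
    by (intro Infinite_Sum.abs_summable_on_comparison_test'[OF M])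
  then have "g summable_on X" by (rule abs_summable_summable)
  then show "((\<lambda>Y. \<Sum>x\<in>Y. g x) \<longlongrightarrow> (\<Sum>\<^sub>\<infinity>x\<in>X. g x)) (finite_subsets_at_top X)"
    using has_sum_def has_sum_infsum by blast
qed auto

lemma abs_summable_on_times:
  fixes f :: "'a \<Rightarrow> complex" and g :: "'b \<Rightarrow> complex"
  assumes f: "(\<lambda>x. norm (f x)) summable_on A" and g: "(\<lambda>y. norm (g y)) summable_on B"
  shows "(\<lambda>p. norm (f (fst p) * g (snd p))) summable_on (A \<times> B)"
  unfolding Infinite_Sum.abs_summable_on_Sigma_iff
proof (intro conjI ballI)
  fix x show "(\<lambda>y. norm (f (fst (x, y)) * g (snd (x, y)))) summable_on B"
    using summable_on_cmult_right[OF g, of "norm (f x)"] by (simp add: norm_mult)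
  show "(\<lambda>x. norm (\<Sum>\<^sub>\<infinity>y\<in>B. norm (f (fst (x, y)) * g (snd (x, y))))) summable_on A"
    using summable_on_cmult_left[OF f, of "\<bar>\<Sum>\<^sub>\<infinity>y\<in>B. norm (g y)\<bar>"]
    by (simp add: norm_mult infsum_cmult_right' abs_mult)
qed

lemma has_sum_times:
  fixes f :: "'a \<Rightarrow> complex" and g :: "'b \<Rightarrow> complex"
  assumes f: "(\<lambda>x. norm (f x)) summable_on A" and g: "(\<lambda>y. norm (g y)) summable_on B"
  shows "((\<lambda>p. f (fst p) * g (snd p)) has_sum infsum f A * infsum g B) (A \<times> B)"
proof -
  have s: "(\<lambda>p. f (fst p) * g (snd p)) summable_on (A \<times> B)"
    by (rule abs_summable_summable[OF abs_summable_on_times[OF f g]])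
  have "infsum (\<lambda>p. f (fst p) * g (snd p)) (A \<times> B) = infsum f A * infsum g B"
    using infsum_Sigma_banach[OF s] by (simp add: infsum_cmult_right' infsum_cmult_left')
  then show ?thesis using has_sum_infsum[OF s] by simp
qed

lemma summable_on_int_abs:
  fixes f :: "nat \<Rightarrow> real"
  assumes f: "f summable_on UNIV"
  shows "(\<lambda>k::int. f (nat \<bar>k\<bar>)) summable_on UNIV"
proof -
  have eq: "(UNIV::int set) = int ` UNIV \<union> (\<lambda>n. - int n) ` {0<..}"
  proof (intro equalityI subsetI)
    fix k :: int
    show "k \<in> int ` UNIV \<union> (\<lambda>n. - int n) ` {0<..}"
      by (cases k rule: int_cases) (auto intro!: rev_image_eqI[of "nat (- k)"])
  qed auto
  show ?thesis
    unfolding eq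
  proof (rule summable_on_union)
    show "(\<lambda>k::int. f (nat \<bar>k\<bar>)) summable_on int ` UNIV"
      using f by (subst summable_on_reindex) (auto simp: o_def inj_on_def)
    show "(\<lambda>k::int. f (nat \<bar>k\<bar>)) summable_on (\<lambda>n. - int n) ` {0<..}"
      using summable_on_subset_banach[OF f]
      by (subst summable_on_reindex) (auto simp: o_def inj_on_def)
  qed
qed

lemma summable_on_int_powr:
  assumes "a < -1"
  shows "(\<lambda>k::int. (1 + \<bar>real_of_int k\<bar>) powr a) summable_on UNIV"
proof -
  have "summable (\<lambda>n. real (Suc n) powr a)"
    using assms by (subst summable_Suc_iff) (simp add: summable_real_powr_iff)
  then have "(\<lambda>n. real (Suc n) powr a) summable_on UNIV"
    by (subst summable_on_UNIV_nonneg_real_iff) auto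
  then show ?thesis
    using summable_on_int_abs[of "\<lambda>n. real (Suc n) powr a"] by simp
qed

text \<open>
  The symmetric intervals exhaust the integers, so an unconditional sum is also a limit along them.
  Telescoping and pairing of \<open>k\<close> with \<open>- k\<close> become available in this form.
\<close>

lemma has_sum_int_symmetric:
  fixes f :: "int \<Rightarrow> complex"
  assumes "(f has_sum S) UNIV"
  shows "(\<lambda>N. \<Sum>k\<in>{- int N..int N}. f k) \<longlonglongrightarrow> S"
proof -
  have "filterlim (\<lambda>N. {- int N..int N}) (finite_subsets_at_top UNIV) sequentially"
    unfolding filterlim_finite_subsets_at_top
  proof safe
    fix X :: "int set" assume X: "finite X"
    show "\<forall>\<^sub>F N in sequentially. finite {- int N..int N} \<and> X \<subseteq> {- int N..int N} \<and> {- int N..int N} \<subseteq> UNIV"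
      using eventually_ge_at_top[of "nat (\<Sum>x\<in>X. \<bar>x\<bar>)"]
    proof eventually_elim
      case (elim N)
      have "\<bar>x\<bar> \<le> int N" if "x \<in> X" for x
      proof -
        have "\<bar>x\<bar> \<le> (\<Sum>x\<in>X. \<bar>x\<bar>)" using X that by (intro member_le_sum) auto
        then show ?thesis using elim by linarith
      qed
      then have "X \<subseteq> {- int N..int N}" by fastforce
      then show ?case by simp
    qed
  qed
  then show ?thesis using assms unfolding has_sum_def by (rule filterlim_compose[rotated])
qed

lemma symmetric_int_interval: "{- int (Suc N)..int (Suc N)} = insert (int (Suc N)) (insert (- int (Suc N)) {- int N..int N})"
  by auto

lemma sum_symmetric_int:
  fixes F :: "int \<Rightarrow> complex"
  shows "(\<Sum>k\<in>{- int N..int N}. F k) = F 0 + (\<Sum>k=1..N. F (int k) + F (- int k))"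
proof (induction N)
  case (Suc N)
  then show ?case unfolding symmetric_int_interval by (subst sum.insert, simp, simp)+ (simp add: add_ac)
qed simp

lemma prod_symmetric_int:
  fixes F :: "int \<Rightarrow> complex"
  shows "(\<Prod>k\<in>{- int N..int N}. F k) = F 0 * (\<Prod>k=1..N. F (int k) * F (- int k))"
proof (induction N)
  case (Suc N)
  then show ?case unfolding symmetric_int_interval by (subst prod.insert, simp, simp)+ (simp add: mult_ac)
qed simp

lemma prod_shift_symmetric_int:
  fixes F :: "int \<Rightarrow> complex"
  shows "(\<Prod>k<2*N+1. F (int k - int N)) = (\<Prod>k\<in>{- int N..int N}. F k)"
  by (rule prod.reindex_bij_witness[where i = "\<lambda>k. nat (k + int N)" and j = "\<lambda>k. int k - int N"]) auto

lemma sum_shift_symmetric_int: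
  fixes F :: "int \<Rightarrow> complex"
  shows "(\<Sum>k<2*N+1. F (int k - int N)) = (\<Sum>k\<in>{- int N..int N}. F k)"
  by (rule sum.reindex_bij_witness[where i = "\<lambda>k. nat (k + int N)" and j = "\<lambda>k. int k - int N"]) auto

section \<open>Theta series and the heat equation\<close>

text \<open>
  The \<open>k\<close>-th term of the \<open>j\<close>-th \<open>z\<close>-derivative of the theta series with characteristic \<open>s\<close>: each
  differentiation multiplies the exponential by \<open>2 * pi * \<i> * (k + s)\<close>. Real values of \<open>s\<close> are
  allowed because products of theta functions lead to \<open>s = 1/4\<close> and \<open>s = 3/4\<close>.
\<close>

definition theta_term :: "nat \<Rightarrow> real \<Rightarrow> complex \<Rightarrow> complex \<Rightarrow> int \<Rightarrow> complex" where
  "theta_term j s z \<tau> k =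
     (2 * pi * \<i> * (of_int k + s)) ^ j
       * exp (pi * \<i> * (of_int k + s)^2 * \<tau> + 2 * pi * \<i> * (of_int k + s) * z)"

definition theta_moment :: "nat \<Rightarrow> real \<Rightarrow> complex \<Rightarrow> complex \<Rightarrow> complex" where
  "theta_moment j s z \<tau> = (\<Sum>\<^sub>\<infinity>k. theta_term j s z \<tau> k)"

lemma norm_theta_term:
  "norm (theta_term j s z \<tau> k) =
     (2 * pi * \<bar>of_int k + s\<bar>) ^ j
       * exp (- pi * (of_int k + s)^2 * Im \<tau> - 2 * pi * (of_int k + s) * Im z)"
proof -
  have "complex_of_int k + complex_of_real s = complex_of_real (of_int k + s)" by simp
  then have [simp]: "norm (complex_of_int k + complex_of_real s) = \<bar>of_int k + s\<bar>"
    by (metis norm_of_real)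
  have "(complex_of_int k + complex_of_real s)^2 = complex_of_real ((of_int k + s)^2)" by simp
  then have [simp]: "Re ((complex_of_int k + complex_of_real s)^2) = (of_int k + s)^2"
     "Im ((complex_of_int k + complex_of_real s)^2) = 0" by (metis Re_complex_of_real, metis Im_complex_of_real)
  show ?thesis
    by (simp add: theta_term_def norm_mult norm_power)
qed

text \<open>
  The exponential series has nonnegative terms here, and \<open>y ^ j / fact j\<close> is one of them.
\<close>

lemma power_le_fact_exp: "y ^ j \<le> fact j * exp y" if "y \<ge> 0" for y :: real
proof -
  have "y ^ j / fact j \<le> exp y"
  proof -
    have "(\<lambda>n. y ^ n /\<^sub>R fact n) sums exp y" by (rule exp_converges)
    then have s: "summable (\<lambda>n. y ^ n /\<^sub>R fact n)" and e: "exp y = (\<Sum>n. y ^ n /\<^sub>R fact n)"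
      by (auto simp: sums_iff)
    have "(\<Sum>n\<in>{j}. y ^ n /\<^sub>R fact n) \<le> (\<Sum>n. y ^ n /\<^sub>R fact n)"
      by (rule sum_le_suminf[OF s]) (use that in auto)
    then show ?thesis by (simp add: e field_simps)
  qed
  then show ?thesis by (simp add: field_simps)
qed

text \<open>
  With \<open>y = \<bar>k + s\<bar>\<close> the term is at most a power of \<open>y\<close> times \<open>exp (- pi * \<epsilon> * y^2 + O(y))\<close>. The
  power is absorbed into an exponential, and completing the square leaves room for a factor
  \<open>exp (- y)\<close>. The bound is uniform on strips, as the Weierstrass test requires.
\<close>

lemma theta_term_bound:
  assumes "\<epsilon> > 0"
  obtains C where
    "\<And>z \<tau> k. Im \<tau> \<ge> \<epsilon> \<Longrightarrow> \<bar>Im z\<bar> \<le> R \<Longrightarrow> norm (theta_term j s z \<tau> k) \<le> C * exp (-1) ^ nat \<bar>k\<bar>"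
proof -
  (* Coefficients of y in the exponent: 2 * pi * R from z, 2 * pi from the power, 1 for the decay. *)
  define b where "b = 2 * pi * (1 + \<bar>R\<bar>) + 1"
  define C where "C = fact j * exp (b^2 / (4 * pi * \<epsilon>) + \<bar>s\<bar>)"
  show ?thesis
  proof (rule that[of C])
    fix z \<tau> :: complex and k :: int
    assume \<tau>: "Im \<tau> \<ge> \<epsilon>" and z: "\<bar>Im z\<bar> \<le> R"
    define y where "y = \<bar>of_int k + s\<bar>"
    have y0: "y \<ge> 0" by (simp add: y_def)
    define q where "q = of_int k + s"
    have "- q * Im z \<le> y * \<bar>R\<bar>"
    proof -
      have "- q * Im z \<le> \<bar>- q * Im z\<bar>" by simp
      also have "\<dots> = y * \<bar>Im z\<bar>" by (simp only: y_def q_def abs_mult abs_minus_cancel)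
      also have "\<dots> \<le> y * \<bar>R\<bar>" using z y0 by (intro mult_left_mono) auto
      finally show ?thesis .
    qed
    then have "2 * pi * (- q * Im z) \<le> 2 * pi * (y * \<bar>R\<bar>)"
      by (intro mult_left_mono) auto
    moreover have "pi * y^2 * Im \<tau> \<ge> pi * y^2 * \<epsilon>"
      using \<tau> by (intro mult_left_mono) auto
    moreover have "y^2 = q^2" by (simp add: y_def q_def)
    ultimately have e1: "- pi * (of_int k + s)^2 * Im \<tau> - 2 * pi * (of_int k + s) * Im z
        \<le> - pi * y^2 * \<epsilon> + 2 * pi * y * \<bar>R\<bar>"
      unfolding q_def[symmetric] by (smt (verit) mult.assoc mult_minus_left mult_minus_right)
    have "norm (theta_term j s z \<tau> k) \<le> (2 * pi * y) ^ j * exp (- pi * y^2 * \<epsilon> + 2 * pi * y * \<bar>R\<bar>)"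
      unfolding norm_theta_term y_def[symmetric] using e1 y0 by (intro mult_left_mono) auto
    also have "\<dots> \<le> (fact j * exp (2 * pi * y)) * exp (- pi * y^2 * \<epsilon> + 2 * pi * y * \<bar>R\<bar>)"
      using y0 by (intro mult_right_mono power_le_fact_exp) auto
    also have "\<dots> = fact j * exp (- pi * y^2 * \<epsilon> + b * y - y)"
      by (simp add: b_def mult_exp_exp algebra_simps)
    also have "\<dots> \<le> fact j * exp (b^2 / (4 * pi * \<epsilon>) + \<bar>s\<bar> - \<bar>of_int k\<bar>)"
    proof -
      have "0 \<le> (2 * pi * \<epsilon> * y - b)^2 / (4 * pi * \<epsilon>)"
        using assms by simp
      also have "\<dots> = pi * y^2 * \<epsilon> - b * y + b^2 / (4 * pi * \<epsilon>)"
        using assms by (simp add: power2_eq_square field_simps)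
      finally show ?thesis
        by (intro mult_left_mono) (auto simp: y_def)
    qed
    also have "\<dots> = C * exp (-1) ^ nat \<bar>k\<bar>"
      by (simp add: C_def exp_of_nat_mult[symmetric] mult_exp_exp)
    finally show "norm (theta_term j s z \<tau> k) \<le> C * exp (-1) ^ nat \<bar>k\<bar>" .
  qed
qed

lemma summable_exp_abs_int: "(\<lambda>k::int. C * exp (-1::real) ^ nat \<bar>k\<bar>) summable_on UNIV"
proof (intro summable_on_cmult_right summable_on_int_abs)
  show "(\<lambda>n. exp (-1::real) ^ n) summable_on UNIV"
    by (intro norm_summable_imp_summable_on) (simp add: summable_geometric)
qed

lemma theta_term_abs_summable:
  assumes "Im \<tau> > 0"
  shows "(\<lambda>k. norm (theta_term j s z \<tau> k)) summable_on UNIV"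
proof -
  obtain C where "\<And>k. norm (theta_term j s z \<tau> k) \<le> C * exp (-1) ^ nat \<bar>k\<bar>"
    using theta_term_bound[OF assms, of "\<bar>Im z\<bar>" j s] by (metis order.refl)
  then show ?thesis
    by (intro Infinite_Sum.abs_summable_on_comparison_test'[OF summable_exp_abs_int])
qed

lemma theta_term_summable: "Im \<tau> > 0 \<Longrightarrow> theta_term j s z \<tau> summable_on UNIV"
  using theta_term_abs_summable abs_summable_summable by blast

lemma has_field_derivative_theta_term:
  "((\<lambda>u. theta_term j s (a + b * u) (c + d * u) k) has_field_derivative
     b * theta_term (j + 1) s (a + b * u) (c + d * u) k
       + d / (4 * pi * \<i>) * theta_term (j + 2) s (a + b * u) (c + d * u) k) (at u)"
  unfolding theta_term_def
  by (rule derivative_eq_intros refl | simp)+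
     (simp add: field_simps power2_eq_square)

text \<open>
  The partial sums converge locally uniformly, so their derivatives converge to the derivative of
  the sum; by the heat equation these derivatives are again partial sums of theta series. Moving
  both arguments along a complex line gives the \<open>z\<close>-derivative (\<open>b = 1\<close>, \<open>d = 0\<close>) and the total
  derivative along \<open>z = A * \<tau> + B\<close> (\<open>b = A\<close>, \<open>c = 0\<close>, \<open>d = 1\<close>) at once.
\<close>

lemma has_field_derivative_theta_moment:
  assumes "Im (c + d * u) > 0"
  shows "((\<lambda>u. theta_moment j s (a + b * u) (c + d * u)) has_field_derivative
     b * theta_moment (j + 1) s (a + b * u) (c + d * u)
       + d / (4 * pi * \<i>) * theta_moment (j + 2) s (a + b * u) (c + d * u)) (at u)"
proof -
  define \<epsilon> where "\<epsilon> = Im (c + d * u) / 2"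
  have \<epsilon>: "\<epsilon> > 0" using assms by (simp add: \<epsilon>_def)
  (* On the disc of radius r the period keeps imaginary part at least \<epsilon>. *)
  define r where "r = min 1 (\<epsilon> / (1 + norm d))"
  have d1: "1 + norm d > 0" by (simp add: add_pos_nonneg)
  have r: "r > 0" "r \<le> 1" "r * norm d \<le> \<epsilon>"
  proof -
    show "r > 0" "r \<le> 1" using \<epsilon> d1 by (auto simp: r_def)
    have "r * norm d \<le> \<epsilon> / (1 + norm d) * (1 + norm d)"
      using \<epsilon> d1 by (intro mult_mono) (auto simp: r_def)
    then show "r * norm d \<le> \<epsilon>" using d1 by simp
  qed
  define R where "R = norm a + norm b * (norm u + 1)"
  have nb: "\<bar>Im (a + b * w)\<bar> \<le> R \<and> Im (c + d * w) \<ge> \<epsilon>" if "w \<in> cball u r" for w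
  proof
    have dw: "norm (w - u) \<le> r" using that by (simp add: dist_norm norm_minus_commute)
    then have "norm w \<le> norm u + 1" using r(2) norm_triangle_ineq2[of w u] by linarith
    then have "norm (a + b * w) \<le> R"
      unfolding R_def by (intro norm_triangle_le add_left_mono) (simp add: norm_mult mult_left_mono)
    then show "\<bar>Im (a + b * w)\<bar> \<le> R" using abs_Im_le_cmod order_trans by blast
    have "\<bar>Im (d * (w - u))\<bar> \<le> norm d * norm (w - u)"
      by (metis abs_Im_le_cmod norm_mult)
    also have "\<dots> \<le> norm d * r" using dw by (intro mult_left_mono) auto
    also have "\<dots> \<le> \<epsilon>" using r(3) by (simp add: mult.commute)
    finally have "Im (d * w) \<ge> Im (d * u) - \<epsilon>" by (simp add: right_diff_distrib)
    moreover have "x - (y + x) / 2 \<le> w' \<Longrightarrow> (y + x) / 2 \<le> y + w'" for x y w' :: real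
      by (simp add: field_simps)
    ultimately show "Im (c + d * w) \<ge> \<epsilon>" unfolding \<epsilon>_def plus_complex.sel(2)[of c] by blast
  qed
  obtain C where C: "\<And>z \<tau> k. Im \<tau> \<ge> \<epsilon> \<Longrightarrow> \<bar>Im z\<bar> \<le> R \<Longrightarrow>
      norm (theta_term j s z \<tau> k) \<le> C * exp (-1) ^ nat \<bar>k\<bar>"
    using theta_term_bound[OF \<epsilon>] by metis
  let ?f = "\<lambda>K w. \<Sum>k\<in>K. theta_term j s (a + b * w) (c + d * w) k"
  let ?f' = "\<lambda>K w. \<Sum>k\<in>K. (b * theta_term (j + 1) s (a + b * w) (c + d * w) k
       + d / (4 * pi * \<i>) * theta_term (j + 2) s (a + b * w) (c + d * w) k)"
  let ?g = "\<lambda>w. theta_moment j s (a + b * w) (c + d * w)"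
  have df: "(?f K has_field_derivative ?f' K w) (at w)" for K w
    by (intro DERIV_sum has_field_derivative_theta_term)
  obtain g' where g': "\<And>w. w \<in> ball u r \<Longrightarrow> (?g has_field_derivative g' w) (at w) \<and>
      ((\<lambda>K. ?f' K w) \<longlongrightarrow> g' w) (finite_subsets_at_top UNIV)"
  proof (rule has_complex_derivative_uniform_limit[where f = ?f and f' = ?f' and g = ?g
        and F = "finite_subsets_at_top UNIV" and z = u and r = r])
    show "\<forall>\<^sub>F K in finite_subsets_at_top UNIV. continuous_on (cball u r) (?f K) \<and>
       (\<forall>w\<in>ball u r. (?f K has_field_derivative ?f' K w) (at w))"
    proof (intro always_eventually allI conjI ballI df)
      fix K show "continuous_on (cball u r) (?f K)"
        by (rule DERIV_continuous_on[where D = "?f' K"]) (rule has_field_derivative_at_within[OF df])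
    qed
    show "uniform_limit (cball u r) ?f ?g (finite_subsets_at_top UNIV)"
      unfolding theta_moment_def
    proof (rule Weierstrass_m_test_general[OF _ summable_exp_abs_int])
      fix k w assume "w \<in> cball u r"
      then show "norm (theta_term j s (a + b * w) (c + d * w) k) \<le> C * exp (-1) ^ nat \<bar>k\<bar>"
        using nb[of w] by (intro C) auto
    qed
  qed (use r in auto)
  have u: "u \<in> ball u r" using r by simp
  have "((\<lambda>K. ?f' K u) \<longlongrightarrow> b * theta_moment (j + 1) s (a + b * u) (c + d * u)
       + d / (4 * pi * \<i>) * theta_moment (j + 2) s (a + b * u) (c + d * u))
       (finite_subsets_at_top UNIV)"
  proof -
    have "((\<lambda>k. b * theta_term (j + 1) s (a + b * u) (c + d * u) k
       + d / (4 * pi * \<i>) * theta_term (j + 2) s (a + b * u) (c + d * u) k) has_sum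
       (b * theta_moment (j + 1) s (a + b * u) (c + d * u)
       + d / (4 * pi * \<i>) * theta_moment (j + 2) s (a + b * u) (c + d * u))) UNIV"
      unfolding theta_moment_def
      by (intro has_sum_add has_sum_cmult_right has_sum_infsum theta_term_summable assms)
    then show ?thesis by (simp add: has_sum_def)
  qed
  then have "g' u = b * theta_moment (j + 1) s (a + b * u) (c + d * u)
       + d / (4 * pi * \<i>) * theta_moment (j + 2) s (a + b * u) (c + d * u)"
    using g'[OF u] by (intro tendsto_unique[of "finite_subsets_at_top (UNIV::int set)"]) auto
  then show ?thesis using g'[OF u] by simp
qed

section \<open>Products of theta series\<close>

abbreviation theta_series :: "real \<Rightarrow> complex \<Rightarrow> complex \<Rightarrow> complex" where
  "theta_series \<equiv> theta_moment 0"

lemma exp_two_pi_i_int: "exp (2 * complex_of_real pi * \<i> * of_int k) = 1"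
  using exp_integer_2pi[of "of_int k"] by (simp add: mult_ac)

lemma theta_moment_add_1: "theta_moment j s (z + 1) t = exp (2 * pi * \<i> * s) * theta_moment j s z t"
proof -
  have "theta_term j s (z + 1) t k = exp (2 * pi * \<i> * s) * theta_term j s z t k" for k
  proof -
    have "exp (pi * \<i> * (of_int k + s)^2 * t + 2 * pi * \<i> * (of_int k + s) * (z + 1))
      = exp ((pi * \<i> * (of_int k + s)^2 * t + 2 * pi * \<i> * (of_int k + s) * z) + 2 * pi * \<i> * s
            + 2 * pi * \<i> * of_int k)"
      by (rule arg_cong[where f = exp]) (simp add: algebra_simps)
    then show ?thesis
      unfolding theta_term_def exp_add exp_two_pi_i_int by (simp add: mult_ac)
  qed
  then show ?thesis by (simp add: theta_moment_def infsum_cmult_right')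
qed

lemma theta_moment_add_1_char: "theta_moment j (s + 1) z t = theta_moment j s z t"
  unfolding theta_moment_def
  by (rule infsum_reindex_bij_witness[where i = "\<lambda>k. k - 1" and j = "\<lambda>k. k + 1"])
     (auto simp: theta_term_def add_ac)

lemma theta_moment_minus: "theta_moment j (- s) (- z) t = (-1) ^ j * theta_moment j s z t"
proof -
  have "theta_moment j (- s) (- z) t = (\<Sum>\<^sub>\<infinity>k. (-1) ^ j * theta_term j s z t k)"
    unfolding theta_moment_def
  proof (rule infsum_reindex_bij_witness[where i = "\<lambda>k. - k" and j = "\<lambda>k. - k"])
    fix k :: int
    define x where "x = complex_of_int (- k) + complex_of_real s"
    have m: "complex_of_int k + complex_of_real (- s) = - x" by (simp add: x_def)
    show "(-1) ^ j * theta_term j s z t (- k) = theta_term j (- s) (- z) t k"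
      unfolding theta_term_def m x_def[symmetric]
      by (simp add: power_minus[of "_ * x" j])
  qed auto
  then show ?thesis by (simp add: theta_moment_def infsum_cmult_right')
qed

text \<open>
  In the double series over \<open>(k, l)\<close> substitute \<open>k = m + n + e\<close>, \<open>l = m - n\<close> with \<open>e\<close> the parity of
  \<open>k + l\<close>. The quadratic form \<open>k^2 + l^2\<close> becomes diagonal in \<open>m\<close> and \<open>n\<close> with both coefficients
  doubled, so each parity class is the product of two theta series at \<open>2 * t\<close>.
\<close>

lemma theta_series_product:
  assumes "Im t > 0"
  shows "theta_series s x t * theta_series s' y t =
     theta_series ((s + s') / 2) (x + y) (2 * t) * theta_series ((s - s') / 2) (x - y) (2 * t)
   + theta_series ((s + s' + 1) / 2) (x + y) (2 * t) * theta_series ((s - s' + 1) / 2) (x - y) (2 * t)"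
proof -
  define F where "F = (\<lambda>p. theta_term 0 s x t (fst p) * theta_term 0 s' y t (snd p))"
  define h where "h = (\<lambda>e p. (fst p + snd p + e, fst p - snd p :: int))"
  define S where "S = (\<lambda>e::int. theta_series ((s + s' + of_int e) / 2) (x + y) (2 * t)
                      * theta_series ((s - s' + of_int e) / 2) (x - y) (2 * t))"
  have fterm: "F (h e p) = theta_term 0 ((s + s' + of_int e) / 2) (x + y) (2 * t) (fst p)
       * theta_term 0 ((s - s' + of_int e) / 2) (x - y) (2 * t) (snd p)" for e p
    unfolding F_def h_def theta_term_def power_0 mult_1_left mult_exp_exp
    by (rule arg_cong[where f = exp]) (simp add: field_simps power2_eq_square)
  have inj: "inj (h e)" for e
    by (auto simp: inj_def h_def)
  have part: "(F has_sum S e) (range (h e))" for e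
  proof -
    have "((\<lambda>p. F (h e p)) has_sum S e) UNIV"
      unfolding fterm S_def theta_moment_def UNIV_Times_UNIV[symmetric]
      using assms by (intro has_sum_times theta_term_abs_summable) auto
    then show ?thesis using inj by (subst has_sum_reindex) (auto simp: o_def)
  qed
  have disj: "range (h 0) \<inter> range (h 1) = {}"
  proof -
    have False if "h 0 p = h 1 q" for p q
    proof -
      have "fst p + snd p = fst q + snd q + 1" "fst p - snd p = fst q - snd q"
        using that by (auto simp: h_def)
      then show False by presburger
    qed
    then show ?thesis by blast
  qed
  have un: "range (h 0) \<union> range (h 1) = UNIV"
  proof (intro equalityI subsetI UNIV_I)
    fix p :: "int \<times> int"
    obtain k l where p: "p = (k, l)" by fastforce
    show "p \<in> range (h 0) \<union> range (h 1)"
    proof (cases "even (k + l)")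
      case True
      then have "k = (k + l) div 2 + (k - l) div 2" "l = (k + l) div 2 - (k - l) div 2"
        by presburger+
      then have "p = h 0 ((k + l) div 2, (k - l) div 2)"
        unfolding p h_def by simp
      then show ?thesis by blast
    next
      case False
      then have "k = (k + l - 1) div 2 + (k - l - 1) div 2 + 1" "l = (k + l - 1) div 2 - (k - l - 1) div 2"
        by presburger+
      then have "p = h 1 ((k + l - 1) div 2, (k - l - 1) div 2)"
        unfolding p h_def by simp
      then show ?thesis by blast
    qed
  qed
  have "(F has_sum S 0 + S 1) UNIV"
    using has_sum_Un_disjoint[OF part part disj] unfolding un .
  moreover have "(F has_sum theta_series s x t * theta_series s' y t) UNIV"
    unfolding F_def theta_moment_def UNIV_Times_UNIV[symmetric]
    using assms by (intro has_sum_times theta_term_abs_summable) auto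
  ultimately have "theta_series s x t * theta_series s' y t = S 0 + S 1"
    using has_sum_unique by blast
  then show ?thesis by (simp add: S_def)
qed

section \<open>The four theta functions\<close>

text \<open>
  The \<open>j\<close>-th \<open>z\<close>-derivative of \<open>theta k\<close>, see \<open>has_field_derivative_theta_deriv\<close>.
\<close>

definition theta_deriv :: "nat \<Rightarrow> nat \<Rightarrow> complex \<Rightarrow> complex \<Rightarrow> complex" where
  "theta_deriv j k z \<tau> =
     (if k = 1 then - theta_moment j (1/2) (z + 1/2) \<tau>
      else if k = 2 then theta_moment j (1/2) z \<tau>
      else if k = 3 then theta_moment j 0 z \<tau>
      else if k = 4 then theta_moment j 0 (z + 1/2) \<tau>
      else 0)"

lemma theta_eq_theta_deriv: "theta k z \<tau> = theta_deriv 0 k z \<tau>"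
  by (simp add: theta_def theta_deriv_def theta_char_def theta_moment_def theta_term_def)

lemma has_field_derivative_theta_deriv_line:
  assumes "Im (c + d * u) > 0"
  shows "((\<lambda>u. theta_deriv j k (a + b * u) (c + d * u)) has_field_derivative
     b * theta_deriv (j + 1) k (a + b * u) (c + d * u)
       + d / (4 * pi * \<i>) * theta_deriv (j + 2) k (a + b * u) (c + d * u)) (at u)"
proof -
  note M = has_field_derivative_theta_moment[OF assms]
  have sh: "a + b * v + 1/2 = (a + 1/2) + b * v" for v by simp
  consider "k = 1" | "k = 2" | "k = 3" | "k = 4" | "k \<notin> {1,2,3,4}" by auto
  then show ?thesis
  proof cases
    case 1
    show ?thesis
      using DERIV_minus[OF M[where a = "a + 1/2" and s = "1/2" and j = j and b = b]]
      unfolding theta_deriv_def sh 1 by (simp add: algebra_simps)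
  next
    case 2
    show ?thesis using M[where a = a and s = "1/2" and j = j and b = b]
      unfolding theta_deriv_def 2 by simp
  next
    case 3
    show ?thesis using M[where a = a and s = "0" and j = j and b = b]
      unfolding theta_deriv_def 3 by simp
  next
    case 4
    show ?thesis using M[where a = "a + 1/2" and s = "0" and j = j and b = b]
      unfolding theta_deriv_def sh 4 by simp
  next
    case 5
    then show ?thesis by (simp add: theta_deriv_def)
  qed
qed

lemma has_field_derivative_theta_deriv:
  assumes "Im t > 0"
  shows "((\<lambda>z. theta_deriv j k z t) has_field_derivative theta_deriv (Suc j) k z t) (at z)"
  using has_field_derivative_theta_deriv_line[of t 0 z j k 0 1] assms by simp

lemma has_field_derivative_theta_deriv_curve:
  assumes "Im t > 0"
  shows "((\<lambda>t. theta_deriv j k (A * t + B) t) has_field_derivative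
     A * theta_deriv (j + 1) k (A * t + B) t
       + theta_deriv (j + 2) k (A * t + B) t / (4 * pi * \<i>)) (at t)"
  using has_field_derivative_theta_deriv_line[of 0 1 t j k B A] assms by (simp add: add.commute)

lemma DERIV_theta_deriv [derivative_intros]:
  assumes "(f has_field_derivative f') (at u)" "Im t > 0"
  shows "((\<lambda>u. theta_deriv j k (f u) t) has_field_derivative theta_deriv (Suc j) k (f u) t * f') (at u)"
  using DERIV_chain2[OF has_field_derivative_theta_deriv[OF assms(2)] assms(1)] .

lemma DERIV_theta_moment [derivative_intros]:
  assumes "(f has_field_derivative f') (at u)" "Im t > 0"
  shows "((\<lambda>u. theta_moment j s (f u) t) has_field_derivative theta_moment (Suc j) s (f u) t * f') (at u)"
proof (rule DERIV_chain2[OF _ assms(1)])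
  show "((\<lambda>u. theta_moment j s u t) has_field_derivative theta_moment (Suc j) s (f u) t) (at (f u))"
    using has_field_derivative_theta_moment[of t 0 "f u" j s 0 1] assms(2) by simp
qed

lemma theta1'_eq_theta_deriv: "Im t > 0 \<Longrightarrow> theta1' z t = theta_deriv 1 1 z t"
  unfolding theta1'_def theta_eq_theta_deriv
  using DERIV_imp_deriv[OF has_field_derivative_theta_deriv[of t 0 1 z]] by simp

lemma exp_2pi_half: "exp (2 * complex_of_real pi * \<i> * complex_of_real (1/2)) = -1"
  using exp_pi_i' by simp

lemma exp_2pi_quarter: "exp (2 * complex_of_real pi * \<i> * complex_of_real (1/4)) = \<i>"
proof -
  have "exp (2 * complex_of_real pi * \<i> * complex_of_real (1/4)) = exp (\<i> * complex_of_real (pi / 2))"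
    by (rule arg_cong[where f = exp]) simp
  also have "\<dots> = \<i>" unfolding exp_Euler cos_of_real sin_of_real by simp
  finally show ?thesis .
qed

lemma exp_2pi_three_quarters: "exp (2 * complex_of_real pi * \<i> * complex_of_real (3/4)) = -\<i>"
proof -
  have "2 * complex_of_real pi * \<i> * complex_of_real (3/4)
     = 2 * complex_of_real pi * \<i> * complex_of_real (1/2) + 2 * complex_of_real pi * \<i> * complex_of_real (1/4)"
    by simp
  then show ?thesis by (simp only: exp_add exp_2pi_half exp_2pi_quarter) simp
qed

lemma theta_moment_shift:
  "theta_moment j 0 (z + 1) t = theta_moment j 0 z t"
  "theta_moment j (1/2) (z + 1) t = - theta_moment j (1/2) z t"
  "theta_moment j (1/4) (z + 1) t = \<i> * theta_moment j (1/4) z t"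
  "theta_moment j (3/4) (z + 1) t = - \<i> * theta_moment j (3/4) z t"
  "theta_moment j 1 z t = theta_moment j 0 z t"
  "theta_moment j (- (1/4)) z t = theta_moment j (3/4) z t"
  using theta_moment_add_1[of j 0 z t] theta_moment_add_1[of j "1/2" z t]
    theta_moment_add_1[of j "1/4" z t] theta_moment_add_1[of j "3/4" z t]
    exp_2pi_half exp_2pi_quarter exp_2pi_three_quarters
    theta_moment_add_1_char[of j 0 z t] theta_moment_add_1_char[of j "-1/4" z t]
  by simp_all

lemma theta_parity:
  "theta_deriv j 1 (- z) t = - ((-1) ^ j * theta_deriv j 1 z t)"
  "theta_deriv j 2 (- z) t = (-1) ^ j * theta_deriv j 2 z t"
  "theta_deriv j 3 (- z) t = (-1) ^ j * theta_deriv j 3 z t"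
  "theta_deriv j 4 (- z) t = (-1) ^ j * theta_deriv j 4 z t"
proof -
  have h: "theta_moment j (1/2) w t = theta_moment j (- (1/2)) w t" for w
    using theta_moment_add_1_char[of j "-1/2" w t] by simp
  have s: "- (w::complex) + 1/2 = - (w + 1/2) + 1" for w by simp
  have s': "- (w::complex) - 1/2 = - (w + 1/2)" for w by simp
  show "theta_deriv j 1 (- z) t = - ((-1) ^ j * theta_deriv j 1 z t)"
    unfolding theta_deriv_def s theta_moment_shift h[of "- (z + 1/2)"] theta_moment_minus by simp
  show "theta_deriv j 2 (- z) t = (-1) ^ j * theta_deriv j 2 z t"
    using h[of "-z"] theta_moment_minus[of j "1/2" z t] by (simp add: theta_deriv_def)
  show "theta_deriv j 3 (- z) t = (-1) ^ j * theta_deriv j 3 z t"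
    using theta_moment_minus[of j "0" z t] by (simp add: theta_deriv_def)
  show "theta_deriv j 4 (- z) t = (-1) ^ j * theta_deriv j 4 z t"
    unfolding theta_deriv_def s theta_moment_shift using theta_moment_minus[of j "0" "z + 1/2" t]
    by simp
qed

lemma theta_even_odd_0:
  "even j \<Longrightarrow> theta_deriv j 1 0 t = 0"
  "odd j \<Longrightarrow> theta_deriv j 2 0 t = 0"
  "odd j \<Longrightarrow> theta_deriv j 3 0 t = 0"
  "odd j \<Longrightarrow> theta_deriv j 4 0 t = 0"
  using theta_parity[of j 0 t] by (auto simp: eq_neg_iff_add_eq_0)

section \<open>Behaviour under repeated doubling of the period\<close>

text \<open>
  As the imaginary part of the period tends to infinity only the terms with minimal \<open>\<bar>k + s\<bar>\<close>
  survive. The value of \<open>s\<close> is assumed to attain this minimum, as \<open>0\<close> and \<open>1/2\<close> do; the normalising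
  factor makes the surviving terms independent of \<open>n\<close>, and the terms at \<open>t\<close> itself dominate.
\<close>

lemma theta_moment_asymp:
  assumes t: "Im t > 0" and s: "\<And>k::int. s^2 \<le> (of_int k + s)^2"
  defines "K \<equiv> {k::int. (of_int k + s)^2 = s^2}"
  assumes fin: "finite K"
  shows "(\<lambda>n. theta_moment j s z (2 ^ n * t) * exp (- (pi * \<i> * s^2 * (2 ^ n * t))))
     \<longlonglongrightarrow> (\<Sum>k\<in>K. (2 * pi * \<i> * (of_int k + s)) ^ j * exp (2 * pi * \<i> * (of_int k + s) * z))"
proof -
  define w where "w = (\<lambda>k::int. (2 * pi * \<i> * (of_int k + s)) ^ j * exp (2 * pi * \<i> * (of_int k + s) * z))"
  define c where "c = (\<lambda>k::int. (of_int k + s)^2 - s^2)"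
  define f where "f = (\<lambda>n k. theta_term j s z (2 ^ n * t) k * exp (- (pi * \<i> * s^2 * (2 ^ n * t))))"
  have f: "f n k = w k * exp (pi * \<i> * c k * t) ^ (2 ^ n)" for n k
  proof -
    have "f n k = (2 * pi * \<i> * (of_int k + s)) ^ j *
        (exp (pi * \<i> * (of_int k + s)^2 * (2 ^ n * t) + 2 * pi * \<i> * (of_int k + s) * z)
        * exp (- (pi * \<i> * s^2 * (2 ^ n * t))))"
      unfolding f_def theta_term_def
      by (simp only: mult.assoc of_real_add of_real_power of_real_of_int_eq of_real_mult)
    also have "exp (pi * \<i> * (of_int k + s)^2 * (2 ^ n * t) + 2 * pi * \<i> * (of_int k + s) * z)
        * exp (- (pi * \<i> * s^2 * (2 ^ n * t)))
      = exp (2 * pi * \<i> * (of_int k + s) * z) * exp (of_nat (2 ^ n) * (pi * \<i> * c k * t))"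
      unfolding mult_exp_exp by (rule arg_cong[where f = exp]) (simp add: c_def algebra_simps)
    also have "(2 * pi * \<i> * (of_int k + s)) ^ j * \<dots> = w k * exp (pi * \<i> * c k * t) ^ (2 ^ n)"
      unfolding w_def exp_of_nat_mult by (rule mult.assoc[symmetric])
    finally show ?thesis .
  qed
  have e: "norm (exp (pi * \<i> * c k * t)) = exp (- (pi * c k * Im t))" for k
    by simp
  have c0: "c k \<ge> 0" for k using s[of k] by (simp add: c_def)
  have "(\<lambda>n. \<Sum>\<^sub>\<infinity>k. f n k) \<longlonglongrightarrow> (\<Sum>\<^sub>\<infinity>k. if k \<in> K then w k else 0)"
  proof (rule tannery_infsum[where M = "\<lambda>k. norm (f 0 k)"])
    fix k :: int
    show "(\<lambda>n. f n k) \<longlonglongrightarrow> (if k \<in> K then w k else 0)"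
    proof (cases "k \<in> K")
      case True
      then have "c k = 0" by (simp add: c_def K_def)
      then show ?thesis using True by (simp add: f)
    next
      case False
      then have "c k > 0" using c0[of k] by (auto simp: c_def K_def)
      then have "norm (exp (pi * \<i> * c k * t)) < 1"
        unfolding e using t by simp
      then have "(\<lambda>m. exp (pi * \<i> * c k * t) ^ m) \<longlonglongrightarrow> 0" by (rule LIMSEQ_power_zero)
      then have "(\<lambda>n. exp (pi * \<i> * c k * t) ^ (2 ^ n)) \<longlonglongrightarrow> 0"
        by (rule filterlim_compose[OF _ filterlim_subseq]) (simp add: strict_mono_def)
      from tendsto_mult_right_zero[OF this] show ?thesis using False unfolding f by simp
    qed
  next
    fix n and k :: int
    have "norm (exp (pi * \<i> * c k * t)) \<le> 1" unfolding e using t c0[of k] by simp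
    then have "norm (exp (pi * \<i> * c k * t)) ^ (2 ^ n) \<le> norm (exp (pi * \<i> * c k * t)) ^ 1"
      by (intro power_decreasing) auto
    then show "norm (f n k) \<le> norm (f 0 k)"
      unfolding f norm_mult norm_power by (intro mult_left_mono) auto
  next
    show "(\<lambda>k. norm (f 0 k)) summable_on UNIV"
      unfolding f_def norm_mult using t by (intro summable_on_cmult_left theta_term_abs_summable) simp
  qed
  also have "(\<Sum>\<^sub>\<infinity>k. if k \<in> K then w k else 0) = (\<Sum>\<^sub>\<infinity>k\<in>K. w k)"
    by (rule infsum_cong_neutral) auto
  also have "\<dots> = (\<Sum>k\<in>K. w k)" using fin by simp
  also have "(\<lambda>n. \<Sum>\<^sub>\<infinity>k. f n k) = (\<lambda>n. theta_moment j s z (2 ^ n * t) * exp (- (pi * \<i> * s^2 * (2 ^ n * t))))"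
    unfolding f_def theta_moment_def by (simp add: infsum_cmult_left')
  finally show ?thesis unfolding w_def by simp
qed

lemma theta_moment_0_asymp:
  assumes t: "Im t > 0"
  shows "(\<lambda>n. theta_series 0 z (2 ^ n * t)) \<longlonglongrightarrow> 1"
proof -
  have "{k::int. (of_int k + 0)^2 = (0::real)^2} = {0}" by auto
  then show ?thesis using theta_moment_asymp[OF t, of 0 0 z] by simp
qed

lemma theta_moment_half_asymp:
  assumes t: "Im t > 0"
  shows "(\<lambda>n. theta_moment j (1/2) z (2 ^ n * t) * exp (- (pi * \<i> / 4 * (2 ^ n * t))))
    \<longlonglongrightarrow> (pi * \<i>) ^ j * exp (pi * \<i> * z) + (- (pi * \<i>)) ^ j * exp (- (pi * \<i> * z))"
proof -
  have sq: "(of_int k + 1/2)^2 - (1/2)^2 = (of_int (k * (k + 1)) :: real)" for k :: int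
    by (simp add: power2_eq_square algebra_simps)
  have "k * (k + 1) \<ge> 0" for k :: int
    by (cases "k \<ge> 0") (auto intro: mult_nonneg_nonneg mult_nonpos_nonpos)
  then have nn: "(of_int (k * (k + 1)) :: real) \<ge> 0" for k :: int
    by (subst of_int_0_le_iff)
  have le: "(1/2)^2 \<le> (of_int k + 1/2 :: real)^2" for k :: int
    using sq[of k] nn[of k] by linarith
  have "(of_int k + 1/2)^2 = ((1/2)^2 :: real) \<longleftrightarrow> k = 0 \<or> k = -1" for k :: int
  proof -
    have "(of_int k + 1/2)^2 = ((1/2)^2 :: real) \<longleftrightarrow> (of_int k + 1/2)^2 - (1/2)^2 = (0 :: real)"
      by (rule eq_iff_diff_eq_0)
    also have "\<dots> \<longleftrightarrow> k * (k + 1) = 0"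
      unfolding sq by (rule of_int_eq_0_iff)
    finally show ?thesis by auto
  qed
  then have K: "{k::int. (of_int k + 1/2)^2 = ((1/2)^2 :: real)} = {0, -1}"
    by auto
  have e': "complex_of_real pi * \<i> * (complex_of_real (1/2))^2 = pi * \<i> / 4"
    by (simp add: power2_eq_square)
  have sum: "(\<Sum>k\<in>{0, - 1}. (complex_of_real (2 * pi) * \<i> * (of_int k + complex_of_real (1/2))) ^ j
        * exp (complex_of_real (2 * pi) * \<i> * (of_int k + complex_of_real (1/2)) * z))
     = (pi * \<i>) ^ j * exp (pi * \<i> * z) + (- (pi * \<i>)) ^ j * exp (- (pi * \<i> * z))"
    by simp
  show ?thesis using theta_moment_asymp[OF t le, of j z] unfolding K sum e'
    by (simp only: finite.intros simp_thms)
qed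

section \<open>Wronskians and theta constants\<close>

abbreviation theta_double :: "real \<Rightarrow> complex \<Rightarrow> complex \<Rightarrow> complex" where
  "theta_double s z t \<equiv> theta_moment 0 s z (2 * t)"

text \<open>
  For two equal characteristics only the two theta series with \<open>s = 0\<close> and \<open>s = 1/2\<close> at \<open>2 * t\<close>
  occur in the product formula, whichever of the four functions is taken.
\<close>

lemma theta_products:
  assumes "Im t > 0"
  shows "theta_deriv 0 1 x t * theta_deriv 0 1 y t = theta_double 0 (x + y) t * theta_double (1/2) (x - y) t - theta_double (1/2) (x + y) t * theta_double 0 (x - y) t"
    and "theta_deriv 0 2 x t * theta_deriv 0 2 y t = theta_double (1/2) (x + y) t * theta_double 0 (x - y) t + theta_double 0 (x + y) t * theta_double (1/2) (x - y) t"
    and "theta_deriv 0 3 x t * theta_deriv 0 3 y t = theta_double 0 (x + y) t * theta_double 0 (x - y) t + theta_double (1/2) (x + y) t * theta_double (1/2) (x - y) t"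
    and "theta_deriv 0 4 x t * theta_deriv 0 4 y t = theta_double 0 (x + y) t * theta_double 0 (x - y) t - theta_double (1/2) (x + y) t * theta_double (1/2) (x - y) t"
proof -
  have a: "x + 1/2 + (y + 1/2) = x + y + 1" "x + 1/2 - (y + 1/2) = x - y" by simp_all
  show "theta_deriv 0 1 x t * theta_deriv 0 1 y t = theta_double 0 (x + y) t * theta_double (1/2) (x - y) t - theta_double (1/2) (x + y) t * theta_double 0 (x - y) t"
    using theta_series_product[OF assms, of "1/2" "x+1/2" "1/2" "y+1/2"] unfolding a
    by (simp add: theta_deriv_def theta_moment_shift)
  show "theta_deriv 0 2 x t * theta_deriv 0 2 y t = theta_double (1/2) (x + y) t * theta_double 0 (x - y) t + theta_double 0 (x + y) t * theta_double (1/2) (x - y) t"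
    using theta_series_product[OF assms, of "1/2" x "1/2" y]
    by (simp add: theta_deriv_def theta_moment_shift)
  show "theta_deriv 0 3 x t * theta_deriv 0 3 y t = theta_double 0 (x + y) t * theta_double 0 (x - y) t + theta_double (1/2) (x + y) t * theta_double (1/2) (x - y) t"
    using theta_series_product[OF assms, of 0 x 0 y]
    by (simp add: theta_deriv_def theta_moment_shift)
  show "theta_deriv 0 4 x t * theta_deriv 0 4 y t = theta_double 0 (x + y) t * theta_double 0 (x - y) t - theta_double (1/2) (x + y) t * theta_double (1/2) (x - y) t"
    using theta_series_product[OF assms, of 0 "x+1/2" 0 "y+1/2"] unfolding a
    by (simp add: theta_deriv_def theta_moment_shift)
qed

lemma theta_moment_minus_1:
  "theta_moment j 0 (v - 1) t = theta_moment j 0 v t"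
  "theta_moment j (1/2) (v - 1) t = - theta_moment j (1/2) v t"
  "theta_moment j (1/4) (v - 1) t = - \<i> * theta_moment j (1/4) v t"
  "theta_moment j (3/4) (v - 1) t = \<i> * theta_moment j (3/4) v t"
  using theta_moment_shift(1-4)[of j "v - 1" t] by simp_all

lemma theta_quarter_relations:
  "theta_moment 0 (3/4) 0 t = theta_moment 0 (1/4) 0 t"
  "theta_moment 0 (3/4) (1/2) t = - \<i> * theta_moment 0 (1/4) (1/2) t"
  "theta_moment 0 (1/2) (1/2) t = 0"
proof -
  show "theta_moment 0 (3/4) 0 t = theta_moment 0 (1/4) 0 t"
    using theta_moment_minus[of 0 "1/4" 0 t] theta_moment_shift(6)[of 0 0 t] by simp
  have "theta_moment 0 (3/4) (1/2) t = theta_moment 0 (1/4) (- (1/2)) t"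
    using theta_moment_minus[of 0 "1/4" "- (1/2)" t] theta_moment_shift(6)[of 0 "1/2" t] by simp
  then show "theta_moment 0 (3/4) (1/2) t = - \<i> * theta_moment 0 (1/4) (1/2) t"
    using theta_moment_minus_1(3)[of 0 "1/2" t] by simp
  show "theta_moment 0 (1/2) (1/2) t = 0"
    using theta_even_odd_0(1)[of 0 t] by (simp add: theta_deriv_def)
qed

text \<open>
  An identity between analytic functions may be differentiated; it is applied to differences of
  the two sides.
\<close>

lemma deriv_of_identity:
  fixes L :: "complex \<Rightarrow> complex"
  assumes "(L has_field_derivative L') (at z)" "\<And>z. L z = 0"
  shows "L' = 0"
proof -
  have "L = (\<lambda>_. 0)" using assms(2) by auto
  with assms(1) show ?thesis using DERIV_unique DERIV_const by blast
qed

text \<open>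
  If the antisymmetric kernel \<open>f x * g z - g x * f z\<close> splits into a function of \<open>x + z\<close> and a
  function of \<open>x - z\<close>, its \<open>x\<close>-derivative on the diagonal is the Wronskian, and only the derivative
  of the second factor contributes because that factor vanishes at \<open>0\<close>.
\<close>

lemma wronskian_of_splitting:
  fixes f g \<Phi> \<Psi> :: "complex \<Rightarrow> complex"
  assumes "(f has_field_derivative f') (at z)" "(g has_field_derivative g') (at z)"
    and "\<Phi> field_differentiable (at (2 * z))" "(\<Psi> has_field_derivative D) (at 0)" "\<Psi> 0 = 0"
    and split: "\<And>x. f x * g z - g x * f z = \<Phi> (x + z) * \<Psi> (x - z)"
  shows "f' * g z - g' * f z = \<Phi> (2 * z) * D"
proof -
  obtain d where d: "(\<Phi> has_field_derivative d) (at (z + z))"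
    using assms(3) by (auto simp: field_differentiable_def)
  have "((\<lambda>x. \<Phi> (x + z)) has_field_derivative d * 1) (at z)"
    by (rule DERIV_chain2[where f = \<Phi> and g = "\<lambda>x. x + z", OF d]) (auto intro!: derivative_eq_intros)
  moreover have "((\<lambda>x. \<Psi> (x - z)) has_field_derivative D * 1) (at z)"
    by (rule DERIV_chain2[where f = \<Psi> and g = "\<lambda>x. x - z"]) (use assms(4) in \<open>auto intro!: derivative_eq_intros\<close>)
  ultimately have "((\<lambda>x. \<Phi> (x + z) * \<Psi> (x - z)) has_field_derivative \<Phi> (2 * z) * D) (at z)"
    by (auto intro!: derivative_eq_intros simp: assms(5) mult.commute)
  moreover have "((\<lambda>x. \<Phi> (x + z) * \<Psi> (x - z)) has_field_derivative f' * g z - g' * f z) (at z)"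
    unfolding split[symmetric]
    by (intro DERIV_diff DERIV_cmult_right assms)
  ultimately show ?thesis using DERIV_unique by blast
qed

text \<open>
  The Wronskian of \<open>\<theta>\<^sub>2\<close> and \<open>\<theta>\<^sub>1\<close> and the product \<open>\<theta>\<^sub>3 \<theta>\<^sub>4\<close> are multiples of one and the same
  theta function of \<open>2 * z\<close> at period \<open>2 * t\<close>; the next two lemmas are the analogues for \<open>\<theta>\<^sub>3\<close> and \<open>\<theta>\<^sub>4\<close>.
\<close>

lemma theta_wronskian_2:
  assumes t: "Im t > 0"
  shows "theta_deriv 1 2 z t * theta_deriv 0 1 z t - theta_deriv 1 1 z t * theta_deriv 0 2 z t
      = theta_double 0 (2 * z + 1/2) t * (2 * theta_moment 1 (1/2) (1/2) (2 * t))"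
    and "theta_deriv 0 3 z t * theta_deriv 0 4 z t = theta_double 0 (2 * z + 1/2) t * theta_double 0 (1/2) t"
proof -
  have t2: "Im (2 * t) > 0" using t by simp
  show "theta_deriv 1 2 z t * theta_deriv 0 1 z t - theta_deriv 1 1 z t * theta_deriv 0 2 z t
      = theta_double 0 (2 * z + 1/2) t * (2 * theta_moment 1 (1/2) (1/2) (2 * t))"
  proof (rule wronskian_of_splitting[where f = "\<lambda>z. theta_deriv 0 2 z t" and g = "\<lambda>z. theta_deriv 0 1 z t"
        and \<Phi> = "\<lambda>w. theta_double 0 (w + 1/2) t" and \<Psi> = "\<lambda>v. 2 * theta_double (1/2) (v + 1/2) t"])
    fix x
    define X v where "X = x + z + 1/2" and "v = x - z + 1/2"
    have a: "x + (z + 1/2) = X" "x + 1/2 + z = X" "x + 1/2 - z = v" "x - (z + 1/2) = v - 1"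
      by (simp_all add: X_def v_def)
    show "theta_deriv 0 2 x t * theta_deriv 0 1 z t - theta_deriv 0 1 x t * theta_deriv 0 2 z t =
         theta_double 0 (x + z + 1 / 2) t * (2 * theta_double (1 / 2) (x - z + 1 / 2) t)"
      using theta_series_product[OF t, of "1/2" x "1/2" "z + 1/2"] theta_series_product[OF t, of "1/2" "x + 1/2" "1/2" z]
      unfolding a X_def[symmetric] v_def[symmetric]
      by (simp add: theta_deriv_def theta_moment_shift theta_moment_minus_1)
  next
    show "((\<lambda>v. 2 * theta_double (1/2) (v + 1/2) t) has_field_derivative 2 * theta_moment 1 (1/2) (1/2) (2 * t)) (at 0)"
      using t2 by (auto intro!: derivative_eq_intros)
    show "(\<lambda>w. theta_double 0 (w + 1/2) t) field_differentiable at (2 * z)"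
      unfolding field_differentiable_def using t2 by (auto intro!: exI derivative_eq_intros)
  qed (use t in \<open>auto intro!: derivative_eq_intros simp: theta_quarter_relations\<close>)
  have a: "z + (z + 1/2) = 2 * z + 1/2" "z - (z + 1/2) = 1/2 - 1" by simp_all
  show "theta_deriv 0 3 z t * theta_deriv 0 4 z t = theta_double 0 (2 * z + 1/2) t * theta_double 0 (1/2) t"
    using theta_series_product[OF t, of 0 z 0 "z + 1/2"] unfolding a
    by (simp add: theta_deriv_def theta_moment_shift theta_moment_minus_1[of _ "1/2", simplified] theta_quarter_relations)
qed

lemma theta_wronskian_3:
  assumes t: "Im t > 0"
  defines "\<Phi> \<equiv> \<lambda>w. theta_double (3/4) (w + 1/2) t - \<i> * theta_double (1/4) (w + 1/2) t"
  shows "theta_deriv 1 3 z t * theta_deriv 0 1 z t - theta_deriv 1 1 z t * theta_deriv 0 3 z t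
      = \<Phi> (2 * z) * (theta_moment 1 (3/4) (1/2) (2 * t) + \<i> * theta_moment 1 (1/4) (1/2) (2 * t))"
    and "theta_deriv 0 4 z t * theta_deriv 0 2 z t = \<Phi> (2 * z) * theta_double (1/4) (1/2) t"
proof -
  have t2: "Im (2 * t) > 0" using t by simp
  show "theta_deriv 1 3 z t * theta_deriv 0 1 z t - theta_deriv 1 1 z t * theta_deriv 0 3 z t
      = \<Phi> (2 * z) * (theta_moment 1 (3/4) (1/2) (2 * t) + \<i> * theta_moment 1 (1/4) (1/2) (2 * t))"
  proof (rule wronskian_of_splitting[where f = "\<lambda>z. theta_deriv 0 3 z t" and g = "\<lambda>z. theta_deriv 0 1 z t"
        and \<Phi> = \<Phi> and \<Psi> = "\<lambda>v. theta_double (3/4) (v + 1/2) t + \<i> * theta_double (1/4) (v + 1/2) t"])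
    fix x
    define X v where "X = x + z + 1/2" and "v = x - z + 1/2"
    have a: "x + (z + 1/2) = X" "x + 1/2 + z = X" "x + 1/2 - z = v" "x - (z + 1/2) = v - 1"
      by (simp_all add: X_def v_def)
    show "theta_deriv 0 3 x t * theta_deriv 0 1 z t - theta_deriv 0 1 x t * theta_deriv 0 3 z t =
         \<Phi> (x + z) * (theta_double (3/4) (x - z + 1 / 2) t + \<i> * theta_double (1/4) (x - z + 1/2) t)"
      using theta_series_product[OF t, of 0 x "1/2" "z + 1/2"] theta_series_product[OF t, of "1/2" "x + 1/2" 0 z]
      unfolding a \<Phi>_def X_def[symmetric] v_def[symmetric]
      by (simp add: theta_deriv_def theta_moment_shift theta_moment_minus_1 algebra_simps)
  next
    show "((\<lambda>v. theta_double (3/4) (v + 1/2) t + \<i> * theta_double (1/4) (v + 1/2) t) has_field_derivative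
         theta_moment 1 (3/4) (1/2) (2 * t) + \<i> * theta_moment 1 (1/4) (1/2) (2 * t)) (at 0)"
      using t2 by (auto intro!: derivative_eq_intros)
    show "\<Phi> field_differentiable at (2 * z)"
      unfolding field_differentiable_def \<Phi>_def using t2 by (auto intro!: exI derivative_eq_intros)
  qed (use t in \<open>auto intro!: derivative_eq_intros simp: theta_quarter_relations\<close>)
  have a: "z + (z + 1/2) = 2 * z + 1/2" "z - (z + 1/2) = 1/2 - 1" by simp_all
  show "theta_deriv 0 4 z t * theta_deriv 0 2 z t = \<Phi> (2 * z) * theta_double (1/4) (1/2) t"
    using theta_series_product[OF t, of "1/2" z 0 "z + 1/2"] unfolding a \<Phi>_def
    by (simp add: theta_deriv_def theta_moment_shift theta_moment_minus_1[of _ "1/2", simplified] theta_quarter_relations algebra_simps)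
qed

lemma theta_wronskian_4:
  assumes t: "Im t > 0"
  defines "\<Phi> \<equiv> \<lambda>w. theta_double (3/4) w t + theta_double (1/4) w t"
  shows "theta_deriv 1 4 z t * theta_deriv 0 1 z t - theta_deriv 1 1 z t * theta_deriv 0 4 z t
      = \<Phi> (2 * z) * (- \<i> * (theta_moment 1 (3/4) 0 (2 * t) - theta_moment 1 (1/4) 0 (2 * t)))"
    and "theta_deriv 0 2 z t * theta_deriv 0 3 z t = \<Phi> (2 * z) * theta_double (1/4) 0 t"
proof -
  have t2: "Im (2 * t) > 0" using t by simp
  show "theta_deriv 1 4 z t * theta_deriv 0 1 z t - theta_deriv 1 1 z t * theta_deriv 0 4 z t
      = \<Phi> (2 * z) * (- \<i> * (theta_moment 1 (3/4) 0 (2 * t) - theta_moment 1 (1/4) 0 (2 * t)))"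
  proof (rule wronskian_of_splitting[where f = "\<lambda>z. theta_deriv 0 4 z t" and g = "\<lambda>z. theta_deriv 0 1 z t"
        and \<Phi> = \<Phi> and \<Psi> = "\<lambda>v. - \<i> * (theta_double (3/4) v t - theta_double (1/4) v t)"])
    fix x
    define X v where "X = x + z" and "v = x - z"
    have a: "x + 1/2 + (z + 1/2) = X + 1" "x + 1/2 - (z + 1/2) = v" by (simp_all add: X_def v_def)
    show "theta_deriv 0 4 x t * theta_deriv 0 1 z t - theta_deriv 0 1 x t * theta_deriv 0 4 z t =
         \<Phi> (x + z) * (- \<i> * (theta_double (3/4) (x - z) t - theta_double (1/4) (x - z) t))"
      using theta_series_product[OF t, of 0 "x + 1/2" "1/2" "z + 1/2"] theta_series_product[OF t, of "1/2" "x + 1/2" 0 "z + 1/2"]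
      unfolding a \<Phi>_def X_def[symmetric] v_def[symmetric]
      by (simp add: theta_deriv_def theta_moment_shift theta_moment_shift(3,4)[of _ X, unfolded add.commute[of X]] algebra_simps)
  next
    show "((\<lambda>v. - \<i> * (theta_double (3/4) v t - theta_double (1/4) v t)) has_field_derivative
         - \<i> * (theta_moment 1 (3/4) 0 (2 * t) - theta_moment 1 (1/4) 0 (2 * t))) (at 0)"
      using t2 by (auto intro!: derivative_eq_intros)
    show "\<Phi> field_differentiable at (2 * z)"
      unfolding field_differentiable_def \<Phi>_def using t2 by (auto intro!: exI derivative_eq_intros)
  qed (use t in \<open>auto intro!: derivative_eq_intros simp: theta_quarter_relations\<close>)
  show "theta_deriv 0 2 z t * theta_deriv 0 3 z t = \<Phi> (2 * z) * theta_double (1/4) 0 t"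
    using theta_series_product[OF t, of "1/2" z 0 z] unfolding \<Phi>_def
    by (simp add: theta_deriv_def theta_moment_shift theta_quarter_relations algebra_simps)
qed

text \<open>
  The product formulas and the first Wronskian at \<open>z = 0\<close>: theta constants at \<open>t\<close> in terms of those
  at \<open>2 * t\<close>, as in the arithmetic-geometric mean.
\<close>

lemma vartheta_doubling:
  assumes t: "Im t > 0"
  shows "theta_deriv 0 3 0 t * theta_deriv 0 4 0 t = (theta_deriv 0 4 0 (2 * t))^2"
    and "(theta_deriv 0 2 0 t)^2 = 2 * theta_deriv 0 2 0 (2 * t) * theta_deriv 0 3 0 (2 * t)"
    and "(theta_deriv 0 3 0 t)^2 = (theta_deriv 0 3 0 (2 * t))^2 + (theta_deriv 0 2 0 (2 * t))^2"
    and "(theta_deriv 0 4 0 t)^2 = (theta_deriv 0 3 0 (2 * t))^2 - (theta_deriv 0 2 0 (2 * t))^2"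
    and "theta_deriv 1 1 0 t * theta_deriv 0 2 0 t = 2 * theta_deriv 0 4 0 (2 * t) * theta_deriv 1 1 0 (2 * t)"
  using theta_wronskian_2[OF t, of 0] theta_products[OF t, of 0 0] theta_even_odd_0[of _ t]
  by (simp_all add: theta_deriv_def power2_eq_square)

text \<open>
  A zero would propagate to all \<open>2 ^ n * t\<close> and contradict the limit there.
\<close>

lemma doubling_nonzero:
  fixes f :: "complex \<Rightarrow> complex"
  assumes "\<And>n. f (2 ^ n * t) = 0 \<Longrightarrow> f (2 * (2 ^ n * t)) = 0"
    and "(\<lambda>n. f (2 ^ n * t) * g n) \<longlonglongrightarrow> L" "L \<noteq> 0"
  shows "f t \<noteq> 0"
proof
  assume "f t = 0"
  have "f (2 ^ n * t) = 0" for n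
    by (induction n) (use \<open>f t = 0\<close> assms(1) in \<open>auto simp: mult.assoc\<close>)
  then show False using assms(2,3) LIMSEQ_unique[of "\<lambda>_. 0" 0 L] by simp
qed

lemma vartheta_limits:
  assumes t: "Im t > 0"
  defines "q \<equiv> \<lambda>n. exp (- (pi * \<i> / 4 * (2 ^ n * t)))"
  shows "(\<lambda>n. theta_deriv 0 3 0 (2 ^ n * t)) \<longlonglongrightarrow> 1"
    "(\<lambda>n. theta_deriv 0 4 0 (2 ^ n * t)) \<longlonglongrightarrow> 1"
    "(\<lambda>n. theta_deriv 0 2 0 (2 ^ n * t) * q n) \<longlonglongrightarrow> 2"
    "(\<lambda>n. theta_deriv 1 1 0 (2 ^ n * t) * q n) \<longlonglongrightarrow> 2 * pi"
proof -
  show "(\<lambda>n. theta_deriv 0 3 0 (2 ^ n * t)) \<longlonglongrightarrow> 1"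
    "(\<lambda>n. theta_deriv 0 4 0 (2 ^ n * t)) \<longlonglongrightarrow> 1"
    using theta_moment_0_asymp[OF t] by (simp_all add: theta_deriv_def)
  show "(\<lambda>n. theta_deriv 0 2 0 (2 ^ n * t) * q n) \<longlonglongrightarrow> 2"
    using theta_moment_half_asymp[OF t, of 0 0] by (simp add: theta_deriv_def q_def)
  have e: "exp (pi * \<i> * (1/2)) = \<i>" "exp (- (pi * \<i> * (1/2))) = - \<i>"
    using exp_2pi_quarter exp_minus[of "pi * \<i> * (1/2)"] by (simp_all add: field_simps)
  show "(\<lambda>n. theta_deriv 1 1 0 (2 ^ n * t) * q n) \<longlonglongrightarrow> 2 * pi"
    using tendsto_minus[OF theta_moment_half_asymp[OF t, of 1 "1/2"]]
    unfolding e by (simp add: theta_deriv_def q_def)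
qed

text \<open>
  By the doubling formulas a zero of \<open>\<vartheta>\<^sub>4\<close> propagates directly, a zero of \<open>\<vartheta>\<^sub>3\<close> produces one of
  \<open>\<vartheta>\<^sub>4\<close>, and a zero of \<open>\<vartheta>\<^sub>2\<close> propagates once \<open>\<vartheta>\<^sub>3\<close> is known not to vanish.
\<close>

lemma vartheta_nonzero:
  assumes t: "Im t > 0"
  shows "theta_deriv 0 2 0 t \<noteq> 0" "theta_deriv 0 3 0 t \<noteq> 0" "theta_deriv 0 4 0 t \<noteq> 0"
proof -
  have n4: "theta_deriv 0 4 0 t \<noteq> 0" if t: "Im t > 0" for t
  proof (rule doubling_nonzero[where f = "theta_deriv 0 4 0" and g = "\<lambda>_. 1" and L = 1])
    fix n assume "theta_deriv 0 4 0 (2 ^ n * t) = 0"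
    then show "theta_deriv 0 4 0 (2 * (2 ^ n * t)) = 0"
      using vartheta_doubling(1)[of "2 ^ n * t"] t by simp
  qed (use vartheta_limits(2)[OF t] in auto)
  have n3: "theta_deriv 0 3 0 t \<noteq> 0" if t: "Im t > 0" for t
    using vartheta_doubling(1)[OF t] n4[of "2 * t"] t by auto
  show "theta_deriv 0 2 0 t \<noteq> 0"
  proof (rule doubling_nonzero[where f = "theta_deriv 0 2 0" and g = "\<lambda>n. exp (- (pi * \<i> / 4 * (2 ^ n * t)))" and L = 2])
    fix n assume "theta_deriv 0 2 0 (2 ^ n * t) = 0"
    then show "theta_deriv 0 2 0 (2 * (2 ^ n * t)) = 0"
      using vartheta_doubling(2)[of "2 ^ n * t"] n3[of "2 * (2 ^ n * t)"] t by simp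
  qed (use vartheta_limits(3)[OF t] in auto)
  show "theta_deriv 0 3 0 t \<noteq> 0" "theta_deriv 0 4 0 t \<noteq> 0" using n3 n4 t by auto
qed

text \<open>
  Jacobi's derivative formula. The quotient of the two sides is invariant under \<open>t \<mapsto> 2 * t\<close> by the
  doubling formulas, hence equal to its limit for \<open>2 ^ n * t\<close>, which the leading terms give as \<open>pi\<close>.
\<close>

lemma jacobi_derivative:
  assumes t: "Im t > 0"
  shows "theta_deriv 1 1 0 t = pi * theta_deriv 0 2 0 t * theta_deriv 0 3 0 t * theta_deriv 0 4 0 t"
proof -
  define R where "R = (\<lambda>t. theta_deriv 1 1 0 t / (theta_deriv 0 2 0 t * theta_deriv 0 3 0 t * theta_deriv 0 4 0 t))"
  have step: "R (2 * t) = R t" if t: "Im t > 0" for t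
  proof -
    have t2: "Im (2 * t) > 0" using t by simp
    note nz = vartheta_nonzero[OF t] vartheta_nonzero[OF t2]
    have "theta_deriv 0 2 0 t * (theta_deriv 1 1 0 t * (theta_deriv 0 2 0 (2*t) * theta_deriv 0 3 0 (2*t) * theta_deriv 0 4 0 (2*t)))
      = theta_deriv 0 2 0 t * (theta_deriv 1 1 0 (2 * t) * (theta_deriv 0 2 0 t * theta_deriv 0 3 0 t * theta_deriv 0 4 0 t))"
      using vartheta_doubling(1,2,5)[OF t] by algebra
    then have "theta_deriv 1 1 0 t * (theta_deriv 0 2 0 (2*t) * theta_deriv 0 3 0 (2*t) * theta_deriv 0 4 0 (2*t))
      = theta_deriv 1 1 0 (2 * t) * (theta_deriv 0 2 0 t * theta_deriv 0 3 0 t * theta_deriv 0 4 0 t)"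
      using nz by simp
    then show ?thesis unfolding R_def using nz by (simp add: frac_eq_eq)
  qed
  have R: "R (2 ^ n * t) = R t" for n
  proof (induction n)
    case (Suc n)
    have "R (2 ^ Suc n * t) = R (2 * (2 ^ n * t))" by (simp add: mult.assoc)
    also have "\<dots> = R (2 ^ n * t)" by (rule step) (use t in simp)
    finally show ?case using Suc by simp
  qed simp
  define q where "q = (\<lambda>n. exp (- (pi * \<i> / 4 * (2 ^ n * t))))"
  have "(\<lambda>n. (theta_deriv 1 1 0 (2 ^ n * t) * q n) /
      ((theta_deriv 0 2 0 (2 ^ n * t) * q n) * theta_deriv 0 3 0 (2 ^ n * t) * theta_deriv 0 4 0 (2 ^ n * t)))
      \<longlonglongrightarrow> complex_of_real (2 * pi) / (2 * 1 * 1)"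
    unfolding q_def by (intro tendsto_intros vartheta_limits t) auto
  also have "(\<lambda>n. (theta_deriv 1 1 0 (2 ^ n * t) * q n) /
      ((theta_deriv 0 2 0 (2 ^ n * t) * q n) * theta_deriv 0 3 0 (2 ^ n * t) * theta_deriv 0 4 0 (2 ^ n * t)))
      = (\<lambda>n. R (2 ^ n * t))"
    by (auto simp: R_def q_def fun_eq_iff)
  finally have "R t = pi" unfolding R using LIMSEQ_unique[OF tendsto_const] by fastforce
  then show ?thesis unfolding R_def using vartheta_nonzero[OF t] by (simp add: field_simps)
qed

text \<open>
  The Wronskian is a constant multiple of the product on the right, by \<open>theta_wronskian_2\<close> and its
  two analogues; the constant is found at \<open>z = 0\<close> from Jacobi's derivative formula.
\<close>

lemma theta_wronskian:
  assumes t: "Im t > 0"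
  shows "theta_deriv 1 2 z t * theta_deriv 0 1 z t - theta_deriv 1 1 z t * theta_deriv 0 2 z t
      = - (pi * (theta_deriv 0 2 0 t)^2 * (theta_deriv 0 3 z t * theta_deriv 0 4 z t))" (is ?W2)
    and "theta_deriv 1 3 z t * theta_deriv 0 1 z t - theta_deriv 1 1 z t * theta_deriv 0 3 z t
      = - (pi * (theta_deriv 0 3 0 t)^2 * (theta_deriv 0 4 z t * theta_deriv 0 2 z t))" (is ?W3)
    and "theta_deriv 1 4 z t * theta_deriv 0 1 z t - theta_deriv 1 1 z t * theta_deriv 0 4 z t
      = - (pi * (theta_deriv 0 4 0 t)^2 * (theta_deriv 0 2 z t * theta_deriv 0 3 z t))" (is ?W4)
proof -
  (* P and W are multiples of F; F0 is the value of F at z = 0, which relates the two factors. *)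
  have fix_const: "W = - (p * a^2 * P)"
    if "W = F * D" "P = F * c" "b * d = F0 * c" "- (p * a * b * d) * a = F0 * D" "b * d \<noteq> 0"
    for W F D P a b c d F0 p :: complex
  proof -
    have "(b * d) * W = (b * d) * (- (p * a^2 * P))" using that(1-4) by algebra
    with that(5) show ?thesis by (metis mult_left_cancel)
  qed
  note nz = vartheta_nonzero[OF t] and J = jacobi_derivative[OF t]
  have zero: "theta_deriv 0 1 0 t = 0" by (rule theta_even_odd_0) simp
  show ?W2
    by (rule fix_const[OF theta_wronskian_2[OF t, of z] theta_wronskian_2(2)[OF t, of 0]])
       (use theta_wronskian_2(1)[OF t, of 0] J zero nz in \<open>simp_all add: mult_ac\<close>)
  show ?W3
    by (rule fix_const[OF theta_wronskian_3[OF t, of z] theta_wronskian_3(2)[OF t, of 0]])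
       (use theta_wronskian_3(1)[OF t, of 0] J zero nz in \<open>simp_all add: mult_ac\<close>)
  show ?W4
    by (rule fix_const[OF theta_wronskian_4[OF t, of z] theta_wronskian_4(2)[OF t, of 0]])
       (use theta_wronskian_4(1)[OF t, of 0] J zero nz in \<open>simp_all add: mult_ac\<close>)
qed

section \<open>The second logarithmic derivative\<close>

text \<open>
  The product \<open>\<theta>\<^sub>1(z + u) \<theta>\<^sub>1(z - u)\<close> is a combination of two functions of \<open>2 * z\<close> whose coefficients
  depend on \<open>u\<close> alone. The second \<open>u\<close>-derivative at \<open>u = 0\<close> is twice the left-hand side, while
  \<open>u = 0\<close> itself expresses \<open>\<theta>\<^sub>1^2\<close> and \<open>\<theta>\<^sub>2^2\<close> by the same two functions. The coefficient of \<open>\<theta>\<^sub>2^2\<close>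
  is read off at \<open>z = 0\<close>; the value of \<open>c\<close> is left open here.
\<close>

lemma theta_log_deriv2_exists:
  assumes t: "Im t > 0"
  obtains c where "\<And>z. theta_deriv 2 1 z t * theta_deriv 0 1 z t - (theta_deriv 1 1 z t)^2
      = - c * (theta_deriv 0 1 z t)^2
        - (pi * theta_deriv 0 3 0 t * theta_deriv 0 4 0 t)^2 * (theta_deriv 0 2 z t)^2"
proof -
  have t2: "Im (2 * t) > 0" using t by simp
  define x y x2 y2 where "x = theta_double 0 0 t" and "y = theta_double (1/2) 0 t"
    and "x2 = theta_moment 2 0 0 (2 * t)" and "y2 = theta_moment 2 (1/2) 0 (2 * t)"
  have nz: "x \<noteq> 0" "y \<noteq> 0"
    using vartheta_nonzero[OF t2] by (simp_all add: x_def y_def theta_deriv_def)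
  have second: "theta_deriv 2 1 z t * theta_deriv 0 1 z t - (theta_deriv 1 1 z t)^2
     = 2 * (theta_double 0 (2 * z) t * y2 - theta_double (1/2) (2 * z) t * x2)" for z
  proof -
    define F where "F = (\<lambda>u. theta_deriv 0 1 (z + u) t * theta_deriv 0 1 (z - u) t
       - (theta_double 0 (2 * z) t * theta_double (1/2) (2 * u) t - theta_double (1/2) (2 * z) t * theta_double 0 (2 * u) t))"
    define F1 where "F1 = (\<lambda>u. theta_deriv 1 1 (z + u) t * theta_deriv 0 1 (z - u) t
       - theta_deriv 0 1 (z + u) t * theta_deriv 1 1 (z - u) t
       - 2 * (theta_double 0 (2 * z) t * theta_moment 1 (1/2) (2 * u) (2 * t)
              - theta_double (1/2) (2 * z) t * theta_moment 1 0 (2 * u) (2 * t)))"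
    have F0: "F u = 0" for u
      using theta_products(1)[OF t, of "z + u" "z - u"] by (simp add: F_def)
    have "(F has_field_derivative F1 u) (at u)" for u
      unfolding F_def F1_def using t t2
      by (auto intro!: derivative_eq_intros simp: algebra_simps)
    then have F1: "F1 u = 0" for u using deriv_of_identity[of F] F0 by blast
    have "(F1 has_field_derivative 2 * (theta_deriv 2 1 z t * theta_deriv 0 1 z t - (theta_deriv 1 1 z t)^2)
       - 4 * (theta_double 0 (2 * z) t * y2 - theta_double (1/2) (2 * z) t * x2)) (at 0)"
      unfolding F1_def x2_def y2_def using t t2
      by (auto intro!: derivative_eq_intros simp: algebra_simps power2_eq_square numeral_2_eq_2)
    then have "2 * (theta_deriv 2 1 z t * theta_deriv 0 1 z t - (theta_deriv 1 1 z t)^2)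
       - 4 * (theta_double 0 (2 * z) t * y2 - theta_double (1/2) (2 * z) t * x2) = 0"
      using deriv_of_identity F1 by blast
    moreover have "a = 2 * b" if "2 * a - 4 * b = 0" for a b :: complex
    proof -
      have "2 * (a - 2 * b) = 0" using that by (simp add: algebra_simps)
      then show ?thesis by simp
    qed
    ultimately show ?thesis by blast
  qed
  have sq: "2 * (theta_double 0 (2 * z) t * y) = (theta_deriv 0 1 z t)^2 + (theta_deriv 0 2 z t)^2"
     "2 * (theta_double (1/2) (2 * z) t * x) = (theta_deriv 0 2 z t)^2 - (theta_deriv 0 1 z t)^2" for z
    using theta_products(1,2)[OF t, of z z] by (simp_all add: x_def y_def power2_eq_square)
  define \<alpha> \<beta> where "\<alpha> = y2 / y + x2 / x" and "\<beta> = y2 / y - x2 / x"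
  have main: "theta_deriv 2 1 z t * theta_deriv 0 1 z t - (theta_deriv 1 1 z t)^2
      = \<alpha> * (theta_deriv 0 1 z t)^2 + \<beta> * (theta_deriv 0 2 z t)^2" for z
  proof -
    have "2 * (theta_double 0 (2 * z) t * y2 - theta_double (1/2) (2 * z) t * x2)
      = (2 * (theta_double 0 (2 * z) t * y)) * (y2 / y) - (2 * (theta_double (1/2) (2 * z) t * x)) * (x2 / x)"
      using nz by (simp add: field_simps)
    then show ?thesis unfolding second sq \<alpha>_def \<beta>_def by (simp add: algebra_simps)
  qed
  have "theta_deriv 0 1 0 t = 0" by (rule theta_even_odd_0) simp
  then have "- ((theta_deriv 1 1 0 t)^2) = \<beta> * (theta_deriv 0 2 0 t)^2" using main[of 0] by simp
  then have "(theta_deriv 0 2 0 t)^2 * \<beta> = (theta_deriv 0 2 0 t)^2 * (- ((pi * theta_deriv 0 3 0 t * theta_deriv 0 4 0 t)^2))"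
    unfolding jacobi_derivative[OF t] by (simp add: power_mult_distrib mult_ac)
  then have \<beta>: "\<beta> = - ((pi * theta_deriv 0 3 0 t * theta_deriv 0 4 0 t)^2)"
    using vartheta_nonzero[OF t] by (metis mult_left_cancel power_eq_0_iff)
  show ?thesis by (rule that[of "- \<alpha>"]) (use main[unfolded \<beta>] in simp)
qed

text \<open>
  All four squares are combinations of the same two functions of \<open>2 * z\<close>, so any three of them
  are linearly dependent.
\<close>

lemma theta_square_relations:
  assumes t: "Im t > 0"
  shows "(theta_deriv 0 2 z t)^2 * (theta_deriv 0 3 0 t)^2
       = (theta_deriv 0 3 z t)^2 * (theta_deriv 0 2 0 t)^2 - (theta_deriv 0 1 z t)^2 * (theta_deriv 0 4 0 t)^2"
    and "(theta_deriv 0 2 z t)^2 * (theta_deriv 0 4 0 t)^2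
       = (theta_deriv 0 4 z t)^2 * (theta_deriv 0 2 0 t)^2 - (theta_deriv 0 1 z t)^2 * (theta_deriv 0 3 0 t)^2"
proof -
  note P = theta_products[OF t, of z z] and C = theta_products[OF t, of 0 0]
  define X Y x y where "X = theta_double 0 (2*z) t" and "Y = theta_double (1/2) (2 * z) t"
    and "x = theta_double 0 0 t" and "y = theta_double (1/2) 0 t"
  have P: "(theta_deriv 0 1 z t)^2 = X * y - Y * x" "(theta_deriv 0 2 z t)^2 = Y * x + X * y"
    "(theta_deriv 0 3 z t)^2 = X * x + Y * y" "(theta_deriv 0 4 z t)^2 = X * x - Y * y"
    using P by (simp_all add: power2_eq_square X_def Y_def x_def y_def)
  have C: "(theta_deriv 0 2 0 t)^2 = 2 * x * y" "(theta_deriv 0 3 0 t)^2 = x^2 + y^2"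
    "(theta_deriv 0 4 0 t)^2 = x^2 - y^2"
    using C by (simp_all add: power2_eq_square x_def y_def)
  show "(theta_deriv 0 2 z t)^2 * (theta_deriv 0 3 0 t)^2
       = (theta_deriv 0 3 z t)^2 * (theta_deriv 0 2 0 t)^2 - (theta_deriv 0 1 z t)^2 * (theta_deriv 0 4 0 t)^2"
    "(theta_deriv 0 2 z t)^2 * (theta_deriv 0 4 0 t)^2
       = (theta_deriv 0 4 z t)^2 * (theta_deriv 0 2 0 t)^2 - (theta_deriv 0 1 z t)^2 * (theta_deriv 0 3 0 t)^2"
    unfolding P C by (simp_all add: algebra_simps power2_eq_square)
qed

text \<open>
  The same identity with \<open>\<theta>\<^sub>3^2\<close> or \<open>\<theta>\<^sub>4^2\<close> in place of \<open>\<theta>\<^sub>2^2\<close>. In Weierstrass' notation the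
  coefficient of \<open>- \<theta>\<^sub>1^2\<close> is \<open>4 (\<eta> + e)\<close> with \<open>e\<close> the value of the elliptic function at the
  corresponding half-period.
\<close>

lemma theta_log_deriv2_all:
  assumes t: "Im t > 0"
    and I2: "\<And>z. theta_deriv 2 1 z t * theta_deriv 0 1 z t - (theta_deriv 1 1 z t)^2
      = - c * (theta_deriv 0 1 z t)^2
        - (pi * theta_deriv 0 3 0 t * theta_deriv 0 4 0 t)^2 * (theta_deriv 0 2 z t)^2"
  shows "theta_deriv 2 1 z t * theta_deriv 0 1 z t - (theta_deriv 1 1 z t)^2
      = - (c - pi^2 * (theta_deriv 0 4 0 t)^4) * (theta_deriv 0 1 z t)^2
        - (pi * theta_deriv 0 2 0 t * theta_deriv 0 4 0 t)^2 * (theta_deriv 0 3 z t)^2"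
    and "theta_deriv 2 1 z t * theta_deriv 0 1 z t - (theta_deriv 1 1 z t)^2
      = - (c - pi^2 * (theta_deriv 0 3 0 t)^4) * (theta_deriv 0 1 z t)^2
        - (pi * theta_deriv 0 2 0 t * theta_deriv 0 3 0 t)^2 * (theta_deriv 0 4 z t)^2"
  unfolding of_real_power
  using I2[of z] theta_square_relations[OF t, of z] by algebra+

text \<open>
  The identity and its first two derivatives, evaluated at a zero of \<open>\<theta>\<^sub>1\<close>, determine in turn
  \<open>\<theta>\<^sub>k^2\<close>, \<open>\<theta>\<^sub>k'\<close> and \<open>\<theta>\<^sub>k''\<close> from \<open>\<theta>\<^sub>1'\<close> and \<open>m\<close>. It serves twice: at \<open>z = 0\<close> with \<open>m = 0\<close>, to
  identify the constant \<open>c\<close>, and with \<open>m = - 4 * pi * \<i> * A\<close> in the case where \<open>\<theta>\<^sub>1\<close> vanishes along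
  the whole curve.
\<close>

lemma theta_derivs_at_zero:
  assumes t: "Im t > 0"
    and I2: "\<And>z. theta_deriv 2 1 z t * theta_deriv 0 1 z t - (theta_deriv 1 1 z t)^2
      = - c * (theta_deriv 0 1 z t)^2 - d^2 * (theta_deriv 0 k z t)^2"
    and d: "d \<noteq> 0"
    and zero: "theta_deriv 0 1 z t = 0" and nz: "theta_deriv 1 1 z t \<noteq> 0"
    and m: "theta_deriv 2 1 z t = m * theta_deriv 1 1 z t"
  shows "theta_deriv 0 k z t \<noteq> 0"
    and "theta_deriv 1 k z t = m / 2 * theta_deriv 0 k z t"
    and "theta_deriv 2 k z t = (m^2 / 4 - c) * theta_deriv 0 k z t"
proof -
  let ?f = "\<lambda>j z. theta_deriv j 1 z t" and ?g = "\<lambda>j z. theta_deriv j k z t"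
  have i0: "(?f 1 z)^2 = d^2 * (?g 0 z)^2" using I2[of z] zero by simp
  then show gnz: "?g 0 z \<noteq> 0" using nz by auto
  define L where "L = (\<lambda>z. ?f 2 z * ?f 0 z - (?f 1 z)^2 + c * (?f 0 z)^2 + d^2 * (?g 0 z)^2)"
  define L1 where "L1 = (\<lambda>z. ?f 3 z * ?f 0 z - ?f 1 z * ?f 2 z + 2 * c * ?f 0 z * ?f 1 z + 2 * d^2 * ?g 0 z * ?g 1 z)"
  have L: "L z = 0" for z using I2[of z] by (simp add: L_def)
  have "(L has_field_derivative L1 z) (at z)" for z
    unfolding L_def L1_def using t
    by (auto intro!: derivative_eq_intros
       simp: algebra_simps power2_eq_square numeral_3_eq_3 numeral_2_eq_2)
  then have L1: "L1 z = 0" for z using deriv_of_identity[of L] L by blast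
  have "(L1 has_field_derivative ?f 4 z * ?f 0 z - (?f 2 z)^2 + 2 * c * ((?f 1 z)^2 + ?f 0 z * ?f 2 z)
     + 2 * d^2 * ((?g 1 z)^2 + ?g 0 z * ?g 2 z)) (at z)" for z
    unfolding L1_def using t
    by (auto intro!: derivative_eq_intros
       simp: algebra_simps power2_eq_square eval_nat_numeral)
  then have L2: "?f 4 z * ?f 0 z - (?f 2 z)^2 + 2 * c * ((?f 1 z)^2 + ?f 0 z * ?f 2 z)
     + 2 * d^2 * ((?g 1 z)^2 + ?g 0 z * ?g 2 z) = 0" for z
    using deriv_of_identity[of L1] L1 by blast
  have dg: "2 * d^2 * ?g 0 z \<noteq> 0" using gnz d by simp
  have "m * (?f 1 z)^2 = 2 * d^2 * ?g 0 z * ?g 1 z"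
    using L1[of z] zero m by (simp add: L1_def power2_eq_square mult_ac)
  then have "(2 * d^2 * ?g 0 z) * ?g 1 z = (2 * d^2 * ?g 0 z) * (m / 2 * ?g 0 z)"
    unfolding i0 by (auto simp: power2_eq_square mult_ac)
  then show g1: "?g 1 z = m / 2 * ?g 0 z" using dg by (metis mult_left_cancel)
  have "m^2 * (d^2 * (?g 0 z)^2) = 2 * c * (d^2 * (?g 0 z)^2) + 2 * d^2 * ((m / 2 * ?g 0 z)^2 + ?g 0 z * ?g 2 z)"
    using L2[of z] zero m unfolding g1[symmetric] i0[symmetric] by (simp add: power_mult_distrib algebra_simps)
  then have "(2 * d^2 * ?g 0 z) * ?g 2 z = (2 * d^2 * ?g 0 z) * ((m^2 / 4 - c) * ?g 0 z)"
    by (simp add: power2_eq_square field_simps)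
  then show "?g 2 z = (m^2 / 4 - c) * ?g 0 z" using dg by (metis mult_left_cancel)
qed

text \<open>
  Differentiating the Wronskian of \<open>\<theta>\<^sub>2\<close> and \<open>\<theta>\<^sub>1\<close> twice brings in \<open>\<theta>\<^sub>1'''\<close>; at the zero all other
  terms are known, and each is a multiple of \<open>\<theta>\<^sub>1' \<theta>\<^sub>2\<close>.
\<close>

lemma theta1_deriv3_at_zero:
  assumes t: "Im t > 0"
    and I2: "\<And>z. theta_deriv 2 1 z t * theta_deriv 0 1 z t - (theta_deriv 1 1 z t)^2
      = - c * (theta_deriv 0 1 z t)^2
        - (pi * theta_deriv 0 3 0 t * theta_deriv 0 4 0 t)^2 * (theta_deriv 0 2 z t)^2"
    and zero: "theta_deriv 0 1 z t = 0" and nz: "theta_deriv 1 1 z t \<noteq> 0"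
    and m: "theta_deriv 2 1 z t = m * theta_deriv 1 1 z t"
  shows "theta_deriv 3 1 z t = (3 * m^2 / 4 - 3 * c
     + pi^2 * ((theta_deriv 0 3 0 t)^4 + (theta_deriv 0 4 0 t)^4)) * theta_deriv 1 1 z t"
proof -
  let ?f = "\<lambda>j k z. theta_deriv j k z t"
  note v = vartheta_nonzero[OF t]
  note d2 = theta_derivs_at_zero[OF t I2 _ zero nz m]
  note d3 = theta_derivs_at_zero[OF t theta_log_deriv2_all(1)[OF t I2] _ zero nz m]
  note d4 = theta_derivs_at_zero[OF t theta_log_deriv2_all(2)[OF t I2] _ zero nz m]
  define p where "p = pi * (?f 0 2 0)^2"
  define L where "L = (\<lambda>z. ?f 1 2 z * ?f 0 1 z - ?f 1 1 z * ?f 0 2 z + p * (?f 0 3 z * ?f 0 4 z))"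
  define L1 where "L1 = (\<lambda>z. ?f 2 2 z * ?f 0 1 z - ?f 2 1 z * ?f 0 2 z + p * (?f 1 3 z * ?f 0 4 z + ?f 0 3 z * ?f 1 4 z))"
  have L: "L z = 0" for z using theta_wronskian(1)[OF t, of z] by (simp add: L_def p_def)
  have "(L has_field_derivative L1 z) (at z)" for z
    unfolding L_def L1_def using t
    by (auto intro!: derivative_eq_intros simp: algebra_simps numeral_2_eq_2)
  then have L1: "L1 z = 0" for z using deriv_of_identity[of L] L by blast
  have "(L1 has_field_derivative ?f 3 2 z * ?f 0 1 z + ?f 2 2 z * ?f 1 1 z - ?f 3 1 z * ?f 0 2 z - ?f 2 1 z * ?f 1 2 z
     + p * (?f 2 3 z * ?f 0 4 z + 2 * ?f 1 3 z * ?f 1 4 z + ?f 0 3 z * ?f 2 4 z)) (at z)" for z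
    unfolding L1_def using t
    by (auto intro!: derivative_eq_intros simp: algebra_simps eval_nat_numeral)
  then have L2: "?f 3 2 z * ?f 0 1 z + ?f 2 2 z * ?f 1 1 z - ?f 3 1 z * ?f 0 2 z - ?f 2 1 z * ?f 1 2 z
     + p * (?f 2 3 z * ?f 0 4 z + 2 * ?f 1 3 z * ?f 1 4 z + ?f 0 3 z * ?f 2 4 z) = 0" for z
    using deriv_of_identity[of L1] L1 by blast
  define c3 c4 where "c3 = c - pi^2 * (?f 0 4 0)^4" and "c4 = c - pi^2 * (?f 0 3 0)^4"
  have e2: "?f 0 2 z \<noteq> 0" "?f 1 2 z = m / 2 * ?f 0 2 z" "?f 2 2 z = (m^2 / 4 - c) * ?f 0 2 z"
    using d2 v by auto
  have e3: "?f 1 3 z = m / 2 * ?f 0 3 z" "?f 2 3 z = (m^2 / 4 - c3) * ?f 0 3 z"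
    using d3 v by (auto simp: c3_def)
  have e4: "?f 1 4 z = m / 2 * ?f 0 4 z" "?f 2 4 z = (m^2 / 4 - c4) * ?f 0 4 z"
    using d4 v by (auto simp: c4_def)
  have w: "p * (?f 0 3 z * ?f 0 4 z) = ?f 1 1 z * ?f 0 2 z"
    using L[of z] zero by (simp add: L_def)
  have "?f 3 1 z * ?f 0 2 z = (m^2 / 4 - c) * ?f 0 2 z * ?f 1 1 z - m * ?f 1 1 z * (m / 2 * ?f 0 2 z)
     + (m^2 / 4 - c3 + 2 * (m / 2)^2 + (m^2 / 4 - c4)) * (p * (?f 0 3 z * ?f 0 4 z))"
    using L2[of z] unfolding zero m e2(2,3) e3 e4 by (simp add: algebra_simps power2_eq_square)
  also have "\<dots> = (3 * m^2 / 4 - c - c3 - c4) * ?f 1 1 z * ?f 0 2 z"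
    unfolding w by (simp add: field_simps power2_eq_square)
  finally have "?f 3 1 z = (3 * m^2 / 4 - c - c3 - c4) * ?f 1 1 z" using e2(1) by simp
  then show ?thesis by (simp add: c3_def c4_def algebra_simps)
qed

text \<open>
  This will turn out to be \<open>eta\<close>.
\<close>

definition theta1_ratio :: "complex \<Rightarrow> complex" where
  "theta1_ratio t = - theta_deriv 3 1 0 t / (12 * theta_deriv 1 1 0 t)"

text \<open>
  The constant \<open>c\<close> is found by applying the previous lemma at the zero \<open>z = 0\<close>.
\<close>

lemma theta_log_deriv2:
  assumes t: "Im t > 0"
  shows "theta_deriv 2 1 z t * theta_deriv 0 1 z t - (theta_deriv 1 1 z t)^2
      = - (4 * theta1_ratio t + pi^2 / 3 * ((theta_deriv 0 3 0 t)^4 + (theta_deriv 0 4 0 t)^4)) * (theta_deriv 0 1 z t)^2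
        - (pi * theta_deriv 0 3 0 t * theta_deriv 0 4 0 t)^2 * (theta_deriv 0 2 z t)^2"
proof -
  obtain c where I2: "\<And>z. theta_deriv 2 1 z t * theta_deriv 0 1 z t - (theta_deriv 1 1 z t)^2
      = - c * (theta_deriv 0 1 z t)^2
        - (pi * theta_deriv 0 3 0 t * theta_deriv 0 4 0 t)^2 * (theta_deriv 0 2 z t)^2"
    using theta_log_deriv2_exists[OF t] by metis
  have nz: "theta_deriv 1 1 0 t \<noteq> 0"
    using jacobi_derivative[OF t] vartheta_nonzero[OF t] by simp
  have "theta_deriv 3 1 0 t = (3 * 0^2 / 4 - 3 * c
     + pi^2 * ((theta_deriv 0 3 0 t)^4 + (theta_deriv 0 4 0 t)^4)) * theta_deriv 1 1 0 t"
    by (rule theta1_deriv3_at_zero[OF t I2 _ nz]) (simp_all add: theta_even_odd_0 del: One_nat_def)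
  then have "theta1_ratio t = - (- 3 * c + pi^2 * ((theta_deriv 0 3 0 t)^4 + (theta_deriv 0 4 0 t)^4)) / 12"
    using nz unfolding theta1_ratio_def by (simp add: field_simps)
  then have "c = 4 * theta1_ratio t + pi^2 / 3 * ((theta_deriv 0 3 0 t)^4 + (theta_deriv 0 4 0 t)^4)"
    by (simp add: field_simps)
  then show ?thesis using I2 by simp
qed

section \<open>A finite product for the first theta function\<close>

text \<open>
  The \<open>q\<close>-Pochhammer symbol \<open>(p; p)\<^sub>n\<close>.
\<close>

definition qpoch :: "complex \<Rightarrow> nat \<Rightarrow> complex" where
  "qpoch p n = (\<Prod>i<n. 1 - p ^ Suc i)"

text \<open>
  The Gaussian binomial coefficient. The value \<open>0\<close> for \<open>j > M\<close> makes Pascal's rule hold for \<open>j = M\<close>.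
\<close>

definition qbinomial :: "complex \<Rightarrow> nat \<Rightarrow> nat \<Rightarrow> complex" where
  "qbinomial p M j = (if j \<le> M then qpoch p M / (qpoch p j * qpoch p (M - j)) else 0)"

lemma one_minus_power_nonzero:
  fixes p :: complex
  assumes "norm p < 1"
  shows "1 - p ^ Suc i \<noteq> 0"
proof
  assume "1 - p ^ Suc i = 0"
  then have "norm (p ^ Suc i) = 1" by (simp del: power_Suc)
  moreover have "norm (p ^ Suc i) < 1"
    unfolding norm_power using power_Suc_less_one[of "norm p" i] assms by (cases "p = 0") auto
  ultimately show False by simp
qed

lemma qpoch_nonzero: "norm p < 1 \<Longrightarrow> qpoch p n \<noteq> 0"
  using one_minus_power_nonzero by (auto simp: qpoch_def)

lemma qbinomial_Suc_Suc:
  assumes p: "norm p < 1" and j: "j \<le> M"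
  shows "qbinomial p (Suc M) (Suc j) = qbinomial p M (Suc j) + p ^ (M - j) * qbinomial p M j"
proof (cases "j = M")
  case True
  then show ?thesis using qpoch_nonzero[OF p] by (simp add: qbinomial_def)
next
  case False
  with j obtain r where r: "M = j + Suc r" using less_imp_Suc_add[of j M] by auto
  have S: "qpoch p (Suc n) = qpoch p n * (1 - p ^ Suc n)" for n by (simp add: qpoch_def)
  note nz = qpoch_nonzero[OF p]
  have [simp]: "p ^ Suc j \<noteq> 1" "p ^ Suc r \<noteq> 1"
    using one_minus_power_nonzero[OF p, of j] one_minus_power_nonzero[OF p, of r] by auto
  have "qbinomial p (Suc M) (Suc j) = qpoch p M * (1 - p ^ Suc M) / (qpoch p j * (1 - p ^ Suc j) * (qpoch p r * (1 - p ^ Suc r)))"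
    by (simp add: qbinomial_def r S del: power_Suc)
  also have "1 - p ^ Suc M = (1 - p ^ Suc r) + p ^ Suc r * (1 - p ^ Suc j)"
    by (simp add: r algebra_simps power_add)
  also have "qpoch p M * ((1 - p ^ Suc r) + p ^ Suc r * (1 - p ^ Suc j)) / (qpoch p j * (1 - p ^ Suc j) * (qpoch p r * (1 - p ^ Suc r)))
     = qpoch p M / (qpoch p j * (1 - p ^ Suc j) * qpoch p r)
       + p ^ Suc r * (qpoch p M / (qpoch p j * (qpoch p r * (1 - p ^ Suc r))))"
    using nz by (simp add: divide_simps del: power_Suc) (simp add: algebra_simps del: power_Suc)
  also have "\<dots> = qbinomial p M (Suc j) + p ^ (M - j) * qbinomial p M j"
    by (simp add: qbinomial_def r S del: power_Suc)
  finally show ?thesis .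
qed

text \<open>
  Rothe's \<open>q\<close>-binomial theorem, with the usual power \<open>p ^ (j * (j - 1) div 2) * y ^ j\<close> written as a
  product so that the induction step adds one factor.
\<close>

lemma rothe_identity:
  assumes p: "norm p < 1"
  shows "(\<Sum>j\<le>M. qbinomial p M j * (\<Prod>i<j. p ^ i * y)) = (\<Prod>k<M. 1 + p ^ k * y)"
proof (induction M)
  case 0
  show ?case by (simp add: qbinomial_def qpoch_def)
next
  case (Suc M)
  let ?Y = "\<lambda>j. \<Prod>i<j. p ^ i * y"
  have "(\<Sum>j\<le>Suc M. qbinomial p (Suc M) j * ?Y j)
     = qbinomial p (Suc M) 0 + (\<Sum>j\<le>M. qbinomial p (Suc M) (Suc j) * ?Y (Suc j))"
    by (subst sum.atMost_Suc_shift) simp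
  also have "qbinomial p (Suc M) 0 = qbinomial p M 0"
    using qpoch_nonzero[OF p] by (simp add: qbinomial_def qpoch_def[of _ 0])
  also have "(\<Sum>j\<le>M. qbinomial p (Suc M) (Suc j) * ?Y (Suc j))
     = (\<Sum>j\<le>M. qbinomial p M (Suc j) * ?Y (Suc j)) + (\<Sum>j\<le>M. p ^ M * y * (qbinomial p M j * ?Y j))"
    unfolding sum.distrib[symmetric]
  proof (rule sum.cong[OF refl])
    fix j assume "j \<in> {..M}"
    then have j: "j \<le> M" by simp
    then have "p ^ M = p ^ (M - j) * p ^ j" by (simp flip: power_add)
    then show "qbinomial p (Suc M) (Suc j) * ?Y (Suc j)
      = qbinomial p M (Suc j) * ?Y (Suc j) + p ^ M * y * (qbinomial p M j * ?Y j)"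
      unfolding qbinomial_Suc_Suc[OF p j] by (simp add: algebra_simps)
  qed
  also have "qbinomial p M 0 + ((\<Sum>j\<le>M. qbinomial p M (Suc j) * ?Y (Suc j)) + (\<Sum>j\<le>M. p ^ M * y * (qbinomial p M j * ?Y j)))
     = (\<Sum>j\<le>Suc M. qbinomial p M j * ?Y j) + p ^ M * y * (\<Sum>j\<le>M. qbinomial p M j * ?Y j)"
    by (subst sum.atMost_Suc_shift) (simp add: sum_distrib_left)
  also have "(\<Sum>j\<le>Suc M. qbinomial p M j * ?Y j) = (\<Sum>j\<le>M. qbinomial p M j * ?Y j)"
    by (simp add: qbinomial_def)
  also have "(\<Sum>j\<le>M. qbinomial p M j * ?Y j) + p ^ M * y * (\<Sum>j\<le>M. qbinomial p M j * ?Y j)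
    = (1 + p ^ M * y) * (\<Prod>k<M. 1 + p ^ k * y)"
    unfolding Suc.IH by (simp add: algebra_simps)
  finally show ?case by (simp add: mult.commute)
qed

lemma sin_pi_nonzero:
  fixes z :: complex
  assumes "z \<notin> \<int>"
  shows "sin (pi * z) \<noteq> 0"
proof
  assume "sin (pi * z) = 0"
  then obtain n :: int where "pi * z = n * of_real pi" unfolding sin_eq_0 by (auto simp: mult_ac)
  then have "z = of_int n" by simp
  then show False using assms by simp
qed

lemma of_int_mult_not_int:
  assumes "Im t > 0" "n \<noteq> 0"
  shows "of_int n * t \<notin> \<int>"
proof
  assume "of_int n * t \<in> \<int>"
  then obtain k where "of_int n * t = of_int k" by (elim Ints_cases)
  then have "Im (of_int n * t) = Im (of_int k)" by (rule arg_cong)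
  then show False using assms by simp
qed

text \<open>
  The factors of the product side of Rothe's identity become sines up to exponential factors,
  and these cancel in a product that is symmetric in \<open>k\<close> and \<open>- k\<close>.
\<close>

lemma one_minus_exp_eq_sin:
  fixes u :: complex
  shows
  "1 - exp (2 * pi * \<i> * u) = (- 2 * \<i>) * exp (pi * \<i> * u) * sin (pi * u)"
proof -
  have "exp (pi * \<i> * u) * exp (pi * \<i> * u) = exp (2 * pi * \<i> * u)"
    unfolding mult_exp_exp by (rule arg_cong[where f = exp]) simp
  moreover have "exp (pi * \<i> * u) * exp (- (pi * \<i> * u)) = 1"
    by (simp add: mult_exp_exp)
  moreover have "sin (pi * u) = (exp (pi * \<i> * u) - exp (- (pi * \<i> * u))) / (2 * \<i>)"
    by (simp add: sin_exp_eq mult_ac)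
  moreover have "1 - E = (- 2 * \<i>) * a * s" if "a * a = E" "a * b = 1" "s = (a - b) / (2 * \<i>)" for a b s E :: complex
  proof -
    have "a - b = 2 * \<i> * s" unfolding that(3) by simp
    then have "(- 2 * \<i>) * a * s = - (a * (a - b))" by (simp add: mult_ac)
    also have "\<dots> = 1 - a * a" using that(2) by (simp add: right_diff_distrib)
    finally show ?thesis unfolding that(1) ..
  qed
  ultimately show ?thesis by blast
qed

text \<open>
  For \<open>y = - p ^ (- N) * exp (2 * pi * \<i> * z)\<close> the products in Rothe's identity are, up to a common
  factor, the terms of the series of \<open>\<theta>\<^sub>1\<close>: the exponent \<open>j * (j - 1) / 2 - N * j\<close> is
  \<open>(k + 1/2)^2 / 2\<close> up to a constant when \<open>k = j - N - 1\<close>. The factors on the product side form a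
  complete symmetric range of sines.
\<close>

lemma finite_theta1_product:
  fixes t :: complex
  assumes t: "Im t > 0"
  obtains c :: complex where "\<And>z::complex. (\<Sum>j\<le>2*N+1. qbinomial (exp (2 * pi * \<i> * t)) (2*N+1) j *
       theta_term 0 (1/2) (z + 1/2) t (int j - int N - 1))
     = c * (sin (pi * z) * (\<Prod>k=1..N. sin (pi * (z + of_nat k * t)) * sin (pi * (z - of_nat k * t))))"
proof -
  define p where "p = exp (2 * pi * \<i> * t)"
  have p: "norm p < 1" using t by (simp add: p_def)
  define c where "c = exp (pi * \<i> * (of_nat N + 1/2)^2 * t - pi * \<i> * (of_nat N + 1/2)) * (- 2 * \<i>) ^ (2*N+1)"
  have "(\<Sum>j\<le>2*N+1. qbinomial p (2*N+1) j * theta_term 0 (1/2) (z + 1/2) t (int j - int N - 1))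
     = c * (sin (pi * z) * (\<Prod>k=1..N. sin (pi * (z + of_nat k * t)) * sin (pi * (z - of_nat k * t))))" for z :: complex
  proof -
    define y where "y = exp (2 * pi * \<i> * (z + 1/2 - of_nat N * t))"
    define E where "E = exp (pi * \<i> * (of_nat N + 1/2)^2 * t - 2 * pi * \<i> * (of_nat N + 1/2) * (z + 1/2))"
    have py: "p ^ i * y = exp (2 * pi * \<i> * (z + 1/2 + (of_nat i - of_nat N) * t))" for i
      unfolding p_def y_def exp_of_nat_mult[symmetric] mult_exp_exp
      by (rule arg_cong[where f = exp]) (simp add: algebra_simps)
    have Y: "theta_term 0 (1/2) (z + 1/2) t (int j - int N - 1) = E * (\<Prod>i<j. p ^ i * y)" for j
    proof (induction j)
      case 0
      show ?case unfolding theta_term_def E_def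
        by simp (rule arg_cong[where f = exp], simp add: algebra_simps power2_eq_square)
    next
      case (Suc j)
      have "E * (\<Prod>i<Suc j. p ^ i * y) = theta_term 0 (1/2) (z + 1/2) t (int j - int N - 1) * (p ^ j * y)"
        using Suc by simp
      also have "\<dots> = theta_term 0 (1/2) (z + 1/2) t (int (Suc j) - int N - 1)"
        unfolding py theta_term_def power_0 mult_1_left mult_exp_exp
        by (rule arg_cong[where f = exp]) (simp add: field_simps power2_eq_square)
      finally show ?case by simp
    qed
    have fac: "1 + p ^ k * y = (- 2 * \<i>) * exp (pi * \<i> * (z + of_int (int k - int N) * t)) * sin (pi * (z + of_int (int k - int N) * t))" for k
    proof -
      have "p ^ k * y = exp (2 * pi * \<i> * (z + of_int (int k - int N) * t)) * exp (pi * \<i>)"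
        unfolding py mult_exp_exp by (rule arg_cong[where f = exp]) (simp add: algebra_simps)
      then show ?thesis using one_minus_exp_eq_sin[of "z + of_int (int k - int N) * t"] by simp
    qed
    have "(\<Sum>j\<le>2*N+1. qbinomial p (2*N+1) j * theta_term 0 (1/2) (z + 1/2) t (int j - int N - 1))
       = E * (\<Sum>j\<le>2*N+1. qbinomial p (2*N+1) j * (\<Prod>i<j. p ^ i * y))"
      unfolding Y sum_distrib_left by (rule sum.cong) (auto simp: mult_ac)
    also have "\<dots> = E * (\<Prod>k<2*N+1. 1 + p ^ k * y)"
      unfolding rothe_identity[OF p] ..
    also have "(\<Prod>k<2*N+1. 1 + p ^ k * y) = (- 2 * \<i>) ^ (2*N+1)
       * (\<Prod>k<2*N+1. exp (pi * \<i> * (z + of_int (int k - int N) * t)))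
       * (\<Prod>k<2*N+1. sin (pi * (z + of_int (int k - int N) * t)))"
      unfolding fac prod.distrib by simp
    also have "(\<Prod>k<2*N+1. exp (pi * \<i> * (z + of_int (int k - int N) * t)))
       = exp (\<Sum>k<2*N+1. pi * \<i> * (z + of_int (int k - int N) * t))"
      by (rule exp_sum[symmetric]) simp
    also have "(\<Sum>k<2*N+1. pi * \<i> * (z + of_int (int k - int N) * t)) = of_nat (2*N+1) * (pi * \<i> * z)"
      unfolding sum_shift_symmetric_int[of "\<lambda>k. pi * \<i> * (z + of_int k * t)"] sum_symmetric_int
      by (simp add: algebra_simps)
    also have "(\<Prod>k<2*N+1. sin (pi * (z + of_int (int k - int N) * t)))
       = sin (pi * z) * (\<Prod>k=1..N. sin (pi * (z + of_nat k * t)) * sin (pi * (z - of_nat k * t)))"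
      unfolding prod_shift_symmetric_int[of "\<lambda>k. sin (pi * (z + of_int k * t))"] prod_symmetric_int
      by simp
    also have "E * ((- 2 * \<i>) ^ (2*N+1) * exp (of_nat (2*N+1) * (pi * \<i> * z)) * (sin (pi * z) * (\<Prod>k=1..N. sin (pi * (z + of_nat k * t)) * sin (pi * (z - of_nat k * t)))))
      = (E * exp (of_nat (2*N+1) * (pi * \<i> * z))) * (- 2 * \<i>) ^ (2*N+1) * (sin (pi * z) * (\<Prod>k=1..N. sin (pi * (z + of_nat k * t)) * sin (pi * (z - of_nat k * t))))"
      by (simp only: mult_ac)
    also have "E * exp (of_nat (2*N+1) * (pi * \<i> * z)) = exp (pi * \<i> * (of_nat N + 1/2)^2 * t - pi * \<i> * (of_nat N + 1/2))"
      unfolding E_def mult_exp_exp by (rule arg_cong[where f = exp]) (simp add: field_simps)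
    finally show ?thesis unfolding c_def .
  qed
  then show ?thesis using that unfolding p_def by blast
qed

text \<open>
  Each factor \<open>sin (pi * (z + a)) * sin (pi * (z - a))\<close> is even in \<open>z\<close> with second derivative
  \<open>2 * pi^2\<close> and value \<open>- sin (pi * a)^2\<close> at \<open>0\<close>, so the logarithmic second derivatives add up.
\<close>

lemma prod_sin_derivs_at_0:
  fixes t :: complex
  assumes t: "Im t > 0"
  defines "g \<equiv> \<lambda>N (z::complex). \<Prod>k=1..N. sin (pi * (z + of_nat k * t)) * sin (pi * (z - of_nat k * t))"
  shows "g N holomorphic_on UNIV" "deriv (g N) 0 = 0"
    "deriv (deriv (g N)) 0 = g N 0 * (\<Sum>k=1..N. - 2 * pi^2 / sin (pi * (of_nat k * t))^2)"
proof -
  show hol: "g N holomorphic_on UNIV" for N unfolding g_def by (intro holomorphic_intros)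
  have "deriv (g N) 0 = 0 \<and> deriv (deriv (g N)) 0 = g N 0 * (\<Sum>k=1..N. - 2 * pi^2 / sin (pi * (of_nat k * t))^2)"
  proof (induction N)
    case 0
    then show ?case by (simp add: g_def)
  next
    case (Suc N)
    define a where "a = of_nat (Suc N) * t"
    define h where "h = (\<lambda>z. sin (pi * (z + a)) * sin (pi * (z - a)))"
    have h: "h holomorphic_on UNIV" unfolding h_def by (intro holomorphic_intros)
    have gS: "g (Suc N) = (\<lambda>z. h z * g N z)" by (simp add: g_def h_def a_def mult.commute fun_eq_iff)
    have d1: "deriv h = (\<lambda>z. pi * (cos (pi * (z + a)) * sin (pi * (z - a)) + sin (pi * (z + a)) * cos (pi * (z - a))))"
      unfolding h_def by (intro ext DERIV_imp_deriv) (auto intro!: derivative_eq_intros simp: algebra_simps)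
    have d2: "deriv (deriv h) 0 = 2 * pi^2"
    proof -
      have sc: "cos (a * pi) * cos (a * pi) = 1 - sin (a * pi) * sin (a * pi)"
        by (metis add_diff_cancel_right' power2_eq_square sin_cos_squared_add2)
      have "(deriv h has_field_derivative 2 * pi^2) (at 0)"
        unfolding d1 by (auto intro!: derivative_eq_intros simp: algebra_simps power2_eq_square sc)
      then show ?thesis by (simp add: DERIV_imp_deriv)
    qed
    have nz: "sin (pi * a) \<noteq> 0"
      using sin_pi_nonzero[OF of_int_mult_not_int[OF t, of "int (Suc N)"]] by (simp add: a_def)
    have h0: "h 0 = - ((sin (pi * a))^2)" "deriv h 0 = 0"
      unfolding d1 by (simp_all add: h_def power2_eq_square)
    have "(deriv ^^ 1) (\<lambda>z. h z * g N z) 0 = h 0 * deriv (g N) 0 + deriv h 0 * g N 0"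
      by (subst higher_deriv_mult[OF h hol]) auto
    moreover have "(deriv ^^ 2) (\<lambda>z. h z * g N z) 0 = h 0 * deriv (deriv (g N)) 0 + 2 * deriv h 0 * deriv (g N) 0 + deriv (deriv h) 0 * g N 0"
      by (subst higher_deriv_mult[OF h hol]) (auto simp: numeral_2_eq_2)
    ultimately have e: "deriv (g (Suc N)) 0 = 0" "deriv (deriv (g (Suc N))) 0 = h 0 * deriv (deriv (g N)) 0 + 2 * pi^2 * g N 0"
      unfolding gS using Suc h0 d2 by (simp_all add: numeral_2_eq_2)
    have "2 * pi^2 * g N 0 = h 0 * g N 0 * (- 2 * pi^2 / sin (pi * a)^2)"
      unfolding h0 using nz by simp
    moreover have "(\<Sum>k=1..Suc N. - 2 * pi^2 / sin (pi * (of_nat k * t))^2)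
       = (\<Sum>k=1..N. - 2 * pi^2 / sin (pi * (of_nat k * t))^2) + (- 2 * pi^2 / sin (pi * a)^2)"
      by (simp add: a_def)
    ultimately have "deriv (deriv (g (Suc N))) 0 = h 0 * g N 0 * (\<Sum>k=1..Suc N. - 2 * pi^2 / sin (pi * (of_nat k * t))^2)"
      unfolding e using Suc by (simp only: distrib_left mult.assoc)
    then show ?case using e(1) by (simp add: gS)
  qed
  then show "deriv (g N) 0 = 0"
    "deriv (deriv (g N)) 0 = g N 0 * (\<Sum>k=1..N. - 2 * pi^2 / sin (pi * (of_nat k * t))^2)"
    by auto
qed

text \<open>
  The finite counterpart of \<open>\<theta>\<^sub>1''' / \<theta>\<^sub>1'\<close> at \<open>0\<close>, computed from the product side: with
  \<open>T = c * sin (pi * z) * g z\<close> and \<open>g\<close> even, \<open>T' = c * pi * g\<close> and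
  \<open>T''' = - c * pi^3 * g + 3 * c * pi * g''\<close> at \<open>0\<close>.
\<close>

lemma finite_theta1_deriv3:
  fixes t :: complex
  assumes t: "Im t > 0"
  defines "S \<equiv> \<lambda>N n. \<Sum>j\<le>2*N+1. qbinomial (exp (2 * pi * \<i> * t)) (2*N+1) j * theta_term n (1/2) (1/2) t (int j - int N - 1)"
  shows "S N 3 = (- (pi^2) + (\<Sum>k=1..N. - 6 * pi^2 / sin (pi * (of_nat k * t))^2)) * S N 1"
proof -
  define T where "T = (\<lambda>n z. \<Sum>j\<le>2*N+1. qbinomial (exp (2 * pi * \<i> * t)) (2*N+1) j * theta_term n (1/2) (z + 1/2) t (int j - int N - 1))"
  define g where "g = (\<lambda>z::complex. \<Prod>k=1..N. sin (pi * (z + of_nat k * t)) * sin (pi * (z - of_nat k * t)))"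
  note g = prod_sin_derivs_at_0[OF t, of N, folded g_def]
  have "\<exists>c. \<forall>z::complex. T 0 z = c * (sin (pi * z) * g z)"
    unfolding T_def g_def by (rule finite_theta1_product[OF t, of N]) blast
  then obtain c where c: "\<And>z::complex. T 0 z = c * (sin (pi * z) * g z)" by blast
  have dterm: "((\<lambda>z. theta_term n (1/2) (z + 1/2) t k) has_field_derivative theta_term (Suc n) (1/2) (z + 1/2) t k) (at z)" for n z k
    using has_field_derivative_theta_term[of n "1/2" "1/2" 1 t 0 k z] by (simp add: add.commute)
  have "(T n has_field_derivative T (Suc n) z) (at z)" for n z
    unfolding T_def by (intro DERIV_sum DERIV_cmult dterm)
  then have dT: "deriv (T n) = T (Suc n)" for n by (intro ext DERIV_imp_deriv)
  have TT: "(deriv ^^ n) (T 0) = T n" for n by (induction n) (auto simp: dT)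
  define s where "s = (\<lambda>z::complex. c * sin (pi * z))"
  have s: "s holomorphic_on UNIV" unfolding s_def by (intro holomorphic_intros)
  have T0: "T 0 = (\<lambda>z. s z * g z)" by (auto simp: c s_def)
  have s1: "deriv s = (\<lambda>z::complex. c * pi * cos (pi * z))"
    unfolding s_def by (intro ext DERIV_imp_deriv) (auto intro!: derivative_eq_intros)
  have s2: "deriv (deriv s) = (\<lambda>z::complex. - c * pi^2 * sin (pi * z))"
    unfolding s1 by (intro ext DERIV_imp_deriv) (auto intro!: derivative_eq_intros simp: power2_eq_square)
  have s3: "deriv (deriv (deriv s)) = (\<lambda>z::complex. - c * pi^3 * cos (pi * z))"
    unfolding s2 by (intro ext DERIV_imp_deriv) (auto intro!: derivative_eq_intros simp: power2_eq_square power3_eq_cube)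
  have sj: "(deriv ^^ 0) s 0 = 0" "(deriv ^^ 1) s 0 = c * pi" "(deriv ^^ 2) s 0 = 0" "(deriv ^^ 3) s 0 = - c * pi^3"
  proof -
    show "(deriv ^^ 0) s 0 = 0" by (simp add: s_def)
    show "(deriv ^^ 1) s 0 = c * pi" by (simp add: s1)
    have "(deriv ^^ 2) s = deriv (deriv s)" by (simp add: numeral_2_eq_2)
    then show "(deriv ^^ 2) s 0 = 0" using fun_cong[OF s2, of 0] by simp
    have "(deriv ^^ 3) s = deriv (deriv (deriv s))" by (simp add: numeral_3_eq_3)
    then show "(deriv ^^ 3) s 0 = - c * pi^3" using fun_cong[OF s3, of 0] by simp
  qed
  have gj: "(deriv ^^ 0) g 0 = g 0" "(deriv ^^ 1) g 0 = 0" "(deriv ^^ 2) g 0 = deriv (deriv g) 0"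
    using g(2) by (simp_all add: numeral_2_eq_2)
  have "T 1 0 = (\<Sum>i=0..1. of_nat (1 choose i) * (deriv ^^ i) s 0 * (deriv ^^ (1 - i)) g 0)"
    unfolding TT[of 1, unfolded T0, symmetric] by (rule higher_deriv_mult[OF s g(1)]) auto
  moreover have "{0..1::nat} = {0, 1}" by auto
  ultimately have "T 1 0 = c * pi * g 0"
    using sj gj by simp
  moreover have "T 3 0 = (\<Sum>i=0..3. of_nat (3 choose i) * (deriv ^^ i) s 0 * (deriv ^^ (3 - i)) g 0)"
    unfolding TT[of 3, unfolded T0, symmetric] by (rule higher_deriv_mult[OF s g(1)]) auto
  moreover have "{0..3::nat} = {0, 1, 2, 3}" by auto
  moreover have "(3::nat) choose 1 = 3" "(3::nat) choose 3 = 1" by (simp_all add: eval_nat_numeral)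
  ultimately have "T 1 0 = c * pi * g 0" "T 3 0 = 3 * (c * pi) * deriv (deriv g) 0 - c * pi^3 * g 0"
    using sj gj by (simp_all del: One_nat_def)
  moreover define S2 where "S2 = (\<Sum>k=1..N. - 2 * pi^2 / sin (pi * (of_nat k * t))^2)"
  moreover have "deriv (deriv g) 0 = g 0 * S2"
    using prod_sin_derivs_at_0(3)[OF t, of N] unfolding g_def S2_def .
  ultimately have "T 3 0 = (- (pi^2) + 3 * S2) * T 1 0"
    by (simp add: algebra_simps power2_eq_square power3_eq_cube)
  also have "3 * S2 = (\<Sum>k=1..N. - 6 * pi^2 / sin (pi * (of_nat k * t))^2)"
    unfolding S2_def sum_distrib_left by (rule sum.cong) auto
  finally have "T 3 0 = (- (pi^2) + (\<Sum>k=1..N. - 6 * pi^2 / sin (pi * (of_nat k * t))^2)) * T 1 0" .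
  then show ?thesis by (simp add: S_def T_def)
qed

lemma qpoch_tendsto:
  assumes p: "norm p < 1"
  obtains L where "qpoch p \<longlonglongrightarrow> L" "L \<noteq> 0"
proof -
  have "summable (\<lambda>i. norm ((1 - p ^ Suc i) - 1))"
    using p by (simp add: norm_power norm_mult summable_mult summable_geometric)
  then have "convergent_prod (\<lambda>i. 1 - p ^ Suc i)"
    by (intro abs_convergent_prod_imp_convergent_prod summable_imp_abs_convergent_prod)
  then obtain L where L: "(\<lambda>n. \<Prod>i\<le>n. 1 - p ^ Suc i) \<longlonglongrightarrow> L" "L \<noteq> 0"
    using convergent_prod_iff_nz_lim[of "\<lambda>i. 1 - p ^ Suc i"] one_minus_power_nonzero[OF p] by blast
  have "(\<lambda>n. qpoch p (Suc n)) \<longlonglongrightarrow> L"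
    using L(1) by (simp add: qpoch_def lessThan_Suc_atMost)
  then have "qpoch p \<longlonglongrightarrow> L" by (simp add: filterlim_sequentially_Suc)
  then show ?thesis using L(2) that by blast
qed

lemma qbinomial_bounded:
  assumes p: "norm p < 1"
  obtains K where "\<And>M j. norm (qbinomial p M j) \<le> K"
proof -
  obtain L where L: "qpoch p \<longlonglongrightarrow> L" "L \<noteq> 0" by (rule qpoch_tendsto[OF p])
  obtain a where a: "\<And>n. norm (qpoch p n) \<le> a"
    using convergent_imp_Bseq[OF convergentI[OF L(1)]] by (auto simp: Bseq_def)
  obtain b where b: "\<And>n. norm (inverse (qpoch p n)) \<le> b"
    using convergent_imp_Bseq[OF convergentI[OF tendsto_inverse[OF L]]] by (auto simp: Bseq_def)
  have a0: "0 \<le> a" using a[of 0] norm_ge_zero order_trans by blast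
  have b0: "0 \<le> b" using b[of 0] norm_ge_zero order_trans by blast
  have "norm (qbinomial p M j) \<le> a * (b * b)" for M j
  proof (cases "j \<le> M")
    case True
    have "norm (qbinomial p M j) = norm (qpoch p M) * (norm (inverse (qpoch p j)) * norm (inverse (qpoch p (M - j))))"
      using True by (simp add: qbinomial_def norm_mult norm_divide norm_inverse field_simps)
    also have "\<dots> \<le> a * (b * b)"
      by (intro mult_mono a b) (use a0 b0 in auto)
    finally show ?thesis .
  qed (use a0 b0 in \<open>simp add: qbinomial_def\<close>)
  then show ?thesis by (rule that)
qed

text \<open>
  All three Pochhammer symbols in the central coefficient tend to the same nonzero product \<open>L\<close>.
\<close>

lemma central_qbinomial_tendsto:
  assumes L: "qpoch p \<longlonglongrightarrow> L" "L \<noteq> 0"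
  shows "(\<lambda>N. qbinomial p (2*N+1) (nat (k + int N + 1))) \<longlonglongrightarrow> 1 / L"
proof -
  have "(\<lambda>N. qpoch p (2*N+1) / (qpoch p (nat (k + int N + 1)) * qpoch p (nat (int N - k)))) \<longlonglongrightarrow> L / (L * L)"
  proof (intro tendsto_intros filterlim_compose[OF L(1)])
    show "filterlim (\<lambda>N. 2*N+1) sequentially sequentially"
      by (rule filterlim_subseq) (simp add: strict_mono_def)
    show "filterlim (\<lambda>N. nat (k + int N + 1)) sequentially sequentially"
      unfolding filterlim_at_top
    proof
      fix Z show "\<forall>\<^sub>F N in sequentially. Z \<le> nat (k + int N + 1)"
        using eventually_ge_at_top[of "nat (int Z - k)"] by eventually_elim auto
    qed
    show "filterlim (\<lambda>N. nat (int N - k)) sequentially sequentially"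
      unfolding filterlim_at_top
    proof
      fix Z show "\<forall>\<^sub>F N in sequentially. Z \<le> nat (int N - k)"
        using eventually_ge_at_top[of "nat (int Z + k)"] by eventually_elim auto
    qed
  qed (use L in auto)
  moreover have "\<forall>\<^sub>F N in sequentially. qpoch p (2*N+1) / (qpoch p (nat (k + int N + 1)) * qpoch p (nat (int N - k)))
      = qbinomial p (2*N+1) (nat (k + int N + 1))"
    using eventually_ge_at_top[of "nat \<bar>k\<bar> + 1"]
  proof eventually_elim
    case (elim N)
    then have "nat (k + int N + 1) \<le> 2*N+1" "2*N+1 - nat (k + int N + 1) = nat (int N - k)" by auto
    then show ?case by (simp add: qbinomial_def)
  qed
  ultimately show ?thesis using L(2) by (simp add: filterlim_cong)
qed

text \<open>
  The weights tend to a nonzero constant, which cancels in the quotient of third and first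
  derivatives. Convergence of the cosecant series on the left is part of the conclusion.
\<close>

lemma theta1_ratio_eq_lim:
  fixes t :: complex
  assumes t: "Im t > 0"
  shows "(\<lambda>N. pi^2 / 12 + (\<Sum>k=1..N. pi^2 / sin (pi * (of_nat k * t))^2 / 2)) \<longlonglongrightarrow> theta1_ratio t"
proof -
  define p where "p = exp (2 * pi * \<i> * t)"
  have p: "norm p < 1" using t by (simp add: p_def)
  obtain L where L: "qpoch p \<longlonglongrightarrow> L" "L \<noteq> 0" by (rule qpoch_tendsto[OF p])
  obtain K where K: "\<And>M j. norm (qbinomial p M j) \<le> K" using qbinomial_bounded[OF p] by metis
  have K0: "0 \<le> K" using K norm_ge_zero order_trans by blast
  define S where "S = (\<lambda>N n. \<Sum>j\<le>2*N+1. qbinomial p (2*N+1) j * theta_term n (1/2) (1/2) t (int j - int N - 1))"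
  have S: "(\<lambda>N. S N n) \<longlonglongrightarrow> 1 / L * theta_moment n (1/2) (1/2) t" for n
  proof -
    (* The finite sum as a sum over all integers, with index k = j - N - 1. *)
    define F where "F = (\<lambda>N k. if k \<in> {- int N - 1..int N} then
       qbinomial p (2*N+1) (nat (k + int N + 1)) * theta_term n (1/2) (1/2) t k else 0)"
    have "(\<lambda>N. \<Sum>\<^sub>\<infinity>k. F N k) \<longlonglongrightarrow> (\<Sum>\<^sub>\<infinity>k. 1 / L * theta_term n (1/2) (1/2) t k)"
    proof (rule tannery_infsum[where M = "\<lambda>k. K * norm (theta_term n (1/2) (1/2) t k)"])
      fix k :: int
      have "(\<lambda>N. qbinomial p (2*N+1) (nat (k + int N + 1)) * theta_term n (1/2) (1/2) t k)
         \<longlonglongrightarrow> 1 / L * theta_term n (1/2) (1/2) t k"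
        by (intro tendsto_intros central_qbinomial_tendsto L)
      moreover have "\<forall>\<^sub>F N in sequentially. qbinomial p (2*N+1) (nat (k + int N + 1)) * theta_term n (1/2) (1/2) t k = F N k"
        using eventually_ge_at_top[of "nat \<bar>k\<bar>"] by eventually_elim (auto simp: F_def)
      ultimately show "(\<lambda>N. F N k) \<longlonglongrightarrow> 1 / L * theta_term n (1/2) (1/2) t k"
        by (rule Lim_transform_eventually)
    next
      fix N and k :: int
      show "norm (F N k) \<le> K * norm (theta_term n (1/2) (1/2) t k)"
        using K K0 by (auto simp: F_def norm_mult intro!: mult_right_mono)
    next
      show "(\<lambda>k. K * norm (theta_term n (1/2) (1/2) t k)) summable_on UNIV"
        by (intro summable_on_cmult_right theta_term_abs_summable t)
    qed
    also have "(\<lambda>N. \<Sum>\<^sub>\<infinity>k. F N k) = (\<lambda>N. S N n)"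
    proof
      fix N
      have "(\<Sum>\<^sub>\<infinity>k. F N k) = (\<Sum>\<^sub>\<infinity>k\<in>{- int N - 1..int N}. F N k)"
        by (rule infsum_cong_neutral) (auto simp: F_def)
      also have "\<dots> = (\<Sum>k\<in>{- int N - 1..int N}. F N k)" by simp
      also have "\<dots> = S N n"
        unfolding S_def
        by (rule sum.reindex_bij_witness[where i = "\<lambda>j. int j - int N - 1" and j = "\<lambda>k. nat (k + int N + 1)"])
           (auto simp: F_def)
      finally show "(\<Sum>\<^sub>\<infinity>k. F N k) = S N n" .
    qed
    finally show ?thesis by (simp only: theta_moment_def infsum_cmult_right')
  qed
  define r where "r = (\<lambda>N. - (pi^2) + (\<Sum>k=1..N. - 6 * pi^2 / sin (pi * (of_nat k * t))^2))"
  have r: "S N 3 = r N * S N 1" for N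
    using finite_theta1_deriv3[OF t, of N] unfolding S_def r_def p_def .
  have m: "theta_moment n (1/2) (1/2) t = - theta_deriv n 1 0 t" for n by (simp add: theta_deriv_def)
  have nz: "theta_deriv 1 1 0 t \<noteq> 0"
    using jacobi_derivative[OF t] vartheta_nonzero[OF t] by simp
  have "(\<lambda>N. S N 3 / S N 1) \<longlonglongrightarrow> (1 / L * - theta_deriv 3 1 0 t) / (1 / L * - theta_deriv 1 1 0 t)"
    using S[of 3] S[of 1] nz L(2) unfolding m by (intro tendsto_divide) auto
  moreover have "\<forall>\<^sub>F N in sequentially. S N 3 / S N 1 = r N"
  proof -
    have "\<forall>\<^sub>F N in sequentially. S N 1 \<noteq> 0"
      by (rule tendsto_imp_eventually_ne[OF S[of 1]]) (use L(2) nz m in auto)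
    then show ?thesis by eventually_elim (simp add: r)
  qed
  ultimately have "r \<longlonglongrightarrow> (1 / L * - theta_deriv 3 1 0 t) / (1 / L * - theta_deriv 1 1 0 t)"
    by (rule Lim_transform_eventually)
  then have "(\<lambda>N. - r N / 12) \<longlonglongrightarrow> - ((1 / L * - theta_deriv 3 1 0 t) / (1 / L * - theta_deriv 1 1 0 t)) / 12"
    by (intro tendsto_intros) auto
  also have "- ((1 / L * - theta_deriv 3 1 0 t) / (1 / L * - theta_deriv 1 1 0 t)) / 12 = theta1_ratio t"
    using L(2) nz by (simp add: theta1_ratio_def)
  also have "(\<lambda>N. - r N / 12) = (\<lambda>N. pi^2 / 12 + (\<Sum>k=1..N. pi^2 / sin (pi * (of_nat k * t))^2 / 2))"
  proof
    fix N
    have "(\<Sum>k=1..N. - 6 * pi^2 / sin (pi * (of_nat k * t))^2) = (-12) * (\<Sum>k=1..N. pi^2 / sin (pi * (of_nat k * t))^2 / 2)"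
      unfolding sum_distrib_left by (rule sum.cong) auto
    then show "- r N / 12 = pi^2 / 12 + (\<Sum>k=1..N. pi^2 / sin (pi * (of_nat k * t))^2 / 2)"
      by (simp add: r_def field_simps)
  qed
  finally show ?thesis .
qed

section \<open>The cosecant series\<close>

text \<open>
  The logarithmic derivative of Euler's reflection formula for the Gamma function.
\<close>

lemma Digamma_reflection:
  fixes z :: complex
  assumes z: "z \<notin> \<int>"
  shows "Digamma (1 - z) - Digamma z = pi * cos (pi * z) / sin (pi * z)"
proof -
  have z': "z \<notin> \<int>\<^sub>\<le>\<^sub>0" "1 - z \<notin> \<int>\<^sub>\<le>\<^sub>0"
    using z by (auto dest: nonpos_Ints_Int)
  note s = sin_pi_nonzero
  define f where "f = (\<lambda>w::complex. Gamma w * Gamma (1 - w) * sin (pi * w))"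
  define G where "G = Gamma z * Gamma (1 - z)"
  have "(f has_field_derivative G * (Digamma z * sin (pi * z) - Digamma (1 - z) * sin (pi * z) + pi * cos (pi * z))) (at z)"
    unfolding f_def G_def using z' by (auto intro!: derivative_eq_intros simp: algebra_simps)
  moreover have "(f has_field_derivative 0) (at z)"
  proof (rule has_field_derivative_transform_within_open[where S = "- \<int>"])
    show "((\<lambda>_. of_real pi) has_field_derivative 0) (at z)" by simp
    fix w :: complex assume "w \<in> - \<int>"
    then show "of_real pi = f w" unfolding f_def Gamma_reflection_complex using s by simp
  qed (use z in \<open>auto simp: open_Compl\<close>)
  ultimately have "G * (Digamma z * sin (pi * z) - Digamma (1 - z) * sin (pi * z) + pi * cos (pi * z)) = 0"
    by (rule DERIV_unique)
  moreover have "G \<noteq> 0" unfolding G_def Gamma_reflection_complex using s[OF z] by simp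
  ultimately have "Digamma z * sin (pi * z) - Digamma (1 - z) * sin (pi * z) + pi * cos (pi * z) = 0" by simp
  then show ?thesis using s[OF z] by (simp add: field_simps)
qed

text \<open>
  One more differentiation; the left-hand side is the sum of \<open>1 / (z + m)^2\<close> over all integers \<open>m\<close>,
  split into \<open>m \<ge> 0\<close> and \<open>m < 0\<close>.
\<close>

lemma Polygamma_1_reflection:
  fixes z :: complex
  assumes z: "z \<notin> \<int>"
  shows "Polygamma 1 z + Polygamma 1 (1 - z) = pi^2 / sin (pi * z)^2"
proof -
  have z': "z \<notin> \<int>\<^sub>\<le>\<^sub>0" "1 - z \<notin> \<int>\<^sub>\<le>\<^sub>0"
    using z by (auto dest: nonpos_Ints_Int)
  have s: "sin (pi * z) \<noteq> 0" by (rule sin_pi_nonzero[OF z])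
  define f where "f = (\<lambda>w::complex. Digamma (1 - w) - Digamma w - pi * cos (pi * w) / sin (pi * w))"
  have sc: "sin (pi * z)^2 + cos (pi * z)^2 = 1" by simp
  have "(f has_field_derivative - Polygamma 1 (1 - z) - Polygamma 1 z
     - (- pi * sin (pi * z) * pi * sin (pi * z) - pi * cos (pi * z) * (cos (pi * z) * pi)) / (sin (pi * z) * sin (pi * z))) (at z)"
    unfolding f_def using z' s by (auto intro!: derivative_eq_intros simp: algebra_simps)
  also have "- pi * sin (pi * z) * pi * sin (pi * z) - pi * cos (pi * z) * (cos (pi * z) * pi)
      = - (pi^2 * (sin (pi * z)^2 + cos (pi * z)^2))"
    by (simp add: power2_eq_square algebra_simps del: sin_cos_squared_add sin_cos_squared_add2 sin_cos_squared_add3)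
  finally have "(f has_field_derivative - Polygamma 1 (1 - z) - Polygamma 1 z - (- (pi^2 * 1) / (sin (pi * z) * sin (pi * z)))) (at z)"
    unfolding sc by simp
  moreover have "(f has_field_derivative 0) (at z)"
  proof (rule has_field_derivative_transform_within_open[where S = "- \<int>"])
    show "((\<lambda>_. 0) has_field_derivative 0) (at z)" by simp
    fix w :: complex assume "w \<in> - \<int>"
    then show "0 = f w" unfolding f_def using Digamma_reflection[of w] by simp
  qed (use z in \<open>auto simp: open_Compl\<close>)
  ultimately have "- Polygamma 1 (1 - z) - Polygamma 1 z - (- (pi^2 * 1) / (sin (pi * z) * sin (pi * z))) = 0"
    by (rule DERIV_unique)
  then show ?thesis by (simp add: power2_eq_square algebra_simps)
qed

lemma infsum_inverse_squares_int:
  fixes z :: complex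
  assumes z: "z \<notin> \<int>" and sm: "(\<lambda>m::int. 1 / (z + of_int m)^2) summable_on UNIV"
  shows "(\<Sum>\<^sub>\<infinity>m::int. 1 / (z + of_int m)^2) = pi^2 / sin (pi * z)^2"
proof -
  have z0: "z \<noteq> 0" "1 - z \<noteq> 0" using z by auto
  have p1: "(\<lambda>N. \<Sum>k<N. inverse ((w + of_nat k)^2)) \<longlonglongrightarrow> Polygamma 1 w" if "w \<noteq> 0" for w :: complex
    using Polygamma_LIMSEQ[of w 1] that by (simp add: sums_def numeral_2_eq_2)
  have "(\<lambda>N. \<Sum>m\<in>{- int N..int N}. 1 / (z + of_int m)^2) \<longlonglongrightarrow> (\<Sum>\<^sub>\<infinity>m::int. 1 / (z + of_int m)^2)"
    by (rule has_sum_int_symmetric[OF has_sum_infsum[OF sm]])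
  moreover have "(\<lambda>N. (\<Sum>k<Suc N. inverse ((z + of_nat k)^2)) + (\<Sum>k<N. inverse ((1 - z + of_nat k)^2)))
     \<longlonglongrightarrow> Polygamma 1 z + Polygamma 1 (1 - z)"
    by (intro tendsto_intros p1 z0 LIMSEQ_Suc)
  moreover have "(\<Sum>m\<in>{- int N..int N}. 1 / (z + of_int m)^2)
     = (\<Sum>k<Suc N. inverse ((z + of_nat k)^2)) + (\<Sum>k<N. inverse ((1 - z + of_nat k)^2))" for N
  proof -
    have "(\<Sum>k=1..N. 1 / (z + of_nat k)^2 + 1 / (z - of_nat k)^2)
      = (\<Sum>k<N. inverse ((z + of_nat (Suc k))^2) + inverse ((1 - z + of_nat k)^2))"
    proof (rule sum.reindex_bij_witness[where i = Suc and j = "\<lambda>k. k - 1"])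
      fix k assume "k \<in> {1..N}"
      then obtain l where "k = Suc l" by (cases k) auto
      moreover have "(z - (1 + of_nat l))^2 = (1 - z + of_nat l)^2"
        by (simp add: power2_eq_square algebra_simps)
      ultimately show "inverse ((z + of_nat (Suc (k - 1)))^2) + inverse ((1 - z + of_nat (k - 1))^2) = 1 / (z + of_nat k)^2 + 1 / (z - of_nat k)^2"
        by (simp add: field_simps)
    qed auto
    then show ?thesis
      unfolding sum_symmetric_int[of "\<lambda>m. 1 / (z + of_int m)^2"] sum.lessThan_Suc_shift
      by (simp add: sum.distrib inverse_eq_divide)
  qed
  ultimately show ?thesis using Polygamma_1_reflection[OF z] LIMSEQ_unique by simp
qed

section \<open>The zeta function at a half-period\<close>

text \<open>
  The imaginary part controls \<open>b\<close>, and then the triangle inequality controls \<open>a\<close>.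
\<close>

lemma lattice_lower_bound:
  assumes t: "Im t > 0"
  obtains \<delta> where "\<delta> > 0" "\<And>a b. \<delta> * (\<bar>a\<bar> + \<bar>b\<bar>) \<le> norm (complex_of_real a + complex_of_real b * t)"
proof -
  define C where "C = 1 + (norm t + 1) / Im t"
  have C: "C > 0" unfolding C_def using t by (simp add: add_pos_nonneg)
  have "1 / C * (\<bar>a\<bar> + \<bar>b\<bar>) \<le> norm (complex_of_real a + complex_of_real b * t)" for a b
  proof -
    define n where "n = norm (complex_of_real a + complex_of_real b * t)"
    have "\<bar>b\<bar> * Im t = \<bar>Im (complex_of_real a + complex_of_real b * t)\<bar>"
      using t by (simp add: abs_mult)
    also have "\<dots> \<le> n" unfolding n_def by (rule abs_Im_le_cmod)
    finally have b: "\<bar>b\<bar> \<le> n / Im t" using t by (simp add: pos_le_divide_eq)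
    have "\<bar>a\<bar> = norm ((complex_of_real a + complex_of_real b * t) - complex_of_real b * t)" by simp
    also have "\<dots> \<le> n + \<bar>b\<bar> * norm t"
      unfolding n_def by (rule order_trans[OF norm_triangle_ineq4]) (simp add: norm_mult)
    finally have "\<bar>a\<bar> + \<bar>b\<bar> \<le> n + \<bar>b\<bar> * (norm t + 1)" by (simp add: algebra_simps)
    also have "\<dots> \<le> n + n / Im t * (norm t + 1)"
      by (intro add_left_mono mult_right_mono b) auto
    also have "\<dots> = C * n" by (simp add: C_def field_simps)
    finally show ?thesis using C unfolding n_def by (simp add: field_simps)
  qed
  then show ?thesis using C that[of "1 / C"] by simp
qed

definition lattice_point :: "complex \<Rightarrow> int \<times> int \<Rightarrow> complex" where
  "lattice_point t p = 2 * of_int (snd p) + 2 * of_int (fst p) * t"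

text \<open>
  The point \<open>1\<close> lies halfway between lattice points, so distances from it are also bounded below
  by the coordinates; the loss of a factor \<open>2\<close> comes from \<open>\<bar>m\<bar> \<le> \<bar>2 * m - 1\<bar>\<close>.
\<close>

lemma lattice_point_bounds:
  assumes t: "Im t > 0"
  obtains \<delta> where "\<delta> > 0"
    "\<And>p. 2 * \<delta> * (\<bar>real_of_int (fst p)\<bar> + \<bar>real_of_int (snd p)\<bar>) \<le> norm (lattice_point t p)"
    "\<And>p. \<delta> * (\<bar>real_of_int (fst p)\<bar> + \<bar>real_of_int (snd p)\<bar>) \<le> norm (1 - lattice_point t p)"
proof -
  obtain \<delta> where \<delta>: "\<delta> > 0" "\<And>a b. \<delta> * (\<bar>a\<bar> + \<bar>b\<bar>) \<le> norm (complex_of_real a + complex_of_real b * t)"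
    using lattice_lower_bound[OF t] by metis
  show ?thesis
  proof (rule that[OF \<delta>(1)])
    fix p :: "int \<times> int"
    have w: "lattice_point t p = 2 * (complex_of_real (of_int (snd p)) + complex_of_real (of_int (fst p)) * t)"
      by (simp add: lattice_point_def algebra_simps)
    show "2 * \<delta> * (\<bar>real_of_int (fst p)\<bar> + \<bar>real_of_int (snd p)\<bar>) \<le> norm (lattice_point t p)"
      unfolding w norm_mult using \<delta>(2)[of "of_int (snd p)" "of_int (fst p)"] by (simp add: add.commute)
    have w': "1 - lattice_point t p = - 2 * (complex_of_real (of_int (snd p) - 1/2) + complex_of_real (of_int (fst p)) * t)"
      by (simp add: lattice_point_def algebra_simps)
    have "\<bar>snd p\<bar> \<le> \<bar>2 * snd p - 1\<bar>" by presburger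
    then have "real_of_int \<bar>snd p\<bar> \<le> real_of_int \<bar>2 * snd p - 1\<bar>" by (simp only: of_int_le_iff)
    then have "\<bar>real_of_int (snd p)\<bar> \<le> 2 * \<bar>of_int (snd p) - 1/2\<bar>" by (simp add: abs_if split: if_splits)
    then have "\<bar>real_of_int (fst p)\<bar> + \<bar>real_of_int (snd p)\<bar> \<le> 2 * (\<bar>of_int (snd p) - 1/2\<bar> + \<bar>of_int (fst p)\<bar>)" by simp
    then have "\<delta> * (\<bar>real_of_int (fst p)\<bar> + \<bar>real_of_int (snd p)\<bar>) \<le> \<delta> * (2 * (\<bar>of_int (snd p) - 1/2\<bar> + \<bar>of_int (fst p)\<bar>))"
      using \<delta>(1) by (intro mult_left_mono) auto
    also have "\<dots> = 2 * (\<delta> * (\<bar>of_int (snd p) - 1/2\<bar> + \<bar>of_int (fst p)\<bar>))" by simp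
    also have "\<dots> \<le> 2 * norm (complex_of_real (of_int (snd p) - 1/2) + complex_of_real (of_int (fst p)) * t)"
      by (intro mult_left_mono \<delta>(2)) simp
    also have "\<dots> = norm (1 - lattice_point t p)" unfolding w' norm_mult by simp
    finally show "\<delta> * (\<bar>real_of_int (fst p)\<bar> + \<bar>real_of_int (snd p)\<bar>) \<le> norm (1 - lattice_point t p)" .
  qed
qed

lemma lattice_point_minus: "lattice_point t (- p) = - lattice_point t p"
  by (simp add: lattice_point_def)

lemma lattice_point_eq_0_iff:
  assumes "Im t > 0"
  shows "lattice_point t p = 0 \<longleftrightarrow> p = (0, 0)"
proof
  assume z: "lattice_point t p = 0"
  then have "Im (lattice_point t p) = 0" by simp
  then have f: "fst p = 0" using assms by (simp add: lattice_point_def)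
  with z have "snd p = 0" by (simp add: lattice_point_def)
  with f show "p = (0, 0)" by (simp add: prod_eq_iff)
qed (simp add: lattice_point_def)

lemma lattice_point_neq_1:
  assumes "Im t > 0"
  shows "lattice_point t p \<noteq> 1"
proof
  assume z: "lattice_point t p = 1"
  then have "Im (lattice_point t p) = 0" by simp
  then have f: "fst p = 0" using assms by (simp add: lattice_point_def)
  with z have "complex_of_int (2 * snd p) = of_int 1" by (simp add: lattice_point_def)
  then have "2 * snd p = 1" by (simp only: of_int_eq_iff)
  then show False by presburger
qed

text \<open>
  The terms are of order \<open>\<bar>w\<bar> ^ (- 3)\<close>. Splitting the cube as the product of the powers \<open>3/2\<close> of
  \<open>1 + \<bar>m\<bar>\<close> and \<open>1 + \<bar>n\<bar>\<close> reduces the double series to a product of two convergent ones.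
\<close>

lemma zeta_term_summable:
  assumes t: "Im t > 0"
  shows "(\<lambda>p. 1 / ((lattice_point t p)^2 * (1 - lattice_point t p))) summable_on (UNIV - {(0, 0)})"
proof -
  obtain \<delta> where \<delta>: "\<delta> > 0"
    "\<And>p. 2 * \<delta> * (\<bar>real_of_int (fst p)\<bar> + \<bar>real_of_int (snd p)\<bar>) \<le> norm (lattice_point t p)"
    "\<And>p. \<delta> * (\<bar>real_of_int (fst p)\<bar> + \<bar>real_of_int (snd p)\<bar>) \<le> norm (1 - lattice_point t p)"
    using lattice_point_bounds[OF t] by metis
  define h where "h = (\<lambda>k::int. (1 + \<bar>real_of_int k\<bar>) powr (-3/2))"
  have h: "h summable_on UNIV" unfolding h_def by (rule summable_on_int_powr) simp
  have hn: "(\<lambda>k. norm (complex_of_real (h k))) summable_on UNIV"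
    using h by (simp add: h_def)
  have "(\<lambda>p. norm (complex_of_real (h (fst p)) * complex_of_real (h (snd p)))) summable_on (UNIV \<times> UNIV)"
    by (rule abs_summable_on_times[OF hn hn])
  then have hh: "(\<lambda>p. h (fst p) * h (snd p)) summable_on UNIV"
    by (simp add: norm_mult h_def)
  have M: "(\<lambda>p. 2 / \<delta>^3 * (h (fst p) * h (snd p))) summable_on (UNIV - {(0,0)})"
    by (rule summable_on_subset_banach[OF summable_on_cmult_right[OF hh]]) simp
  have "norm (1 / ((lattice_point t p)^2 * (1 - lattice_point t p))) \<le> 2 / \<delta>^3 * (h (fst p) * h (snd p))"
    if "p \<in> UNIV - {(0, 0)}" for p
  proof -
    define s where "s = \<bar>real_of_int (fst p)\<bar> + \<bar>real_of_int (snd p)\<bar>"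
    have "s \<ge> 1"
    proof -
      have "\<bar>fst p\<bar> + \<bar>snd p\<bar> \<ge> 1" using that by (cases p) auto
      then have "real_of_int (\<bar>fst p\<bar> + \<bar>snd p\<bar>) \<ge> real_of_int 1" by (simp only: of_int_le_iff)
      then show ?thesis by (simp add: s_def)
    qed
    define P where "P = (1 + \<bar>real_of_int (fst p)\<bar>) * (1 + \<bar>real_of_int (snd p)\<bar>)"
    have P1: "P > 0" by (simp add: P_def add_pos_nonneg)
    (* As s >= 1, the product P is at most (2 * s)^2, so s^3 dominates P powr (3/2). *)
    have "P \<le> (1 + s) * (1 + s)" unfolding P_def s_def by (intro mult_mono) auto
    also have "\<dots> \<le> (2 * s) * (2 * s)" using \<open>s \<ge> 1\<close> by (intro mult_mono) auto
    finally have "P \<le> (2 * s)^2" by (simp add: power2_eq_square)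
    then have "P powr (3/2) \<le> ((2 * s)^2) powr (3/2)" using P1 by (intro powr_mono2) auto
    also have "\<dots> = (2 * s)^3"
    proof -
      have "(2 * s)^2 = (2 * s) powr 2" using \<open>s \<ge> 1\<close> by simp
      then have "((2 * s)^2) powr (3/2) = (2 * s) powr 3" by (simp add: powr_powr)
      then show ?thesis using \<open>s \<ge> 1\<close> by simp
    qed
    finally have P2: "P powr (3/2) \<le> 8 * s^3" by (simp add: power_mult_distrib)
    have "4 * \<delta>^3 * s^3 = (2 * \<delta> * s)^2 * (\<delta> * s)" by (simp add: power2_eq_square power3_eq_cube)
    also have "\<dots> \<le> norm (lattice_point t p)^2 * norm (1 - lattice_point t p)"
      using \<delta> \<open>s \<ge> 1\<close> unfolding s_def by (intro mult_mono power_mono) auto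
    finally have D: "4 * \<delta>^3 * s^3 \<le> norm ((lattice_point t p)^2 * (1 - lattice_point t p))"
      by (simp add: norm_mult norm_power)
    have pos: "4 * \<delta>^3 * s^3 > 0" using \<delta>(1) \<open>s \<ge> 1\<close> by simp
    have "norm (1 / ((lattice_point t p)^2 * (1 - lattice_point t p))) \<le> 1 / (4 * \<delta>^3 * s^3)"
      unfolding norm_divide using D pos by (simp add: frac_le)
    also have "\<dots> \<le> 2 / (\<delta>^3 * P powr (3/2))"
    proof -
      have "\<delta>^3 * P powr (3/2) \<le> \<delta>^3 * (8 * s^3)" using P2 \<delta>(1) by (intro mult_left_mono) auto
      moreover have "\<delta>^3 * P powr (3/2) > 0" using P1 \<delta>(1) by simp
      ultimately have "2 / (\<delta>^3 * (8 * s^3)) \<le> 2 / (\<delta>^3 * P powr (3/2))" by (intro divide_left_mono) auto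
      then show ?thesis by (simp add: mult_ac)
    qed
    also have "\<dots> = 2 / \<delta>^3 * P powr (-3/2)" by (simp add: powr_minus_divide)
    also have "P powr (-3/2) = h (fst p) * h (snd p)"
      unfolding P_def h_def by (rule powr_mult)
    finally show ?thesis .
  qed
  then have "(\<lambda>p. norm (1 / ((lattice_point t p)^2 * (1 - lattice_point t p)))) summable_on (UNIV - {(0, 0)})"
    by (rule Infinite_Sum.abs_summable_on_comparison_test'[OF M])
  then show ?thesis by (rule abs_summable_summable)
qed

text \<open>
  The three summands of the zeta function combine to \<open>1 / (w^2 * (1 - w))\<close> at \<open>z = 1\<close>. The value \<open>1\<close> at
  the origin is the pole term \<open>1 / z\<close>.
\<close>

lemma has_sum_eta:
  assumes t: "Im t > 0"
  shows "((\<lambda>p. if p = (0, 0) then 1 else 1 / ((lattice_point t p)^2 * (1 - lattice_point t p))) has_sum eta t) UNIV"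
proof -
  let ?f = "\<lambda>p. 1 / ((lattice_point t p)^2 * (1 - lattice_point t p))"
  have inj: "inj (lattice_point t)"
  proof (rule injI)
    fix p q :: "int \<times> int" assume "lattice_point t p = lattice_point t q"
    then have "lattice_point t (p - q) = 0" by (simp add: lattice_point_def algebra_simps)
    then have "p - q = (0, 0)" by (simp only: lattice_point_eq_0_iff[OF t])
    then show "p = q" by (simp add: prod_eq_iff)
  qed
  have "period_lattice 1 t = range (lattice_point t)"
  proof (intro equalityI subsetI)
    fix w assume "w \<in> period_lattice 1 t"
    then obtain m n where "w = lattice_point t (n, m)"
      by (auto simp: period_lattice_def lattice_point_def)
    then show "w \<in> range (lattice_point t)" by blast
  qed (auto simp: period_lattice_def lattice_point_def)
  then have im: "period_lattice 1 t - {0} = lattice_point t ` (UNIV - {(0, 0)})"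
    using lattice_point_eq_0_iff[OF t] by auto
  have "eta t = 1 + (\<Sum>\<^sub>\<infinity>w\<in>lattice_point t ` (UNIV - {(0, 0)}). 1 / (1 - w) + 1 / w + 1 / w^2)"
    by (simp add: eta_def weierstrass_zeta_def im)
  also have "(\<Sum>\<^sub>\<infinity>w\<in>lattice_point t ` (UNIV - {(0, 0)}). 1 / (1 - w) + 1 / w + 1 / w^2)
     = (\<Sum>\<^sub>\<infinity>p\<in>UNIV - {(0, 0)}. 1 / (1 - lattice_point t p) + 1 / lattice_point t p + 1 / (lattice_point t p)^2)"
    by (subst infsum_reindex) (auto intro: inj_on_subset[OF inj] simp: o_def)
  also have "\<dots> = (\<Sum>\<^sub>\<infinity>p\<in>UNIV - {(0, 0)}. ?f p)"
  proof (rule infsum_cong)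
    fix p assume "p \<in> UNIV - {(0 :: int, 0 :: int)}"
    then have "lattice_point t p \<noteq> 0" "1 - lattice_point t p \<noteq> 0"
      using lattice_point_eq_0_iff[OF t, of p] lattice_point_neq_1[OF t, of p] by auto
    then show "1 / (1 - lattice_point t p) + 1 / lattice_point t p + 1 / (lattice_point t p)^2 = ?f p"
      by (simp add: divide_simps power2_eq_square)
  qed
  finally have e: "eta t = 1 + (\<Sum>\<^sub>\<infinity>p\<in>UNIV - {(0, 0)}. ?f p)" .
  let ?g = "\<lambda>p. if p = (0, 0) then 1 else ?f p"
  have "(?g has_sum (\<Sum>\<^sub>\<infinity>p\<in>UNIV - {(0, 0)}. ?f p)) (UNIV - {(0, 0)})"
    using has_sum_infsum[OF zeta_term_summable[OF t]]
    by (rule has_sum_cong[THEN iffD1, rotated]) auto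
  moreover have "(?g has_sum 1) {(0, 0)}" using has_sum_finite[of "{(0,0)}" ?g] by simp
  ultimately have "(?g has_sum 1 + (\<Sum>\<^sub>\<infinity>p\<in>UNIV - {(0, 0)}. ?f p)) ({(0, 0)} \<union> (UNIV - {(0, 0)}))"
    by (intro has_sum_Un_disjoint) auto
  moreover have "{(0, 0)} \<union> (UNIV - {(0, 0)}) = (UNIV :: (int \<times> int) set)" by auto
  ultimately show ?thesis unfolding e by simp
qed

lemma inverse_partial_fractions:
  fixes u x y :: complex
  assumes "u \<noteq> 0" "x \<noteq> 0" "y \<noteq> 0" "x + y = 2" "x * y + u = 1"
  shows "1 / 2 * (1 / (u * x) + 1 / (u * y)) = 1 / u + 1 / (x * y)"
proof -
  have "1 / (u * x) + 1 / (u * y) = (x + y) / (u * (x * y))"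
    using assms(1-3) by (simp add: divide_simps)
  moreover have "1 / u + 1 / (x * y) = (x * y + u) / (u * (x * y))"
    using assms(1-3) by (simp add: divide_simps)
  ultimately show ?thesis unfolding assms(4,5) by simp
qed

text \<open>
  Averaging the terms at \<open>w\<close> and \<open>- w\<close> gives \<open>1 / (w^2 * (1 - w^2))\<close>, which splits into
  \<open>1 / w^2 + 1 / (1 - w^2)\<close>. At the origin \<open>1 / 0 = 0\<close> makes this expression equal to \<open>1\<close>, the value
  needed there.
\<close>

lemma has_sum_eta_symmetric:
  assumes t: "Im t > 0"
  shows "((\<lambda>p. 1 / (lattice_point t p)^2 + 1 / (1 - (lattice_point t p)^2)) has_sum eta t) UNIV"
proof -
  let ?g = "\<lambda>p. if p = (0, 0) then 1 else 1 / ((lattice_point t p)^2 * (1 - lattice_point t p))"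
  have 1: "(?g has_sum eta t) UNIV" by (rule has_sum_eta[OF t])
  have "bij (uminus :: int \<times> int \<Rightarrow> _)" by (rule bij_betwI[of _ _ _ uminus]) auto
  then have 2: "((\<lambda>p. ?g (- p)) has_sum eta t) UNIV"
    using 1 by (rule has_sum_reindex_bij_betw[THEN iffD2])
  have "((\<lambda>p. 1 / 2 * (?g p + ?g (- p))) has_sum 1 / 2 * (eta t + eta t)) UNIV"
    by (rule has_sum_cmult_right[OF has_sum_add[OF 1 2]])
  moreover have "1 / 2 * (?g p + ?g (- p)) = 1 / (lattice_point t p)^2 + 1 / (1 - (lattice_point t p)^2)" for p
  proof (cases "p = (0, 0)")
    case True
    then show ?thesis by (simp add: lattice_point_def)
  next
    case False
    define w where "w = lattice_point t p"
    have "w \<noteq> 0" using lattice_point_eq_0_iff[OF t] False by (simp add: w_def)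
    moreover have "1 - w \<noteq> 0" using lattice_point_neq_1[OF t, of p] by (auto simp: w_def)
    moreover have "1 + w \<noteq> 0"
      using lattice_point_neq_1[OF t, of "- p"] unfolding lattice_point_minus w_def[symmetric]
      by (auto simp: add_eq_0_iff)
    moreover have "(1 - w) * (1 + w) = 1 - w^2" by (simp add: power2_eq_square algebra_simps)
    ultimately have e: "1 / 2 * (1 / (w^2 * (1 - w)) + 1 / (w^2 * (1 + w))) = 1 / w^2 + 1 / (1 - w^2)"
      using inverse_partial_fractions[of "w^2" "1 - w" "1 + w"] by simp
    have "?g p = 1 / (w^2 * (1 - w))" "?g (- p) = 1 / (w^2 * (1 + w))"
      using False by (auto simp: w_def lattice_point_minus prod_eq_iff)
    with e have "1 / 2 * (?g p + ?g (- p)) = 1 / w^2 + 1 / (1 - w^2)" by (simp only:)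
    then show ?thesis by (simp add: w_def)
  qed
  ultimately show ?thesis by (simp only: mult_2[symmetric] mult.assoc[symmetric]) simp
qed

text \<open>
  Summing by rows: the terms \<open>1 / (1 - w^2)\<close> of a row telescope to zero, because \<open>w\<close> moves in steps
  of \<open>2\<close>, and the terms \<open>1 / w^2\<close> give the cosecant series, with \<open>pi^2 / 12\<close> for the row through
  the origin.
\<close>

lemma eta_eq_lim:
  fixes t :: complex
  assumes t: "Im t > 0"
  shows "(\<lambda>N. pi^2 / 12 + (\<Sum>k=1..N. pi^2 / sin (pi * (of_nat k * t))^2 / 2)) \<longlonglongrightarrow> eta t"
proof -
  let ?W = "\<lambda>n m. lattice_point t (n, m)"
  define G where "G = (\<lambda>p. 1 / (lattice_point t p)^2 + 1 / (1 - (lattice_point t p)^2))"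
  have G: "(G has_sum eta t) UNIV" unfolding G_def by (rule has_sum_eta_symmetric[OF t])
  obtain \<delta> where \<delta>: "\<delta> > 0"
    "\<And>p. 2 * \<delta> * (\<bar>real_of_int (fst p)\<bar> + \<bar>real_of_int (snd p)\<bar>) \<le> norm (lattice_point t p)"
    using lattice_point_bounds[OF t] by metis
  have A: "(\<lambda>m. 1 / (?W n m)^2) summable_on UNIV" for n
  proof (rule abs_summable_summable, rule Infinite_Sum.abs_summable_on_comparison_test')
    show "(\<lambda>m. 1 / \<delta>^2 * (1 + \<bar>real_of_int m\<bar>) powr (-2)) summable_on UNIV"
      by (intro summable_on_cmult_right summable_on_int_powr) simp
    fix m :: int
    show "norm (1 / (?W n m)^2) \<le> 1 / \<delta>^2 * (1 + \<bar>real_of_int m\<bar>) powr (-2)"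
    proof (cases "(n, m) = (0, 0)")
      case False
      then have "\<bar>n\<bar> + \<bar>m\<bar> \<ge> 1" by auto
      then have "real_of_int (\<bar>n\<bar> + \<bar>m\<bar>) \<ge> real_of_int 1" by (simp only: of_int_le_iff)
      then have "1 + \<bar>real_of_int m\<bar> \<le> 2 * (\<bar>real_of_int n\<bar> + \<bar>real_of_int m\<bar>)" by simp
      then have "\<delta> * (1 + \<bar>real_of_int m\<bar>) \<le> \<delta> * (2 * (\<bar>real_of_int n\<bar> + \<bar>real_of_int m\<bar>))"
        using \<delta>(1) by (intro mult_left_mono) auto
      also have "\<dots> \<le> norm (?W n m)" using \<delta>(2)[of "(n, m)"] by (simp add: mult_ac)
      finally have "(\<delta> * (1 + \<bar>real_of_int m\<bar>))^2 \<le> norm (?W n m)^2" using \<delta>(1) by (intro power_mono) auto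
      moreover have "(\<delta> * (1 + \<bar>real_of_int m\<bar>))^2 > 0" using \<delta>(1) by (auto simp: add_pos_nonneg)
      ultimately have "1 / norm (?W n m)^2 \<le> 1 / (\<delta> * (1 + \<bar>real_of_int m\<bar>))^2" by (intro frac_le) auto
      then show ?thesis
        by (simp add: norm_divide norm_power power_mult_distrib powr_minus_divide)
    qed (use \<delta> in \<open>simp add: lattice_point_def\<close>)
  qed
  have Grow: "(\<lambda>m. G (n, m)) summable_on UNIV" for n
    using summable_on_SigmaD1[of "\<lambda>n m. G (n, m)" UNIV "\<lambda>_. UNIV" n] G
    by (auto simp: summable_on_def case_prod_unfold)
  have B: "((\<lambda>m. 1 / (1 - (?W n m)^2)) has_sum 0) UNIV" for n
  proof -
    have "(\<lambda>m. G (n, m) - 1 / (?W n m)^2) summable_on UNIV"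
      using summable_on_add[OF Grow[of n] summable_on_uminus[THEN iffD2, OF A[of n]]] by simp
    then have sB: "(\<lambda>m. 1 / (1 - (?W n m)^2)) summable_on UNIV" by (simp add: G_def)
    (* 1 + w = - (1 - (w + 2)), so both partial fractions of 1 / (1 - w^2) are values of a. *)
    define a where "a = (\<lambda>m. 1 / (1 - ?W n m) / 2)"
    have tel: "1 / (1 - (?W n m)^2) = a m - a (m + 1)" for m
    proof -
      define w where "w = ?W n m"
      have w1: "?W n (m + 1) = w + 2" by (simp add: lattice_point_def w_def algebra_simps)
      have "1 - w \<noteq> 0" using lattice_point_neq_1[OF t, of "(n, m)"] by (auto simp: w_def)
      moreover have "1 + w \<noteq> 0"
        using lattice_point_neq_1[OF t, of "(n, m + 1)"] unfolding w1
        by (metis add.commute add_cancel_right_left add.assoc one_add_one)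
      moreover have "1 / x / 2 + 1 / y / 2 = (x + y) / 2 / (x * y)" if "x \<noteq> 0" "y \<noteq> 0" for x y :: complex
        using that by (simp add: divide_simps)
      ultimately have "1 / (1 - w) / 2 + 1 / (1 + w) / 2 = ((1 - w) + (1 + w)) / 2 / ((1 - w) * (1 + w))"
        by blast
      moreover have "(1 - w) * (1 + w) = 1 - w^2" by (simp add: power2_eq_square algebra_simps)
      moreover have "((1 - w) + (1 + w)) / 2 = 1" by simp
      ultimately have "1 / (1 - w^2) = 1 / (1 - w) / 2 + 1 / (1 + w) / 2" by (simp only:)
      also have "1 + w = - (1 - (w + 2))" by simp
      also have "1 / - (1 - (w + 2)) = - (1 / (1 - (w + 2)))" by (rule divide_minus_right)
      finally have "1 / (1 - w^2) = 1 / (1 - w) / 2 - 1 / (1 - (w + 2)) / 2"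
        by (simp only: minus_divide_left[symmetric] diff_conv_add_uminus)
      then show ?thesis by (simp add: a_def w1 w_def[symmetric])
    qed
    have "(\<Sum>m\<in>{- int N..int N}. 1 / (1 - (?W n m)^2)) = a (- int N) - a (int N + 1)" for N
    proof -
      have "(\<Sum>m\<in>{- int N..int N}. a m - a (m + 1)) = a (- int N) - a (int N + 1)"
      proof (induction N)
        case (Suc N)
        then show ?case unfolding symmetric_int_interval by (subst sum.insert, simp, simp)+ (simp add: algebra_simps)
      qed simp
      then show ?thesis by (simp only: tel)
    qed
    moreover have "(\<lambda>N. a (- int N) - a (int N + 1)) \<longlonglongrightarrow> 0 - 0"
    proof (intro tendsto_diff)
      have inv: "(\<lambda>N. 1 / (c + 2 * of_nat N) * d) \<longlonglongrightarrow> 0" for c d :: complex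
      proof -
        have "filterlim (\<lambda>N. c + 2 * of_nat N) at_infinity sequentially"
          by (intro tendsto_add_filterlim_at_infinity[OF tendsto_const]
                tendsto_mult_filterlim_at_infinity[OF tendsto_const] tendsto_of_nat) simp
        from tendsto_mult_left_zero[OF filterlim_compose[OF tendsto_inverse_0 this], of d]
        show ?thesis by (simp add: inverse_eq_divide)
      qed
      have a1: "a (- int N) = 1 / ((1 - 2 * of_int n * t) + 2 * of_nat N) * (1 / 2)" for N
        by (simp add: a_def lattice_point_def algebra_simps)
      show "(\<lambda>N. a (- int N)) \<longlonglongrightarrow> 0" unfolding a1 by (rule inv)
      have a2: "a (int N + 1) = 1 / ((1 + 2 * of_int n * t) + 2 * of_nat N) * (- 1 / 2)" for N
      proof -
        have "1 - ?W n (int N + 1) = - ((1 + 2 * of_int n * t) + 2 * of_nat N)"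
          by (simp add: lattice_point_def algebra_simps)
        then show ?thesis unfolding a_def by (simp only: divide_minus_right) simp
      qed
      show "(\<lambda>N. a (int N + 1)) \<longlonglongrightarrow> 0" unfolding a2 by (rule inv)
    qed
    ultimately have "(\<lambda>N. \<Sum>m\<in>{- int N..int N}. 1 / (1 - (?W n m)^2)) \<longlonglongrightarrow> 0" by simp
    then have "(\<Sum>\<^sub>\<infinity>m. 1 / (1 - (?W n m)^2)) = 0"
      using has_sum_int_symmetric[OF has_sum_infsum[OF sB]] LIMSEQ_unique by blast
    then show ?thesis using has_sum_infsum[OF sB] by simp
  qed
  define \<rho> where "\<rho> = (\<lambda>n. \<Sum>\<^sub>\<infinity>m. 1 / (?W n m)^2)"
  have "((\<lambda>m. G (n, m)) has_sum \<rho> n) UNIV" for n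
    using has_sum_add[OF has_sum_infsum[OF A[of n]] B[of n]] unfolding G_def \<rho>_def by simp
  then have "(\<rho> has_sum eta t) UNIV"
    using has_sum_SigmaD[where f = G and S = "eta t" and A = UNIV and B = "\<lambda>_. UNIV" and g = \<rho>] G by simp
  then have lim: "(\<lambda>N. \<rho> 0 + (\<Sum>k=1..N. \<rho> (int k) + \<rho> (- int k))) \<longlonglongrightarrow> eta t"
    using has_sum_int_symmetric[of \<rho>] unfolding sum_symmetric_int by blast
  have \<rho>0: "\<rho> 0 = pi^2 / 12"
  proof -
    have r1: "(\<lambda>N. \<Sum>m\<in>{- int N..int N}. 1 / (?W 0 m)^2) \<longlonglongrightarrow> \<rho> 0"
      unfolding \<rho>_def by (rule has_sum_int_symmetric[OF has_sum_infsum[OF A]])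
    have req: "(\<Sum>m\<in>{- int N..int N}. 1 / (?W 0 m)^2) = of_real (1 / 2 * (\<Sum>k<N. 1 / (real k + 1)^2))" for N
    proof -
      have "(\<Sum>k=1..N. 1 / (?W 0 (int k))^2 + 1 / (?W 0 (- int k))^2) = (\<Sum>k<N. of_real (1 / 2 * (1 / (real k + 1)^2)))"
        by (rule sum.reindex_bij_witness[where i = Suc and j = "\<lambda>k. k - 1"])
           (auto simp: lattice_point_def power_mult_distrib of_nat_diff field_simps)
      then show ?thesis unfolding sum_symmetric_int by (simp add: lattice_point_def sum_distrib_left)
    qed
    have r2: "(\<lambda>N. complex_of_real (1 / 2 * (\<Sum>k<N. 1 / (real k + 1)^2))) \<longlonglongrightarrow> of_real (1 / 2 * (pi^2 / 6))"
    proof (intro tendsto_of_real tendsto_mult tendsto_const)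
      show "(\<lambda>N. \<Sum>k<N. 1 / (real k + 1)^2) \<longlonglongrightarrow> pi^2 / 6"
        using inverse_squares_sums unfolding sums_def by (simp add: add.commute)
    qed
    have "\<rho> 0 = of_real (1 / 2 * (pi^2 / 6))"
      using r1 r2 unfolding req by (rule LIMSEQ_unique)
    then show ?thesis by simp
  qed
  have \<rho>k: "\<rho> n = pi^2 / sin (pi * (of_int n * t))^2 / 4" if "n \<noteq> 0" for n
  proof -
    have ni: "of_int n * t \<notin> \<int>" by (rule of_int_mult_not_int[OF t that])
    have W: "1 / (?W n m)^2 = 1 / 4 * (1 / (of_int n * t + of_int m)^2)" for m
    proof -
      have W': "?W n m = 2 * (of_int n * t + of_int m)" by (simp add: lattice_point_def algebra_simps)
      show ?thesis unfolding W' power_mult_distrib by simp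
    qed
    have "(\<lambda>m. 4 * (1 / (?W n m)^2)) summable_on UNIV" by (rule summable_on_cmult_right[OF A])
    then have sm: "(\<lambda>m::int. 1 / (of_int n * t + of_int m)^2) summable_on UNIV" unfolding W by simp
    show ?thesis
      unfolding \<rho>_def W infsum_cmult_right' infsum_inverse_squares_int[OF ni sm] by simp
  qed
  have "\<rho> 0 + (\<Sum>k=1..N. \<rho> (int k) + \<rho> (- int k)) = pi^2 / 12 + (\<Sum>k=1..N. pi^2 / sin (pi * (of_nat k * t))^2 / 2)" for N
    unfolding \<rho>0 by (intro arg_cong2[where f = "(+)"] refl sum.cong) (simp add: \<rho>k)
  then show ?thesis using lim by simp
qed

lemma eta_eq_theta1_ratio: "Im t > 0 \<Longrightarrow> eta t = theta1_ratio t"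
  using LIMSEQ_unique[OF eta_eq_lim theta1_ratio_eq_lim] by blast

section \<open>The differential equations\<close>

abbreviation cyclic_triple :: "nat \<Rightarrow> nat \<Rightarrow> nat \<Rightarrow> bool" where
  "cyclic_triple k l m \<equiv> (k, l, m) \<in> {(2, 3, 4), (3, 4, 2), (4, 2, 3)}"

lemma theta_wronskian_cyclic:
  assumes "Im t > 0" "cyclic_triple k l m"
  shows "theta_deriv 1 k z t * theta_deriv 0 1 z t - theta_deriv 1 1 z t * theta_deriv 0 k z t
      = - (pi * (theta_deriv 0 k 0 t)^2 * (theta_deriv 0 l z t * theta_deriv 0 m z t))"
  using theta_wronskian[OF assms(1), of z] assms(2) by auto

text \<open>
  The derivative of the Wronskian identity, cleared of \<open>\<theta>\<^sub>l'\<close> and \<open>\<theta>\<^sub>m'\<close> by the other two Wronskians.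
\<close>

lemma theta_deriv2_eq:
  assumes t: "Im t > 0" and k: "cyclic_triple k l m"
  shows "theta_deriv 2 k z t * (theta_deriv 0 1 z t)^2
     = theta_deriv 2 1 z t * theta_deriv 0 1 z t * theta_deriv 0 k z t
       - pi * (theta_deriv 0 k 0 t)^2 * (2 * theta_deriv 1 1 z t * theta_deriv 0 l z t * theta_deriv 0 m z t
         - pi * (theta_deriv 0 l 0 t)^2 * theta_deriv 0 k z t * (theta_deriv 0 m z t)^2
         - pi * (theta_deriv 0 m 0 t)^2 * theta_deriv 0 k z t * (theta_deriv 0 l z t)^2)"
proof -
  let ?f = "\<lambda>j k z. theta_deriv j k z t"
  have lm: "cyclic_triple l m k" "cyclic_triple m k l" using k by auto
  note W = theta_wronskian_cyclic[OF t]
  define v where "v = pi * (?f 0 k 0)^2"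
  define L where "L = (\<lambda>z. ?f 1 k z * ?f 0 1 z - ?f 1 1 z * ?f 0 k z + v * (?f 0 l z * ?f 0 m z))"
  have "L z = 0" for z using W[OF k, of z] by (simp add: L_def v_def)
  moreover have "(L has_field_derivative ?f 2 k z * ?f 0 1 z - ?f 2 1 z * ?f 0 k z
     + v * (?f 1 l z * ?f 0 m z + ?f 0 l z * ?f 1 m z)) (at z)" for z
    unfolding L_def using t
    by (auto intro!: derivative_eq_intros simp: algebra_simps numeral_2_eq_2)
  ultimately have "?f 2 k z * ?f 0 1 z - ?f 2 1 z * ?f 0 k z
     + v * (?f 1 l z * ?f 0 m z + ?f 0 l z * ?f 1 m z) = 0"
    using deriv_of_identity by blast
  then show ?thesis
    using W[OF lm(1), of z] W[OF lm(2), of z] unfolding v_def by algebra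
qed

text \<open>
  The coefficient of \<open>- \<theta>\<^sub>1^2\<close> in \<open>\<theta>\<^sub>1'' \<theta>\<^sub>1 - \<theta>\<^sub>1'^2\<close>; in Weierstrass' notation \<open>4 (\<eta> + e\<^sub>1)\<close>.
\<close>

definition log_coeff :: "complex \<Rightarrow> complex" where
  "log_coeff t = 4 * eta t + pi^2 / 3 * ((vartheta 3 t)^4 + (vartheta 4 t)^4)"

lemma vartheta_eq: "vartheta k t = theta_deriv 0 k 0 t"
  by (simp add: vartheta_def theta_eq_theta_deriv)

lemma vartheta_1: "vartheta 1 t = 0"
  unfolding vartheta_eq by (rule theta_even_odd_0) simp

lemma theta_log_deriv2_eta:
  assumes t: "Im t > 0"
  shows "theta_deriv 2 1 z t * theta_deriv 0 1 z t - (theta_deriv 1 1 z t)^2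
      = - log_coeff t * (theta_deriv 0 1 z t)^2
        - (pi * theta_deriv 0 3 0 t * theta_deriv 0 4 0 t)^2 * (theta_deriv 0 2 z t)^2"
  using theta_log_deriv2[OF t, of z]
  unfolding log_coeff_def eta_eq_theta1_ratio[OF t] vartheta_eq .

text \<open>
  The derivative of \<open>theta_log_deriv2_eta\<close>, cleared of \<open>\<theta>\<^sub>2'\<close> by the Wronskian.
\<close>

lemma theta1_deriv3_eq:
  assumes t: "Im t > 0"
  shows "theta_deriv 3 1 z t * (theta_deriv 0 1 z t)^2
     = theta_deriv 1 1 z t * theta_deriv 2 1 z t * theta_deriv 0 1 z t
       - 2 * log_coeff t * (theta_deriv 0 1 z t)^2 * theta_deriv 1 1 z t
       - 2 * (pi * theta_deriv 0 3 0 t * theta_deriv 0 4 0 t)^2 * theta_deriv 0 2 z t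
         * (theta_deriv 1 1 z t * theta_deriv 0 2 z t - pi * (theta_deriv 0 2 0 t)^2 * (theta_deriv 0 3 z t * theta_deriv 0 4 z t))"
proof -
  let ?f = "\<lambda>j k z. theta_deriv j k z t"
  define c d where "c = log_coeff t" and "d = (pi * ?f 0 3 0 * ?f 0 4 0)^2"
  define L where "L = (\<lambda>z. ?f 2 1 z * ?f 0 1 z - (?f 1 1 z)^2 + c * (?f 0 1 z)^2 + d * (?f 0 2 z)^2)"
  have "L z = 0" for z using theta_log_deriv2_eta[OF t, of z] by (simp add: L_def c_def d_def)
  moreover have "(L has_field_derivative ?f 3 1 z * ?f 0 1 z - ?f 1 1 z * ?f 2 1 z
     + 2 * c * ?f 0 1 z * ?f 1 1 z + 2 * d * ?f 0 2 z * ?f 1 2 z) (at z)" for z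
    unfolding L_def using t
    by (auto intro!: derivative_eq_intros simp: algebra_simps power2_eq_square numeral_2_eq_2 numeral_3_eq_3)
  ultimately have "?f 3 1 z * ?f 0 1 z - ?f 1 1 z * ?f 2 1 z
     + 2 * c * ?f 0 1 z * ?f 1 1 z + 2 * d * ?f 0 2 z * ?f 1 2 z = 0"
    using deriv_of_identity by blast
  then show ?thesis
    using theta_wronskian(1)[OF t, of z] unfolding c_def[symmetric] d_def[symmetric] by algebra
qed

text \<open>
  The total derivative of \<open>theta_deriv j k\<close> along \<open>z = A * t + B\<close> according to the heat equation. It
  makes sense at every \<open>z\<close>, unlike the right-hand sides, which divide by \<open>\<theta>\<^sub>1\<close>.
\<close>

definition theta_flow :: "nat \<Rightarrow> nat \<Rightarrow> complex \<Rightarrow> complex \<Rightarrow> complex \<Rightarrow> complex" where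
  "theta_flow j k A z t = A * theta_deriv (j + 1) k z t + theta_deriv (j + 2) k z t / (4 * pi * \<i>)"

text \<open>
  The rational identity behind the equations for \<open>\<theta>\<^sub>k\<close>, with \<open>f = \<theta>\<^sub>1\<close>, \<open>g = \<theta>\<^sub>k\<close>, \<open>h\<close> and \<open>l\<close> the
  other two theta functions, \<open>s = \<theta>\<^sub>2^2\<close>, and \<open>v\<close>, \<open>vl\<close>, \<open>vm\<close>, \<open>v3\<close>, \<open>v4\<close> squares of theta constants.
  Stating it for arbitrary numbers also covers \<open>k = 1\<close>, where \<open>v = 0\<close>.
\<close>

lemma theta_rhs_algebra:
  fixes f f' g h l v vl vm v3 v4 s e W A p gp gpp f2 :: complex
  assumes f: "f \<noteq> 0" and p: "p \<noteq> 0"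
    and g1: "gp * f - f' * g = - (p * v * (h * l))"
    and g2: "gpp * f^2 = f2 * f * g - p * v * (2 * f' * h * l - p * vl * g * l^2 - p * vm * g * h^2)"
    and f2: "f2 * f - f'^2 = - (4 * e + p^2 / 3 * W) * f^2 - p^2 * v3 * v4 * s"
  shows "- \<i> / (4 * p) * (f' + 4 * p * \<i> * A * f) * f' * (g / f^2)
     + \<i> / 2 * v * (f' + 2 * p * \<i> * A * f) * (h * l / f^2)
     + p * \<i> / 4 * (v3 * v4 * s - v * vm * h^2 - v * vl * l^2) * (g / f^2)
     + \<i> / p * (e + p^2 / 12 * W) * g = A * gp + gpp / (4 * p * \<i>)"
    (is "?R = ?L")
proof -
  have gp: "gp = (f' * g - p * v * (h * l)) / f"
    using g1 f by (simp add: field_simps)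
  have f2': "f2 * f = f'^2 - (4 * e + p^2 / 3 * W) * f^2 - p^2 * v3 * v4 * s"
    using f2 by (simp add: algebra_simps)
  have gpp: "gpp = ((f'^2 - (4 * e + p^2 / 3 * W) * f^2 - p^2 * v3 * v4 * s) * g
     - p * v * (2 * f' * h * l - p * vl * g * l^2 - p * vm * g * h^2)) / f^2"
    using g2 f unfolding f2' by (simp add: field_simps)
  have "?L * (12 * p * f^2) = ?R * (12 * p * f^2)"
    unfolding gp gpp using f p
    by (simp add: field_simps power2_eq_square) 
  then show ?thesis using f p by simp
qed

text \<open>
  The rational identity behind the equation for \<open>\<theta>\<^sub>1'\<close>, with \<open>f = \<theta>\<^sub>1\<close>, \<open>h = \<theta>\<^sub>2\<close>, \<open>a = \<theta>\<^sub>3\<close>,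
  \<open>b = \<theta>\<^sub>4\<close> and \<open>v2\<close>, \<open>v3\<close>, \<open>v4\<close> the squares of the theta constants.
\<close>

lemma theta1'_rhs_algebra:
  fixes f f' f2 f3 h a b v2 v3 v4 e W A p :: complex
  assumes f: "f \<noteq> 0" and p: "p \<noteq> 0"
    and f2: "f2 * f - f'^2 = - (4 * e + p^2 / 3 * W) * f^2 - p^2 * v3 * v4 * h^2"
    and f3: "f3 * f^2 = f' * f2 * f - 2 * (4 * e + p^2 / 3 * W) * f^2 * f'
       - 2 * (p^2 * v3 * v4) * h * (f' * h - p * v2 * (a * b))"
  shows "\<i> / (4 * p) * (3 * f' + 4 * p * \<i> * A * f) * (p^2 * v3 * v4 * (h^2 / f^2) + 4 * e + p^2 / 3 * W)
     - \<i> / (4 * p) * (f' + 4 * p * \<i> * A * f) * (f'^2 / f^2)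
     - \<i> / 2 * p^2 * v2 * v3 * v4 * (h * a * b / f^2) = A * f2 + f3 / (4 * p * \<i>)"
    (is "?R = ?L")
proof -
  have f2': "f2 = (f'^2 - (4 * e + p^2 / 3 * W) * f^2 - p^2 * v3 * v4 * h^2) / f"
    using f2 f by (simp add: field_simps)
  have f3': "f3 = (f' * (f2 * f) - 2 * (4 * e + p^2 / 3 * W) * f^2 * f'
       - 2 * (p^2 * v3 * v4) * h * (f' * h - p * v2 * (a * b))) / f^2"
    using f3 f by (simp add: field_simps)
  have f3'': "f3 = (f' * (f'^2 - (4 * e + p^2 / 3 * W) * f^2 - p^2 * v3 * v4 * h^2) - 2 * (4 * e + p^2 / 3 * W) * f^2 * f'
       - 2 * (p^2 * v3 * v4) * h * (f' * h - p * v2 * (a * b))) / f^2"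
  proof -
    have "f2 * f = f'^2 - (4 * e + p^2 / 3 * W) * f^2 - p^2 * v3 * v4 * h^2"
      using f2 by (simp add: algebra_simps)
    with f3' show ?thesis by (simp only:)
  qed
  have "?L * (12 * p * f^2) = ?R * (12 * p * f^2)"
    unfolding f3'' unfolding f2' using f p
    by (simp add: field_simps power2_eq_square)
  then show ?thesis using f p by simp
qed

lemma theta_flow_0: "theta_flow 0 k A z t = A * theta_deriv 1 k z t + theta_deriv 2 k z t / (4 * pi * \<i>)"
  by (simp add: theta_flow_def numeral_2_eq_2)

lemma theta_flow_1: "theta_flow 1 k A z t = A * theta_deriv 2 k z t + theta_deriv 3 k z t / (4 * pi * \<i>)"
  by (simp add: theta_flow_def numeral_2_eq_2 numeral_3_eq_3)

lemma theta_rhs_eq_flow: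
  assumes t: "Im t > 0" and k: "k \<in> {1, 2, 3, 4}" and nz: "theta 1 z t \<noteq> 0"
  shows "theta_rhs k A z t = theta_flow 0 k A z t"
proof (cases "k = 1")
  case False
  define l m where "l = nu k" and "m = mu k"
  have c: "cyclic_triple k l m" using False k nu_mu_values by (auto simp: l_def m_def)
  show ?thesis
    unfolding theta_rhs_def theta_flow_0 theta1'_eq_theta_deriv[OF t] theta_eq_theta_deriv vartheta_eq
      l_def[symmetric] m_def[symmetric] of_real_power
    using theta_rhs_algebra[OF nz[unfolded theta_eq_theta_deriv] _ theta_wronskian_cyclic[OF t c, of z]
      theta_deriv2_eq[OF t c, of z], of "eta t" "(theta_deriv 0 3 0 t)^4 + (theta_deriv 0 4 0 t)^4"
       "(theta_deriv 0 3 0 t)^2" "(theta_deriv 0 4 0 t)^2" "(theta_deriv 0 2 z t)^2" A]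
      theta_log_deriv2_eta[OF t, of z]
    unfolding log_coeff_def vartheta_eq power_mult_distrib of_real_power by simp
next
  case True
  have f: "theta_deriv 0 1 z t \<noteq> 0" using nz unfolding theta_eq_theta_deriv .
  have g1: "theta_deriv 1 1 z t * theta_deriv 0 1 z t - theta_deriv 1 1 z t * theta_deriv 0 1 z t = - (complex_of_real pi * 0 * (0 * 0))"
    by simp
  have g2: "theta_deriv 2 1 z t * (theta_deriv 0 1 z t)^2 = theta_deriv 2 1 z t * theta_deriv 0 1 z t * theta_deriv 0 1 z t
     - complex_of_real pi * 0 * (2 * theta_deriv 1 1 z t * 0 * 0 - complex_of_real pi * 0 * theta_deriv 0 1 z t * 0^2
         - complex_of_real pi * 0 * theta_deriv 0 1 z t * 0^2)"
    by (simp add: power2_eq_square)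
  show ?thesis
    unfolding True theta_rhs_def theta_flow_0 theta1'_eq_theta_deriv[OF t] vartheta_1
    unfolding theta_eq_theta_deriv vartheta_eq of_real_power
    using theta_rhs_algebra[OF f _ g1 g2, of "eta t" "(theta_deriv 0 3 0 t)^4 + (theta_deriv 0 4 0 t)^4"
       "(theta_deriv 0 3 0 t)^2" "(theta_deriv 0 4 0 t)^2" "(theta_deriv 0 2 z t)^2" A]
      theta_log_deriv2_eta[OF t, of z]
    unfolding log_coeff_def vartheta_eq power_mult_distrib of_real_power by simp
qed

lemma theta1'_rhs_eq_flow:
  assumes t: "Im t > 0" and nz: "theta 1 z t \<noteq> 0"
  shows "theta1'_rhs A z t = theta_flow 1 1 A z t"
proof -
  have f: "theta_deriv 0 1 z t \<noteq> 0" using nz unfolding theta_eq_theta_deriv .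
  note A1 = theta_log_deriv2_eta[OF t, of z] and A2 = theta1_deriv3_eq[OF t, of z]
  show ?thesis
    unfolding theta1'_rhs_def theta_flow_1 theta1'_eq_theta_deriv[OF t]
    unfolding theta_eq_theta_deriv vartheta_eq of_real_power
    using theta1'_rhs_algebra[OF f, of "of_real pi" "theta_deriv 2 1 z t" "theta_deriv 1 1 z t" "eta t"
      "(theta_deriv 0 3 0 t)^4 + (theta_deriv 0 4 0 t)^4" "(theta_deriv 0 3 0 t)^2" "(theta_deriv 0 4 0 t)^2"
      "theta_deriv 0 2 z t" "theta_deriv 3 1 z t" "(theta_deriv 0 2 0 t)^2" "theta_deriv 0 3 z t" "theta_deriv 0 4 z t" A]
      A1[unfolded log_coeff_def vartheta_eq power_mult_distrib of_real_power]
      A2[unfolded log_coeff_def vartheta_eq power_mult_distrib of_real_power]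
    by (simp add: add.assoc)
qed

lemma theta_flow_has_derivative:
  assumes "Im t > 0"
  shows "((\<lambda>t. theta k (A * t + B) t) has_field_derivative theta_flow 0 k A (A * t + B) t) (at t)"
    and "((\<lambda>t. theta1' (A * t + B) t) has_field_derivative theta_flow 1 1 A (A * t + B) t) (at t)"
proof -
  show "((\<lambda>t. theta k (A * t + B) t) has_field_derivative theta_flow 0 k A (A * t + B) t) (at t)"
    unfolding theta_eq_theta_deriv theta_flow_def
    by (rule has_field_derivative_theta_deriv_curve[OF assms])
  have op: "open {t::complex. Im t > 0}" by (rule open_halfspace_Im_gt)
  show "((\<lambda>t. theta1' (A * t + B) t) has_field_derivative theta_flow 1 1 A (A * t + B) t) (at t)"
    unfolding theta_flow_def
    by (rule has_field_derivative_transform_within_open[OF has_field_derivative_theta_deriv_curve[OF assms] op])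
       (use assms theta1'_eq_theta_deriv in auto)
qed

lemma theta_flow_continuous:
  assumes t: "Im t > 0"
  shows "((\<lambda>p. theta_flow j k (fst p) (fst p * t + snd p) t) \<longlongrightarrow> theta_flow j k A (A * t + B) t) (at (A, B) within S)"
proof -
  have c: "((\<lambda>p. theta_deriv n k (fst p * t + snd p) t) \<longlongrightarrow> theta_deriv n k (A * t + B) t) (at (A, B) within S)" for n
  proof (rule isCont_tendsto_compose[where g = "\<lambda>z. theta_deriv n k z t"])
    show "isCont (\<lambda>z. theta_deriv n k z t) (A * t + B)"
      by (rule DERIV_isCont[OF has_field_derivative_theta_deriv[OF t]])
    show "((\<lambda>p. fst p * t + snd p) \<longlongrightarrow> A * t + B) (at (A, B) within S)"
      by (auto intro!: tendsto_eq_intros)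
  qed
  show ?thesis
    unfolding theta_flow_def by (intro tendsto_intros c) (auto intro!: tendsto_eq_intros)
qed

text \<open>
  On regular parameters the right-hand sides coincide with the flow, which is continuous in the
  parameters.
\<close>

lemma rhs_tendsto_flow:
  assumes t: "Im t > 0"
  shows "k \<in> {1, 2, 3, 4} \<Longrightarrow> ((\<lambda>(A', B'). theta_rhs k A' (A' * t + B') t) \<longlongrightarrow> theta_flow 0 k A (A * t + B) t)
          (at (A, B) within regular_params t)"
    and "((\<lambda>(A', B'). theta1'_rhs A' (A' * t + B') t) \<longlongrightarrow> theta_flow 1 1 A (A * t + B) t)
          (at (A, B) within regular_params t)"
proof -
  show "((\<lambda>(A', B'). theta1'_rhs A' (A' * t + B') t) \<longlongrightarrow> theta_flow 1 1 A (A * t + B) t)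
          (at (A, B) within regular_params t)"
  proof (rule tendsto_cong[THEN iffD1, OF _ theta_flow_continuous[OF t, of 1 1]])
    show "\<forall>\<^sub>F p in at (A, B) within regular_params t.
       theta_flow 1 1 (fst p) (fst p * t + snd p) t = (case p of (A', B') \<Rightarrow> theta1'_rhs A' (A' * t + B') t)"
      unfolding eventually_at_filter
      by (intro always_eventually) (auto simp: regular_params_def theta1'_rhs_eq_flow[OF t])
  qed
  show "((\<lambda>(A', B'). theta_rhs k A' (A' * t + B') t) \<longlongrightarrow> theta_flow 0 k A (A * t + B) t)
          (at (A, B) within regular_params t)" if k: "k \<in> {1, 2, 3, 4}"
  proof (rule tendsto_cong[THEN iffD1, OF _ theta_flow_continuous[OF t, of 0 k]])
    show "\<forall>\<^sub>F p in at (A, B) within regular_params t.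
       theta_flow 0 k (fst p) (fst p * t + snd p) t = (case p of (A', B') \<Rightarrow> theta_rhs k A' (A' * t + B') t)"
      unfolding eventually_at_filter
      by (intro always_eventually) (auto simp: regular_params_def theta_rhs_eq_flow[OF t k])
  qed
qed

section \<open>Differential closure\<close>

lemma generated_field_diff:
  "f \<in> generated_field D G \<Longrightarrow> g \<in> generated_field D G \<Longrightarrow> (\<lambda>x. f x - g x) \<in> generated_field D G"
  using generated_field.add[of f D G "\<lambda>x. - g x"] generated_field.uminus[of g D G] by simp

lemma generated_field_divide:
  "f \<in> generated_field D G \<Longrightarrow> g \<in> generated_field D G \<Longrightarrow> (\<lambda>x. f x / g x) \<in> generated_field D G"
  using generated_field.mult[of f D G "\<lambda>x. inverse (g x)"] generated_field.inverse[of g D G]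
  by (simp add: divide_inverse)

lemma generated_field_power:
  "f \<in> generated_field D G \<Longrightarrow> (\<lambda>x. f x ^ n) \<in> generated_field D G"
  by (induction n) (auto intro: generated_field.const generated_field.mult)

lemmas generated_field_intros = generated_field.const generated_field.add generated_field.uminus
  generated_field.mult generated_field_diff generated_field_divide generated_field_power

lemma open_connected_upper_half_plane: "open upper_half_plane" "connected upper_half_plane"
  unfolding upper_half_plane_def
  by (rule open_halfspace_Im_gt) (rule convex_connected[OF convex_halfspace_Im_gt])

lemma eventually_nonzero_cosparse:
  assumes "f holomorphic_on D" "open D" "connected D" "\<beta> \<in> D" "f \<beta> \<noteq> 0"
  shows "eventually (\<lambda>x. f x \<noteq> 0) (cosparse D)"
  unfolding eventually_cosparse_open_eq[OF assms(2)]
proof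
  fix x assume x: "x \<in> D"
  show "\<forall>\<^sub>F y in at x. f y \<noteq> 0"
  proof (cases "f x = 0")
    case True
    obtain r where "0 < r" "\<And>z. z \<in> ball x r - {x} \<Longrightarrow> f z \<noteq> 0"
      using isolated_zeros[OF assms(1-3) x True assms(4,5)] by metis
    then show ?thesis by (auto simp: eventually_at dist_commute)
  next
    case False
    have "isCont f x"
      using holomorphic_on_imp_continuous_on[OF assms(1)] x
      by (simp add: continuous_on_eq_continuous_at[OF assms(2)])
    then have "f \<midarrow>x\<rightarrow> f x" by (simp add: isCont_def)
    then show ?thesis using False by (rule tendsto_imp_eventually_ne)
  qed
qed

text \<open>
  Membership only has to be checked off a set without accumulation points, by the rule \<open>cong\<close>.
\<close>

lemma deriv_in_generated_field:
  assumes D: "open D" and g: "g \<in> generated_field D G"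
    and ev: "eventually (\<lambda>x. x \<in> D \<longrightarrow> f' x = g x) (cosparse D)"
    and f': "\<And>x. x \<in> D \<Longrightarrow> (f has_field_derivative f' x) (at x)"
  shows "deriv f \<in> generated_field D G"
proof (rule generated_field.cong[OF g])
  have "eventually (\<lambda>x. x \<in> D) (cosparse D)" by (rule eventually_in_cosparse) (use D in auto)
  then show "eventually (\<lambda>x. deriv f x = g x) (cosparse D)"
    using ev by eventually_elim (auto dest!: f' DERIV_imp_deriv)
qed

lemma five_thetas_memberE:
  assumes "f \<in> five_thetas A B"
  obtains k where "k \<in> {1, 2, 3, 4}" "f = (\<lambda>\<tau>. theta k (A * \<tau> + B) \<tau>)"
  | "f = (\<lambda>\<tau>. theta1' (A * \<tau> + B) \<tau>)"
  using assms unfolding five_thetas_def by blast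

text \<open>
  For \<open>k\<close> other than \<open>2\<close>, \<open>3\<close>, \<open>4\<close> the theta constant is zero, so the uniform formula for the
  right-hand sides needs no case distinction.
\<close>

lemma vartheta_square_in_coeff_field: "(\<lambda>\<tau>. (vartheta k \<tau>)^2) \<in> coeff_field A"
proof -
  have "vartheta k t = 0" if "k \<notin> {2, 3, 4}" for t
  proof (cases "k = 1")
    case True
    show ?thesis unfolding True by (rule vartheta_1)
  qed (use that in \<open>simp add: vartheta_def theta_def\<close>)
  then consider "k = 2" | "k = 3" | "k = 4" | "vartheta k = (\<lambda>_. 0)" by auto
  then show ?thesis
    by cases (auto simp: coeff_field_def intro: generated_field.const generated_field.gen)
qed

lemma vartheta_power4_in_coeff_field: "(\<lambda>\<tau>. (vartheta k \<tau>)^4) \<in> coeff_field A"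
proof -
  have "(\<lambda>\<tau>. ((vartheta k \<tau>)^2)^2) \<in> coeff_field A"
    unfolding coeff_field_def
    by (rule generated_field_power) (rule vartheta_square_in_coeff_field[unfolded coeff_field_def])
  then show ?thesis by (simp flip: power_mult)
qed

lemma eta_in_coeff_field: "eta \<in> coeff_field A"
  unfolding coeff_field_def by (rule generated_field.gen) simp

text \<open>
  Three cases: \<open>\<theta>\<^sub>1\<close> is not identically zero along the curve; it is, but \<open>\<theta>\<^sub>1'\<close> is not; both are.
  In the second case every function is an eigenfunction of the derivation over the coefficient
  field. In the third the identities for the second logarithmic derivative force all five
  functions to vanish.
\<close>

lemma differentially_closed_thetas:
  "differentially_closed_over upper_half_plane (coeff_field A) (five_thetas A B)"
proof -
  let ?H = upper_half_plane
  define F where "F = generated_field ?H (coeff_field A \<union> five_thetas A B)"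
  note F_intros = generated_field_intros[of _ ?H "coeff_field A \<union> five_thetas A B", folded F_def]
  have H: "t \<in> ?H \<longleftrightarrow> Im t > 0" for t by (simp add: upper_half_plane_def)
  have K: "f \<in> F" if "f \<in> coeff_field A" for f using that by (auto simp: F_def intro: generated_field.gen)
  have T: "f \<in> F" if "f \<in> five_thetas A B" for f using that by (auto simp: F_def intro: generated_field.gen)
  have cst: "(\<lambda>_. c) \<in> F" for c unfolding F_def by (rule generated_field.const)
  have th: "(\<lambda>\<tau>. theta k (A * \<tau> + B) \<tau>) \<in> F" for k
  proof (cases "k \<in> {1, 2, 3, 4}")
    case True
    then show ?thesis by (intro T) (auto simp: five_thetas_def)
  next
    case False
    then show ?thesis using cst[of 0] by (simp add: theta_def)
  qed
  have th': "(\<lambda>\<tau>. theta1' (A * \<tau> + B) \<tau>) \<in> F" by (intro T) (simp add: five_thetas_def)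
  note v2 = K[OF vartheta_square_in_coeff_field] and v4 = K[OF vartheta_power4_in_coeff_field]
    and et = K[OF eta_in_coeff_field]
  note hd = theta_flow_has_derivative
  have hol: "(\<lambda>\<tau>. theta k (A * \<tau> + B) \<tau>) holomorphic_on ?H" "(\<lambda>\<tau>. theta1' (A * \<tau> + B) \<tau>) holomorphic_on ?H" for k
    unfolding holomorphic_on_open[OF open_connected_upper_half_plane(1)] using hd H by blast+
  have rhs: "(\<lambda>\<tau>. theta_rhs k A (A * \<tau> + B) \<tau>) \<in> F" for k
    unfolding theta_rhs_def of_real_power by (intro F_intros(2-) cst th th' v2 v4 et)
  have rhs': "(\<lambda>\<tau>. theta1'_rhs A (A * \<tau> + B) \<tau>) \<in> F"
    unfolding theta1'_rhs_def of_real_power by (intro F_intros(2-) cst th th' v2 v4 et)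
  have deriv_in: "deriv f \<in> F"
    if "g \<in> F" "eventually (\<lambda>t. t \<in> ?H \<longrightarrow> f' t = g t) (cosparse ?H)"
      "\<And>t. t \<in> ?H \<Longrightarrow> (f has_field_derivative f' t) (at t)" for f f' g
    using deriv_in_generated_field[OF open_connected_upper_half_plane(1)] that unfolding F_def by blast
  have "deriv f \<in> F" if f: "f \<in> five_thetas A B" for f
  proof (cases "\<exists>t\<in>?H. theta 1 (A * t + B) t \<noteq> 0")
    case True
    then obtain \<beta> where "\<beta> \<in> ?H" "theta 1 (A * \<beta> + B) \<beta> \<noteq> 0" by blast
    then have ev: "eventually (\<lambda>t. theta 1 (A * t + B) t \<noteq> 0) (cosparse ?H)"
      by (rule eventually_nonzero_cosparse[OF hol(1)[of 1] open_connected_upper_half_plane])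
    from f show ?thesis
    proof (cases rule: five_thetas_memberE)
      case (1 k)
      have "eventually (\<lambda>t. t \<in> ?H \<longrightarrow> theta_flow 0 k A (A * t + B) t = theta_rhs k A (A * t + B) t) (cosparse ?H)"
        using ev by eventually_elim (use 1(1) theta_rhs_eq_flow H in auto)
      from deriv_in[OF rhs this] show ?thesis unfolding 1(2) using hd(1) H by blast
    next
      case 2
      have "eventually (\<lambda>t. t \<in> ?H \<longrightarrow> theta_flow 1 1 A (A * t + B) t = theta1'_rhs A (A * t + B) t) (cosparse ?H)"
        using ev by eventually_elim (use theta1'_rhs_eq_flow H in auto)
      from deriv_in[OF rhs' this] show ?thesis unfolding 2 using hd(2) H by blast
    qed
  next
    case False
    then have zero: "theta 1 (A * t + B) t = 0" if "t \<in> ?H" for t using that by blast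
    have flow0: "theta_flow 0 1 A (A * t + B) t = 0" if t: "t \<in> ?H" for t
    proof (rule DERIV_unique)
      show "((\<lambda>t. theta 1 (A * t + B) t) has_field_derivative theta_flow 0 1 A (A * t + B) t) (at t)"
        using t by (intro hd(1)) (simp add: H)
      show "((\<lambda>t. theta 1 (A * t + B) t) has_field_derivative 0) (at t)"
        by (rule has_field_derivative_transform_within_open[of "\<lambda>_. 0" _ _ ?H])
           (use t zero open_connected_upper_half_plane in auto)
    qed
    have d0: "theta_deriv 0 1 (A * t + B) t = 0" if "t \<in> ?H" for t
      using zero[OF that] by (simp only: theta_eq_theta_deriv)
    (* With this m, the vanishing of the total derivative of \<theta>\<^sub>1 says that \<theta>\<^sub>1'' = m * \<theta>\<^sub>1'. *)
    define m where "m = - 4 * pi * \<i> * A"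
    have d2: "theta_deriv 2 1 (A * t + B) t = m * theta_deriv 1 1 (A * t + B) t" if t: "t \<in> ?H" for t
    proof -
      have "theta_deriv 2 1 (A * t + B) t / (4 * pi * \<i>) = - (A * theta_deriv 1 1 (A * t + B) t)"
        using flow0[OF t] unfolding theta_flow_0 by (simp add: eq_neg_iff_add_eq_0 add.commute)
      then show ?thesis by (simp add: m_def field_simps)
    qed
    define c where "c = (\<lambda>(k::nat) \<tau>. if k = 2 then log_coeff \<tau> else if k = 3 then log_coeff \<tau> - pi^2 * (vartheta 4 \<tau>)^4
        else log_coeff \<tau> - pi^2 * (vartheta 3 \<tau>)^4)"
    have lc: "log_coeff \<in> F"
      unfolding log_coeff_def[abs_def] of_real_power by (intro F_intros(2-) cst v4 et)
    have cF: "c k \<in> F" for k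
      unfolding c_def of_real_power
      by (cases "k = 2"; cases "k = 3") (auto intro!: F_intros(2-) cst v4 lc)
    show ?thesis
    proof (cases "\<exists>t\<in>?H. theta1' (A * t + B) t \<noteq> 0")
      case True
      then obtain \<beta> where "\<beta> \<in> ?H" "theta1' (A * \<beta> + B) \<beta> \<noteq> 0" by blast
      then have ev: "eventually (\<lambda>t. theta1' (A * t + B) t \<noteq> 0) (cosparse ?H)"
        by (rule eventually_nonzero_cosparse[OF hol(2) open_connected_upper_half_plane])
      from f show ?thesis
      proof (cases rule: five_thetas_memberE)
        case (1 k)
        show ?thesis
        proof (cases "k = 1")
          case True
          have "eventually (\<lambda>t. t \<in> ?H \<longrightarrow> theta_flow 0 k A (A * t + B) t = 0) (cosparse ?H)"
            unfolding True using flow0 by (intro always_eventually) blast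
          from deriv_in[OF cst this] show ?thesis unfolding 1(2) using hd(1) H by blast
        next
          case False
          have flow: "theta_flow 0 k A (A * t + B) t
              = (A * (m / 2) + (m^2 / 4 - c k t) / (4 * pi * \<i>)) * theta k (A * t + B) t"
            if t: "Im t > 0" and nz: "theta1' (A * t + B) t \<noteq> 0" for t
          proof -
            have nz: "theta_deriv 1 1 (A * t + B) t \<noteq> 0" using nz theta1'_eq_theta_deriv[OF t] by simp
            note I2 = theta_log_deriv2_eta[OF t]
            have tH: "t \<in> ?H" using t by (simp add: H)
            note v = vartheta_nonzero[OF t]
            note r2 = theta_derivs_at_zero[OF t I2 _ d0[OF tH] nz d2[OF tH]]
            note r3 = theta_derivs_at_zero[OF t theta_log_deriv2_all(1)[OF t I2] _ d0[OF tH] nz d2[OF tH]]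
            note r4 = theta_derivs_at_zero[OF t theta_log_deriv2_all(2)[OF t I2] _ d0[OF tH] nz d2[OF tH]]
            have "theta_deriv 1 k (A * t + B) t = m / 2 * theta_deriv 0 k (A * t + B) t"
               "theta_deriv 2 k (A * t + B) t = (m^2 / 4 - c k t) * theta_deriv 0 k (A * t + B) t"
              using 1(1) False r2(2,3) r3(2,3) r4(2,3) v by (auto simp: c_def vartheta_eq)
            then show ?thesis
              unfolding theta_flow_0 theta_eq_theta_deriv by (simp only: distrib_right mult.assoc times_divide_eq_left times_divide_eq_right)
          qed
          have ev': "eventually (\<lambda>t. t \<in> ?H \<longrightarrow> theta_flow 0 k A (A * t + B) t
              = (A * (m / 2) + (m^2 / 4 - c k t) / (4 * pi * \<i>)) * theta k (A * t + B) t) (cosparse ?H)"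
            using ev by eventually_elim (use flow H in blast)
          have mem: "(\<lambda>t. (A * (m / 2) + (m^2 / 4 - c k t) / (4 * pi * \<i>)) * theta k (A * t + B) t) \<in> F"
            by (intro F_intros(2-) cst th cF)
          from deriv_in[OF mem ev'] show ?thesis unfolding 1(2) using hd(1) H by blast
        qed
      next
        case 2
        have flow: "theta_flow 1 1 A (A * t + B) t
            = (A * m + (3 * m^2 / 4 - 3 * log_coeff t + pi^2 * ((vartheta 3 t)^4 + (vartheta 4 t)^4)) / (4 * pi * \<i>))
              * theta1' (A * t + B) t"
          if t: "Im t > 0" and nz: "theta1' (A * t + B) t \<noteq> 0" for t
        proof -
          have nz: "theta_deriv 1 1 (A * t + B) t \<noteq> 0" using nz theta1'_eq_theta_deriv[OF t] by simp
          have tH: "t \<in> ?H" using t by (simp add: H)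
          show ?thesis
            unfolding theta_flow_1 vartheta_eq theta1'_eq_theta_deriv[OF t]
              theta1_deriv3_at_zero[OF t theta_log_deriv2_eta[OF t] d0[OF tH] nz d2[OF tH]] d2[OF tH]
            by (simp add: algebra_simps add_divide_distrib)
        qed
        have ev': "eventually (\<lambda>t. t \<in> ?H \<longrightarrow> theta_flow 1 1 A (A * t + B) t
            = (A * m + (3 * m^2 / 4 - 3 * log_coeff t + pi^2 * ((vartheta 3 t)^4 + (vartheta 4 t)^4)) / (4 * pi * \<i>))
              * theta1' (A * t + B) t) (cosparse ?H)"
          using ev by eventually_elim (use flow H in blast)
        have mem: "(\<lambda>t. (A * m + (3 * m^2 / 4 - 3 * log_coeff t + pi^2 * ((vartheta 3 t)^4 + (vartheta 4 t)^4)) / (4 * pi * \<i>))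
              * theta1' (A * t + B) t) \<in> F"
          unfolding of_real_power by (intro F_intros(2-) cst th' lc v4)
        from deriv_in[OF mem ev'] show ?thesis unfolding 2 using hd(2) H by blast
      qed
    next
      case False
      then have z': "theta1' (A * t + B) t = 0" if "t \<in> ?H" for t using that by blast
      have zk: "theta k (A * t + B) t = 0" if t: "t \<in> ?H" and k: "k \<in> {1, 2, 3, 4}" for k t
      proof -
        have t': "Im t > 0" using t by (simp add: H)
        note I2 = theta_log_deriv2_eta[OF t']
        have d1: "theta_deriv 1 1 (A * t + B) t = 0" using z'[OF t] theta1'_eq_theta_deriv[OF t'] by simp
        show ?thesis
          using I2[of "A * t + B"] theta_log_deriv2_all(1)[OF t' I2, of "A * t + B"]
            theta_log_deriv2_all(2)[OF t' I2, of "A * t + B"] k vartheta_nonzero[OF t'] d0[OF t] d1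
          unfolding theta_eq_theta_deriv by auto
      qed
      have f0: "f t = 0" if "t \<in> ?H" for t
        using f by (cases rule: five_thetas_memberE) (use z' zk that in auto)
      have "eventually (\<lambda>t. t \<in> ?H \<longrightarrow> (0::complex) = 0) (cosparse ?H)" by simp
      moreover have "(f has_field_derivative 0) (at t)" if "t \<in> ?H" for t
        by (rule has_field_derivative_transform_within_open[of "\<lambda>_. 0" _ _ ?H])
           (use that f0 open_connected_upper_half_plane in auto)
      ultimately show ?thesis using deriv_in[OF cst[of 0], of "\<lambda>_. 0"] by blast
    qed
  qed
  moreover have "f holomorphic_on ?H" if "f \<in> five_thetas A B" for f
    using that by (cases rule: five_thetas_memberE) (use hol in auto)
  ultimately show ?thesis unfolding differentially_closed_over_def F_def by blast
qed

theorem theorem10: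
  fixes A B :: complex
  shows
    "differentially_closed_over upper_half_plane (coeff_field A) (five_thetas A B)
     \<and> (\<forall>\<tau>\<in>upper_half_plane. theta 1 (A * \<tau> + B) \<tau> \<noteq> 0 \<longrightarrow>
          (\<forall>k\<in>{1, 2, 3, 4}.
             ((\<lambda>t. theta k (A * t + B) t) has_field_derivative
                theta_rhs k A (A * \<tau> + B) \<tau>) (at \<tau>))
          \<and> ((\<lambda>t. theta1' (A * t + B) t) has_field_derivative
                theta1'_rhs A (A * \<tau> + B) \<tau>) (at \<tau>))
     \<and> (\<forall>\<tau>\<in>upper_half_plane. theta 1 (A * \<tau> + B) \<tau> = 0 \<longrightarrow>
          (\<forall>k\<in>{1, 2, 3, 4}. \<exists>D.
             ((\<lambda>t. theta k (A * t + B) t) has_field_derivative D) (at \<tau>)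
             \<and> ((\<lambda>(A', B'). theta_rhs k A' (A' * \<tau> + B') \<tau>) \<longlongrightarrow> D)
                  (at (A, B) within regular_params \<tau>))
          \<and> (\<exists>D.
             ((\<lambda>t. theta1' (A * t + B) t) has_field_derivative D) (at \<tau>)
             \<and> ((\<lambda>(A', B'). theta1'_rhs A' (A' * \<tau> + B') \<tau>) \<longlongrightarrow> D)
                  (at (A, B) within regular_params \<tau>)))"
proof (intro conjI ballI impI)
  show "differentially_closed_over upper_half_plane (coeff_field A) (five_thetas A B)"
    by (rule differentially_closed_thetas)
next
  fix \<tau> k assume \<tau>: "\<tau> \<in> upper_half_plane" and nz: "theta 1 (A * \<tau> + B) \<tau> \<noteq> 0" and k: "k \<in> {1, 2, 3, 4::nat}"
  have t: "Im \<tau> > 0" using \<tau> by (simp add: upper_half_plane_def)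
  show "((\<lambda>t. theta k (A * t + B) t) has_field_derivative theta_rhs k A (A * \<tau> + B) \<tau>) (at \<tau>)"
    unfolding theta_rhs_eq_flow[OF t k nz] by (rule theta_flow_has_derivative(1)[OF t])
next
  fix \<tau> assume \<tau>: "\<tau> \<in> upper_half_plane" and nz: "theta 1 (A * \<tau> + B) \<tau> \<noteq> 0"
  have t: "Im \<tau> > 0" using \<tau> by (simp add: upper_half_plane_def)
  show "((\<lambda>t. theta1' (A * t + B) t) has_field_derivative theta1'_rhs A (A * \<tau> + B) \<tau>) (at \<tau>)"
    unfolding theta1'_rhs_eq_flow[OF t nz] by (rule theta_flow_has_derivative(2)[OF t])
next
  fix \<tau> k assume \<tau>: "\<tau> \<in> upper_half_plane" and k: "k \<in> {1, 2, 3, 4::nat}"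
  have t: "Im \<tau> > 0" using \<tau> by (simp add: upper_half_plane_def)
  show "\<exists>D. ((\<lambda>t. theta k (A * t + B) t) has_field_derivative D) (at \<tau>)
             \<and> ((\<lambda>(A', B'). theta_rhs k A' (A' * \<tau> + B') \<tau>) \<longlongrightarrow> D)
                  (at (A, B) within regular_params \<tau>)"
    using theta_flow_has_derivative(1)[OF t] rhs_tendsto_flow(1)[OF t k] by blast
next
  fix \<tau> assume \<tau>: "\<tau> \<in> upper_half_plane"
  have t: "Im \<tau> > 0" using \<tau> by (simp add: upper_half_plane_def)
  show "\<exists>D. ((\<lambda>t. theta1' (A * t + B) t) has_field_derivative D) (at \<tau>)
             \<and> ((\<lambda>(A', B'). theta1'_rhs A' (A' * \<tau> + B') \<tau>) \<longlongrightarrow> D)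
                  (at (A, B) within regular_params \<tau>)"
    using theta_flow_has_derivative(2)[OF t] rhs_tendsto_flow(2)[OF t] by blast
qed

end
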